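(* Let $n\ge1$. Consider the Riemann--Hilbert problem of finding $\widehat{A_n}:\mathbb{C}\setminus\Sigma\to\mathcal{M}_D(\mathbb{C})$ such that: (1) $\widehat{A_n}$ is analytic on $\mathbb{C}\setminus\Sigma$; (2) $\widehat{A_n}$ has non-tangential boundary values $\widehat{A_n}^{+}$ (from the left) and $\widehat{A_n}^-$ (from the right) on $\Sigma\setminus\{0\}$, which are continuous functions on $\Sigma\setminus\{0\}$ and satisfy $$\widehat{A_n}^+(x)=\widehat{A_n}^-(x)\begin{pmatrix}1&0&\mathbf{0}\\-e^{-V(x)}\chi_{\mathbb{R}}(x)&1&\mathbf{0}\\-\boldsymbol{\omega}(x)^{\mathsf T}&\mathbf{0}&\mathbb{I}_{D-2}\end{pmatrix},\qquad x\in\Sigma\setminus\{0\};$$ (3) $\widehat{A_n}$ is bounded in a neighbourhood of $0$; (4) $\widehat{A_n}(z)=\big(\mathbb{I}+\mathcal{O}(z^{-1})\big)\operatorname{diag}\big(z^{-n-D+2},z^n,z,\dots,z\big)$ as $z\to\infty$. The unique solution of this Riemann--Hilbert problem is $\widehat{A_n}=A_n^{-\mathsf T}$ (inverse transpose), where $A_n$ is the unique solution of the Riemann--Hilbert problem recalled in the context, and it satisfies $$(\widehat{A_n})_{22}=(A_n^{-1})_{22}=P_n,$$ the $n$th monic Sobolev orthogonal polynomial.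
   Context: Standing assumptions: $D\ge 4$ is an even integer, $\lambda>0$, and $V$ is a real polynomial with $V(x)=\gamma x^D+\mathcal{O}(x^{D-1})$, $\gamma>0$. $\mathcal{M}_D(\mathbb{C})$ is the space of complex $D\times D$ matrices; $\chi_A$ is the indicator function of $A$. Sobolev orthogonal polynomials: $\langle P,Q\rangle_S=\int_{\mathbb{R}}P(x)Q(x)e^{-V(x)}dx+\lambda\int_{\mathbb{R}}P'(x)Q'(x)e^{-V(x)}dx$ on real polynomials. $P_n$ ($n\ge0$) is the unique monic polynomial of degree $n$ such that $\langle P_n,P_m\rangle_S=0$ for all $n\ne m$. Sibuya solutions: let $\varphi(z)=(\gamma^{-1}V(z))^{1/D}$ on a neighbourhood of infinity, with the branch such that $\varphi(z)=z(1+\mathcal{O}(z^{-1}))$ as $z\to\infty$, and let $\varphi^{-1}$ be its inverse near infinity. Fix $\varrho>0$ sufficiently large that $\varphi$ and $\varphi^{-1}$ are both injective on $\{|z|>\frac12\varrho\}$, $\frac12|z|\le|\varphi(z)|\le 2|z|$ for $|z|\ge\varrho$, and $\frac{(D-1)\varrho^{-D}}{\gamma D}\le\frac12$. For $k\in\{0,\dots,2D-1\}$ put $\Omega_k=\varphi^{-1}\big(\{w\in\mathbb{C}:|w|\ge\varrho,\ \pi\frac{k-1}{D}\le\arg w\le\pi\frac{k+1}{D}\}\big)$ (arguments modulo $2\pi$). $F_k$ is the unique entire function with $(-1)^kV'F_k'-F_k''+\lambda^{-1}F_k=0$ on $\mathbb{C}$ and $F_k(z)=1+\mathcal{O}(|z|^{2-D})$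 as $|z|\to\infty$, $z\in\Omega_k$. Define $Y_k(z)=i^k e^{-i\pi/4}e^{-\frac12V(z)}F_k(z)$ for $k$ even and $Y_k(z)=i^ke^{-i\pi/4}\lambda\,e^{\frac12V(z)}F_k'(z)$ for $k$ odd. Wronskians: $W[f,g]=fg'-f'g$. The Wronskians $W[Y_k,Y_j]$ are constants and $W[Y_0,Y_D]\ne0$. For $j\in\{1,\dots,D-1\}\setminus\{D/2\}$: $\beta_j=-\frac{W[Y_D,Y_{2j}]}{W[Y_0,Y_D]}$ and $\kappa_j=\frac{W[Y_0,Y_{2j}]}{W[Y_0,Y_D]}$. Contours: $\Sigma_k=e^{2\pi ik/D}[0,+\infty)$ for $0\le k\le D-1$ and $\Sigma=\bigcup_{k=0}^{D-1}\Sigma_k$. All rays are oriented away from the origin, except $\Sigma_{D/2}=(-\infty,0]$, which is oriented towards the origin. "Left" and "right" are relative to the orientation. Weights: for $j\in\{1,\dots,D-1\}\setminus\{D/2\}$ and $z\in\Sigma$, $\omega_j(z)=Y_{2j}(z)e^{-\frac12V(z)}\chi_{\Sigma_j}(z)-\beta_jY_0(z)e^{-\frac12V(z)}\chi_{\Sigma_0}(z)+\kappa_jY_D(z)e^{-\frac12V(z)}\chi_{\Sigma_{D/2}}(z)$, and $\boldsymbol{\omega}=(\omega_1,\dots,\omega_{D/2-1},\omega_{D/2+1},\dots,\omega_{D-1})$ (row vector of length $D-2$). The matrix $A_n$ ($n\ge1$): the unique function $A_n:\mathbb{C}\setminus\Sigma\to\mathcal{M}_D(\mathbb{C})$ that is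 analytic on $\mathbb{C}\setminus\Sigma$; has continuous non-tangential boundary values $A_n^\pm$ (left/right) on $\Sigma\setminus\{0\}$ with $A_n^+(x)=A_n^-(x)\begin{pmatrix}1&e^{-V(x)}\chi_{\mathbb{R}}(x)&\boldsymbol{\omega}(x)\\0&1&\mathbf{0}\\ \mathbf{0}&\mathbf{0}&\mathbb{I}_{D-2}\end{pmatrix}$; is bounded near $0$; and satisfies $A_n(z)=(\mathbb{I}+\mathcal{O}(z^{-1}))\operatorname{diag}(z^{n+D-2},z^{-n},z^{-1},\dots,z^{-1})$ as $z\to\infty$. It exists and $\det A_n\equiv1$.
   Formalization: Non-tangential boundary values, for both Riemann–Hilbert problems, are required to be attained locally uniformly in the boundary point on Σ\{0}; with merely pointwise non-tangential limits the asserted uniqueness is false. *)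

theory Defs
  imports
    "HOL-Complex_Analysis.Complex_Analysis"
    "Jordan_Normal_Form.Determinant"
    "Jordan_Normal_Form.Gauss_Jordan_Elimination"
begin

section \<open>Sobolev orthogonal polynomials\<close>

definition sobolev_inner :: "real poly \<Rightarrow> real \<Rightarrow> real poly \<Rightarrow> real poly \<Rightarrow> real" where
  "sobolev_inner V lam P Q =
     (LINT x|lborel. poly P x * poly Q x * exp (- poly V x))
     + lam * (LINT x|lborel. poly (pderiv P) x * poly (pderiv Q) x * exp (- poly V x))"

definition monic_sobolev_orthogonal :: "real poly \<Rightarrow> real \<Rightarrow> (nat \<Rightarrow> real poly) \<Rightarrow> bool" where
  "monic_sobolev_orthogonal V lam P \<longleftrightarrow>
     (\<forall>n. degree (P n) = n \<and> lead_coeff (P n) = 1) \<and>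
     (\<forall>n m. n \<noteq> m \<longrightarrow> sobolev_inner V lam (P n) (P m) = 0)"

definition cpoly :: "real poly \<Rightarrow> complex \<Rightarrow> complex" where
  "cpoly V z = poly (map_poly complex_of_real V) z"

section \<open>Sibuya solutions\<close>

text \<open>\<open>\<phi>\<close> is the branch of \<open>(V / \<gamma>)\<^bsup>1/D\<^esup>\<close> asymptotic to the identity, holomorphic on the
  neighbourhood \<open>{z. R < norm z}\<close> of infinity, \<open>\<psi>\<close> is its inverse near infinity, and \<open>\<rho>\<close> is
  large enough that both are defined and injective outside the disc of radius \<open>\<rho> / 2\<close> and that the
  remaining size conditions hold.\<close>

definition sibuya_coordinate ::
    "real poly \<Rightarrow> real \<Rightarrow> (complex \<Rightarrow> complex) \<Rightarrow> (complex \<Rightarrow> complex) \<Rightarrow> bool" where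
  "sibuya_coordinate V \<rho> \<phi> \<psi> \<longleftrightarrow>
     (let D = degree V; \<gamma> = lead_coeff V in
      \<rho> > 0 \<and>
      (\<exists>R. 0 < R \<and> R \<le> \<rho> / 2 \<and>
         \<phi> holomorphic_on {z. R < norm z} \<and>
         (\<forall>z. R < norm z \<longrightarrow> \<phi> z ^ D = cpoly V z / complex_of_real \<gamma>) \<and>
         (\<lambda>z. \<phi> z / z - 1) \<in> O[at_infinity](\<lambda>z. 1 / z) \<and>
         \<psi> holomorphic_on {w. \<rho> / 2 < norm w} \<and>
         (\<forall>w. \<rho> / 2 < norm w \<longrightarrow> R < norm (\<psi> w) \<and> \<phi> (\<psi> w) = w) \<and>
         (\<forall>\<^sub>F z in at_infinity. \<psi> (\<phi> z) = z)) \<and>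
      inj_on \<phi> {z. \<rho> / 2 < norm z} \<and>
      inj_on \<psi> {w. \<rho> / 2 < norm w} \<and>
      (\<forall>z. \<rho> \<le> norm z \<longrightarrow> norm z / 2 \<le> norm (\<phi> z) \<and> norm (\<phi> z) \<le> 2 * norm z) \<and>
      (real D - 1) * \<rho> powi (- int D) / (\<gamma> * real D) \<le> 1 / 2)"

definition sibuya_sector :: "nat \<Rightarrow> real \<Rightarrow> (complex \<Rightarrow> complex) \<Rightarrow> nat \<Rightarrow> complex set" where
  "sibuya_sector D \<rho> \<psi> k =
     \<psi> ` {rcis r t | r t. \<rho> \<le> r \<and> pi * (real k - 1) / real D \<le> t \<and> t \<le> pi * (real k + 1) / real D}"

definition sibuya_solution ::
    "real poly \<Rightarrow> real \<Rightarrow> real \<Rightarrow> (complex \<Rightarrow> complex) \<Rightarrow> nat \<Rightarrow> (complex \<Rightarrow> complex) \<Rightarrow> bool" where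
  "sibuya_solution V lam \<rho> \<psi> k f \<longleftrightarrow>
     (let D = degree V in
      f holomorphic_on UNIV \<and>
      (\<forall>z. (-1) ^ k * cpoly (pderiv V) z * deriv f z - (deriv ^^ 2) f z
             + f z / complex_of_real lam = 0) \<and>
      (\<lambda>z. f z - 1)
        \<in> O[inf at_infinity (principal (sibuya_sector D \<rho> \<psi> k))](\<lambda>z. complex_of_real (norm z powi (2 - int D))))"

definition sibuya_Y ::
    "real poly \<Rightarrow> real \<Rightarrow> (nat \<Rightarrow> complex \<Rightarrow> complex) \<Rightarrow> nat \<Rightarrow> complex \<Rightarrow> complex" where
  "sibuya_Y V lam F k z =
     (if even k
      then \<i> ^ k * cis (- pi / 4) * exp (- cpoly V z / 2) * F k z
      else \<i> ^ k * cis (- pi / 4) * complex_of_real lam * exp (cpoly V z / 2) * deriv (F k) z)"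

definition wronskian ::
    "(complex \<Rightarrow> complex) \<Rightarrow> (complex \<Rightarrow> complex) \<Rightarrow> complex \<Rightarrow> complex" where
  "wronskian f g z = f z * deriv g z - deriv f z * g z"

text \<open>The Wronskians of the functions \<open>Y\<^sub>k\<close> are constant; their value is read off at \<open>0\<close>.\<close>

definition stokes_\<beta> ::
    "real poly \<Rightarrow> real \<Rightarrow> (nat \<Rightarrow> complex \<Rightarrow> complex) \<Rightarrow> nat \<Rightarrow> complex" where
  "stokes_\<beta> V lam F j =
     (let D = degree V; Y = sibuya_Y V lam F in
      - (wronskian (Y D) (Y (2 * j)) 0 / wronskian (Y 0) (Y D) 0))"

definition stokes_\<kappa> ::
    "real poly \<Rightarrow> real \<Rightarrow> (nat \<Rightarrow> complex \<Rightarrow> complex) \<Rightarrow> nat \<Rightarrow> complex" where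
  "stokes_\<kappa> V lam F j =
     (let D = degree V; Y = sibuya_Y V lam F in
      wronskian (Y 0) (Y (2 * j)) 0 / wronskian (Y 0) (Y D) 0)"

section \<open>Contours and weights\<close>

definition ray :: "nat \<Rightarrow> nat \<Rightarrow> complex set" where
  "ray D k = {rcis r (2 * pi * real k / real D) | r. 0 \<le> r}"

definition star :: "nat \<Rightarrow> complex set" where
  "star D = (\<Union>k<D. ray D k)"

text \<open>Unit tangent vector in the direction of the orientation: all rays point away from the origin,
  except the negative half-line.\<close>

definition ray_tangent :: "nat \<Rightarrow> nat \<Rightarrow> complex" where
  "ray_tangent D k = (if k = D div 2 then 1 else cis (2 * pi * real k / real D))"

definition sibuya_weight ::
    "real poly \<Rightarrow> real \<Rightarrow> (nat \<Rightarrow> complex \<Rightarrow> complex) \<Rightarrow> nat \<Rightarrow> complex \<Rightarrow> complex" where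
  "sibuya_weight V lam F j z =
     (let D = degree V; Y = sibuya_Y V lam F in
      Y (2 * j) z * exp (- cpoly V z / 2) * indicator (ray D j) z
      - stokes_\<beta> V lam F j * Y 0 z * exp (- cpoly V z / 2) * indicator (ray D 0) z
      + stokes_\<kappa> V lam F j * Y D z * exp (- cpoly V z / 2) * indicator (ray D (D div 2)) z)"

section \<open>Riemann--Hilbert problems\<close>

text \<open>Convergence of \<open>f\<close> to \<open>g\<close> on \<open>S\<close>, non-tangentially from the left of the direction \<open>d\<close>: in every
  Stolz angle \<open>\<theta> \<le> \<alpha> \<le> pi - \<theta>\<close> the limit exists, locally uniformly in the boundary point. Local
  uniformity is the usual meaning of continuous boundary values in this setting. Merely pointwise
  non-tangential limits would not determine the solution: there is an entire function \<open>E\<close> tending to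
  \<open>0\<close> outside a horizontal half-strip, and the non-constant function \<open>z \<mapsto> E (1 / (z - p))\<close>, for \<open>p\<close>
  on the real line and a half-strip in the upper half-plane, has the same continuous pointwise
  non-tangential boundary values from both sides of the line. Limits from the right are limits
  from the left of \<open>- d\<close>.\<close>

definition nontangential_limit ::
    "complex \<Rightarrow> complex set \<Rightarrow> (complex \<Rightarrow> complex) \<Rightarrow> (complex \<Rightarrow> complex) \<Rightarrow> bool" where
  "nontangential_limit d S f g \<longleftrightarrow>
     (\<forall>K \<theta>. compact K \<and> K \<subseteq> S \<and> 0 < \<theta> \<and> \<theta> < pi / 2 \<longrightarrow>
        uniform_limit (K \<times> {\<theta>..pi - \<theta>})
          (\<lambda>t (x, \<alpha>). f (x + complex_of_real t * d * cis \<alpha>))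
          (\<lambda>(x, \<alpha>). g x) (at_right 0))"

text \<open>Solutions of the problem with jump matrix \<open>J\<close> on \<open>star D\<close> and asymptotics
  \<open>(I + O(1/z)) diag (z powi e 0, \<dots>, z powi e (D - 1))\<close>. Matrix indices start at \<open>0\<close>, and only the
  values of \<open>B\<close> off \<open>star D\<close> are relevant.\<close>

definition rh_solution ::
    "nat \<Rightarrow> (complex \<Rightarrow> complex mat) \<Rightarrow> (nat \<Rightarrow> int) \<Rightarrow> (complex \<Rightarrow> complex mat) \<Rightarrow> bool" where
  "rh_solution D J e B \<longleftrightarrow>
     (\<forall>z \<in> - star D. B z \<in> carrier_mat D D) \<and>
     (\<forall>i<D. \<forall>j<D. (\<lambda>z. B z $$ (i, j)) holomorphic_on - star D) \<and>
     (\<exists>Bplus Bminus.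
        (\<forall>x \<in> star D - {0}. Bplus x \<in> carrier_mat D D \<and> Bminus x \<in> carrier_mat D D) \<and>
        (\<forall>i<D. \<forall>j<D.
           continuous_on (star D - {0}) (\<lambda>x. Bplus x $$ (i, j)) \<and>
           continuous_on (star D - {0}) (\<lambda>x. Bminus x $$ (i, j)) \<and>
           (\<forall>k<D.
              nontangential_limit (ray_tangent D k) (ray D k - {0})
                (\<lambda>z. B z $$ (i, j)) (\<lambda>x. Bplus x $$ (i, j)) \<and>
              nontangential_limit (- ray_tangent D k) (ray D k - {0})
                (\<lambda>z. B z $$ (i, j)) (\<lambda>x. Bminus x $$ (i, j)))) \<and>
        (\<forall>x \<in> star D - {0}. Bplus x = Bminus x * J x)) \<and>
     (\<exists>r>0. \<forall>i<D. \<forall>j<D. bounded ((\<lambda>z. B z $$ (i, j)) ` (ball 0 r - star D))) \<and>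
     (\<exists>E. (\<forall>z. E z \<in> carrier_mat D D) \<and>
        (\<forall>i<D. \<forall>j<D. (\<lambda>z. E z $$ (i, j)) \<in> O[inf at_infinity (principal (- star D))](\<lambda>z. 1 / z)) \<and>
        (\<forall>\<^sub>F z in inf at_infinity (principal (- star D)).
           B z = (1\<^sub>m D + E z) * mat_diag D (\<lambda>i. z powi e i)))"

text \<open>The row vector \<open>\<omega>\<close> omits the index \<open>D div 2\<close>: the matrix index \<open>i \<in> {2..<D}\<close> carries the weight
  with number \<open>i - 1\<close> up to \<open>D div 2 - 1\<close>, and with number \<open>i\<close> from \<open>D div 2 + 1\<close> on.\<close>

definition weight_number :: "nat \<Rightarrow> nat \<Rightarrow> nat" where
  "weight_number D i = (if i \<le> D div 2 then i - 1 else i)"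

definition jump_A ::
    "real poly \<Rightarrow> real \<Rightarrow> (nat \<Rightarrow> complex \<Rightarrow> complex) \<Rightarrow> complex \<Rightarrow> complex mat" where
  "jump_A V lam F x =
     (let D = degree V in
      mat D D (\<lambda>(i, j).
        if i = j then 1
        else if i = 0 \<and> j = 1 then exp (- cpoly V x) * indicator \<real> x
        else if i = 0 then sibuya_weight V lam F (weight_number D j) x
        else 0))"

definition jump_A_hat ::
    "real poly \<Rightarrow> real \<Rightarrow> (nat \<Rightarrow> complex \<Rightarrow> complex) \<Rightarrow> complex \<Rightarrow> complex mat" where
  "jump_A_hat V lam F x =
     (let D = degree V in
      mat D D (\<lambda>(i, j).
        if i = j then 1
        else if i = 1 \<and> j = 0 then - exp (- cpoly V x) * indicator \<real> x
        else if j = 0 then - sibuya_weight V lam F (weight_number D i) x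
        else 0))"

definition solves_rhp_A ::
    "real poly \<Rightarrow> real \<Rightarrow> (nat \<Rightarrow> complex \<Rightarrow> complex) \<Rightarrow> nat \<Rightarrow> (complex \<Rightarrow> complex mat) \<Rightarrow> bool" where
  "solves_rhp_A V lam F n =
     rh_solution (degree V) (jump_A V lam F)
       (\<lambda>i. if i = 0 then int n + int (degree V) - 2 else if i = 1 then - int n else - 1)"

definition solves_rhp_A_hat ::
    "real poly \<Rightarrow> real \<Rightarrow> (nat \<Rightarrow> complex \<Rightarrow> complex) \<Rightarrow> nat \<Rightarrow> (complex \<Rightarrow> complex mat) \<Rightarrow> bool" where
  "solves_rhp_A_hat V lam F n =
     rh_solution (degree V) (jump_A_hat V lam F)
       (\<lambda>i. if i = 0 then - int n - int (degree V) + 2 else if i = 1 then int n else 1)"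

text \<open>Meaningful for invertible \<open>M\<close> only.\<close>

definition mat_inv :: "complex mat \<Rightarrow> complex mat" where
  "mat_inv M = the (mat_inverse M)"

end

theory Submission
  imports Defs
begin

text \<open>
  Duality. Inverting and transposing turns the jump matrix \<open>J\<close> into \<open>J\<^bsup>-T\<^esup>\<close> and
  \<open>diag (z\<^sup>e)\<close> into \<open>diag (z\<^bsup>-e\<^esup>)\<close>, so the inverse transpose of \<open>A\<close> solves the dual problem once \<open>A\<close>
  is known to be invertible. Both \<open>det A = 1\<close> (\<open>det_eq_1\<close>) and uniqueness
  (\<open>rh_solution_unique\<close>, applied to \<open>B A\<^sup>T\<close>) come from one principle: a function that is holomorphic
  off the rays, bounded near the origin and has the same boundary values from both sides extends to an
  entire function (\<open>ray_boundary_values_no_jump\<close>), and an entire function with a limit at infinity is constant.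
  Boundary values are compatible with sums and products, hence with determinants and cofactors, which
  are polynomials in the entries.

  The entry with indices \<open>(1, 1)\<close>. In the second row of a solution of the dual problem only the first
  column jumps. The other entries are therefore entire, and their growth makes the diagonal one a monic
  polynomial \<open>p\<close> of degree \<open>n\<close> and the rest constants \<open>c\<^sub>i\<close>. The entry in the first column is
  \<open>O(z\<^bsup>-(n+D-1)\<^esup>)\<close> and jumps by \<open>- (p e\<^bsup>-V\<^esup> + \<Sum> c\<^sub>i \<omega>\<^sub>i)\<close>, where the first term
  lives on the real line. By Cauchy's theorem in each sector between two rays, the integral
  of this jump over all rays against a polynomial \<open>s\<close> of degree at most \<open>n + D - 3\<close> is zero
  (\<open>ray_jump_primitives\<close>).

  Now let \<open>s = q + \<lambda> (V' q' - q'')\<close> with \<open>degree q < n\<close>. Integration by parts identifies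
  \<open>\<integral> p s e\<^bsup>-V\<^esup>\<close> over the real line with the Sobolev product of \<open>p\<close> and \<open>q\<close>. The weights drop out:
  \<open>s = \<lambda> L q\<close>, where \<open>L\<close> is the formally self-adjoint operator, with respect to \<open>e\<^bsup>-V\<^esup>\<close>, that annihilates
  \<open>F\<^sub>k\<close> for even \<open>k\<close>. Lagrange's identity gives \<open>Y\<^sub>k e\<^bsup>-V/2\<^esup> s\<close> an explicit primitive. It vanishes at
  infinity along the ray in the middle of the sector of \<open>F\<^sub>k\<close>, and its values at the origin cancel because
  \<open>Y\<^bsub>2j\<^esub> - \<beta>\<^sub>j Y\<^sub>0 - \<kappa>\<^sub>j Y\<^sub>D\<close> and its derivative vanish there (\<open>sibuya_boundary_form_connection\<close>).
  Hence \<open>p\<close> is orthogonal to all polynomials of smaller degree, and \<open>p = P\<^sub>n\<close> because the product is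
  positive definite (\<open>moments_characterize_sobolev\<close>).

  The coefficients \<open>\<beta>\<^sub>j\<close> and \<open>\<kappa>\<^sub>j\<close> have this property only if the Wronskian of \<open>Y\<^sub>0\<close> and \<open>Y\<^sub>D\<close> is nonzero.
  This is an energy argument on the real line: \<open>Re (e\<^bsup>-V\<^esup> F' F\<^sup>*)\<close>, with \<open>F\<^sup>*\<close> the complex conjugate,
  increases and tends to \<open>0\<close> on the side where \<open>F\<close> tends to \<open>1\<close>, so it is negative at \<open>0\<close> for \<open>F\<^sub>0\<close> and positive for \<open>F\<^sub>D\<close>
  (\<open>energy_negative\<close>, \<open>sibuya_wronskian_nonzero\<close>).
\<close>

section \<open>The rays\<close>

definition udir :: "nat \<Rightarrow> nat \<Rightarrow> complex" where
  "udir D k = cis (2 * pi * real k / real D)"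

definition open_ray :: "complex \<Rightarrow> complex set" where
  "open_ray u = {complex_of_real r * u | r. 0 < r}"

lemma norm_udir [simp]: "norm (udir D k) = 1"
  by (simp add: udir_def)

lemma udir_nonzero [simp]: "udir D k \<noteq> 0"
  by (simp add: udir_def)

lemma udir_0 [simp]: "udir D 0 = 1"
  by (simp add: udir_def)

lemma udir_D [simp]: "D > 0 \<Longrightarrow> udir D D = 1"
  by (simp add: udir_def)

lemma udir_power_D [simp]: "D > 0 \<Longrightarrow> udir D k ^ D = 1"
proof -
  assume "D > 0"
  then have *: "real D * (2 * pi * real k / real D) = 2 * pi * real k" by simp
  have "udir D k ^ D = cis (2 * pi * real k)" by (simp only: udir_def Complex.DeMoivre *)
  also have "\<dots> = 1" by (rule cis_multiple_2pi) auto
  finally show "udir D k ^ D = 1" .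
qed

lemma udir_half: "even D \<Longrightarrow> D > 0 \<Longrightarrow> udir D (D div 2) = -1"
  by (auto simp: udir_def elim!: evenE)

lemma udir_inj: "j < D \<Longrightarrow> k < D \<Longrightarrow> udir D j = udir D k \<Longrightarrow> j = k"
  using Complex.bij_betw_roots_unity[of D] unfolding bij_betw_def inj_on_def udir_def by auto

lemma ray_eq: "ray D k = {complex_of_real r * udir D k | r. 0 \<le> r}"
  by (auto simp: ray_def udir_def rcis_def)

lemma ray_minus_0: "ray D k - {0} = open_ray (udir D k)"
  unfolding ray_eq open_ray_def by (force simp: less_le)

lemma open_ray_udir_subset_star: "k < D \<Longrightarrow> open_ray (udir D k) \<subseteq> star D - {0}"
  unfolding star_def ray_minus_0[symmetric] by auto

lemma norm_of_real_mult_udir [simp]: "norm (complex_of_real r * udir D k) = \<bar>r\<bar>"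
  by (simp add: norm_mult)

lemma zero_in_star: "D > 0 \<Longrightarrow> 0 \<in> star D"
  unfolding star_def ray_eq by force

lemma ray_unique:
  assumes "j < D" "k < D" "z \<noteq> 0" "z \<in> ray D j" "z \<in> ray D k"
  shows "j = k"
proof -
  obtain r s where rs: "r \<ge> 0" "z = of_real r * udir D j" "s \<ge> 0" "z = of_real s * udir D k"
    using assms unfolding ray_eq by blast
  have "r = norm z" using rs(1,2) by simp
  moreover have "s = norm z" using rs(3,4) by simp
  ultimately have "of_real r * udir D j = of_real r * udir D k" "r \<noteq> 0"
    using rs assms by auto
  then show ?thesis using udir_inj[OF assms(1,2)] by simp
qed

text \<open>This description makes the star visibly closed and settles whether a rotated point lies on it.\<close>
lemma star_iff:
  assumes "D > 0"
  shows "z \<in> star D \<longleftrightarrow> z ^ D \<in> \<real>\<^sub>\<ge>\<^sub>0"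
proof
  assume "z \<in> star D"
  then obtain k r where "r \<ge> 0" "z = of_real r * udir D k"
    unfolding star_def ray_eq by blast
  then have "z ^ D = of_real (r ^ D)" using assms by (simp add: power_mult_distrib)
  then show "z ^ D \<in> \<real>\<^sub>\<ge>\<^sub>0" using \<open>r \<ge> 0\<close> by simp
next
  assume "z ^ D \<in> \<real>\<^sub>\<ge>\<^sub>0"
  then obtain r where r: "r \<ge> 0" "z ^ D = of_real r" by (auto elim: nonneg_Reals_cases)
  show "z \<in> star D"
  proof (cases "z = 0")
    case True
    then show ?thesis using zero_in_star assms by simp
  next
    case False
    have "r = norm z ^ D" using r by (metis norm_power norm_of_real abs_of_nonneg)
    then have "(z / of_real (norm z)) ^ D = 1" using False r by (simp add: power_divide)
    then obtain k where "k < D" "z / of_real (norm z) = udir D k"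
      using bij_betw_imp_surj_on[OF Complex.bij_betw_roots_unity[of D]] assms unfolding udir_def by blast
    then have "z = of_real (norm z) * udir D k" using False by (simp add: field_simps)
    then show ?thesis unfolding star_def ray_eq using \<open>k < D\<close> norm_ge_zero[of z] by blast
  qed
qed

lemma closed_star: "D > 0 \<Longrightarrow> closed (star D)"
proof -
  assume "D > 0"
  then have "star D = (\<lambda>z. z ^ D) -` \<real>\<^sub>\<ge>\<^sub>0" by (auto simp: star_iff)
  then show ?thesis by (auto intro!: closed_vimage continuous_intros closed_nonneg_Reals_complex)
qed

lemma closed_ray: "closed (ray D k)"
proof -
  have "ray D k = (\<lambda>z. z / udir D k) -` \<real>\<^sub>\<ge>\<^sub>0"
    unfolding ray_eq by (auto elim!: nonneg_Reals_cases simp: field_simps)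
  then show ?thesis by (auto intro!: closed_vimage continuous_intros closed_nonneg_Reals_complex)
qed

lemma mult_cis_notin_star:
  assumes "D > 0" "z \<noteq> 0" "z \<in> star D" "0 < t" "t < 2 * pi / real D"
  shows "z * cis t \<notin> star D"
proof
  assume "z * cis t \<in> star D"
  then obtain s where s: "s \<ge> 0" "(z * cis t) ^ D = of_real s"
    using star_iff[OF assms(1)] by (auto elim: nonneg_Reals_cases)
  obtain r where r: "r \<ge> 0" "z ^ D = of_real r"
    using star_iff[OF assms(1)] assms(3) by (auto elim: nonneg_Reals_cases)
  have "r \<noteq> 0" using r assms(1,2) by auto
  have eq: "of_real r * cis (real D * t) = (of_real s :: complex)"
    using s r by (simp add: power_mult_distrib Complex.DeMoivre)
  have "norm (of_real r * cis (real D * t)) = norm (of_real s :: complex)" using eq by simp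
  then have "r = s" using r s by (simp add: norm_mult)
  then have "cis (real D * t) = 1" using eq \<open>r \<noteq> 0\<close> by simp
  then have "cos (real D * t) = 1" by (metis cis.sel(1) one_complex.sel(1))
  moreover have "0 < real D * t" "real D * t < 2 * pi" using assms by (auto simp: field_simps)
  moreover obtain m :: int where "real D * t = of_int m * 2 * pi"
    using calculation(1) cos_one_2pi_int by blast
  ultimately have "0 < real_of_int m * (2 * pi)" "real_of_int m * (2 * pi) < 1 * (2 * pi)" by simp_all
  then have "0 < real_of_int m" "real_of_int m < 1"
    by (simp_all add: zero_less_mult_iff mult_less_cancel_right)
  then have "0 < m" "m < 1" by simp_all
  then show False by simp
qed

section \<open>Boundary values on the rays\<close>

definition stolz_point :: "complex \<Rightarrow> real \<Rightarrow> complex \<times> real \<Rightarrow> complex" where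
  "stolz_point d t y = fst y + complex_of_real t * d * cis (snd y)"

lemma nontangential_limit_iff:
  "nontangential_limit d S f g \<longleftrightarrow>
     (\<forall>K \<theta>. compact K \<and> K \<subseteq> S \<and> 0 < \<theta> \<and> \<theta> < pi / 2 \<longrightarrow>
        uniform_limit (K \<times> {\<theta>..pi - \<theta>}) (\<lambda>t y. f (stolz_point d t y)) (\<lambda>y. g (fst y)) (at_right 0))"
  by (simp add: nontangential_limit_def stolz_point_def case_prod_unfold)

text \<open>Boundary values respect sums and products because the limits are locally uniform; for products
  the boundary functions also have to be bounded on compact sets, which continuity guarantees.\<close>
lemma nontangential_limit_add:
  assumes "nontangential_limit d S f1 g1" "nontangential_limit d S f2 g2"
  shows "nontangential_limit d S (\<lambda>z. f1 z + f2 z) (\<lambda>x. g1 x + g2 x)"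
  using assms unfolding nontangential_limit_iff by (auto intro!: uniform_limit_add)

lemma nontangential_limit_mult:
  assumes "nontangential_limit d S f1 g1" "nontangential_limit d S f2 g2"
    and "continuous_on S g1" "continuous_on S g2"
  shows "nontangential_limit d S (\<lambda>z. f1 z * f2 z) (\<lambda>x. g1 x * g2 x)"
proof -
  have bdd: "bounded ((\<lambda>y. g (fst y)) ` (K \<times> A))"
    if "compact K" "K \<subseteq> S" "continuous_on S g" for K A and g :: "complex \<Rightarrow> complex"
  proof -
    have "bounded (g ` K)"
      using that by (meson compact_continuous_image compact_imp_bounded continuous_on_subset)
    then show ?thesis by (rule bounded_subset) auto
  qed
  show ?thesis
    using assms unfolding nontangential_limit_iff by (auto intro!: uniform_lim_mult bdd)
qed

lemma nontangential_limit_continuous: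
  assumes "continuous_on UNIV h" "norm d = 1"
  shows "nontangential_limit d S h h"
  unfolding nontangential_limit_iff
proof (intro allI impI)
  fix K :: "complex set" and \<theta> :: real
  assume *: "compact K \<and> K \<subseteq> S \<and> 0 < \<theta> \<and> \<theta> < pi / 2"
  define L where "L = {x + y | x y. x \<in> K \<and> y \<in> cball 0 (1::real)}"
  have "compact L" unfolding L_def using * by (intro compact_sums) auto
  then have uc: "uniformly_continuous_on L h"
    using assms(1) continuous_on_subset compact_uniformly_continuous by blast
  show "uniform_limit (K \<times> {\<theta>..pi - \<theta>}) (\<lambda>t y. h (stolz_point d t y)) (\<lambda>y. h (fst y)) (at_right 0)"
  proof (rule uniform_limitI)
    fix e :: real assume "e > 0"
    then obtain \<delta> where \<delta>: "\<delta> > 0" "\<And>x y. x \<in> L \<Longrightarrow> y \<in> L \<Longrightarrow> dist y x < \<delta> \<Longrightarrow> dist (h y) (h x) < e"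
      using uc unfolding uniformly_continuous_on_def by meson
    have "\<forall>\<^sub>F t in at_right (0::real). t < min \<delta> 1 \<and> 0 < t"
      using \<delta>(1) by (auto simp: eventually_at_right_field intro!: exI[of _ "min \<delta> 1"])
    then show "\<forall>\<^sub>F t in at_right 0. \<forall>y\<in>K \<times> {\<theta>..pi - \<theta>}. dist (h (stolz_point d t y)) (h (fst y)) < e"
    proof eventually_elim
      case (elim t)
      show ?case
      proof
        fix y assume y: "y \<in> K \<times> {\<theta>..pi - \<theta>}"
        define w where "w = complex_of_real t * d * cis (snd y)"
        have w: "stolz_point d t y = fst y + w" "norm w = t"
          using elim assms(2) by (auto simp: stolz_point_def w_def norm_mult)
        have "fst y + 0 \<in> L" "fst y + w \<in> L" unfolding L_def using y w(2) elim by fastforce+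
        then show "dist (h (stolz_point d t y)) (h (fst y)) < e"
          using \<delta>(2)[of "fst y" "fst y + w"] w elim by (simp add: dist_norm)
      qed
    qed
  qed
qed

text \<open>A Stolz approach to a ray eventually avoids the whole star: \<open>\<alpha> \<in> [\<theta>, pi - \<theta>]\<close> keeps it off the
  line of that ray, and compactness keeps it at a distance from the other rays. Values of a function
  on the star are therefore irrelevant for its nontangential limits.\<close>
lemma eventually_notin_star:
  assumes D: "D > 0" and k: "k < D" and K: "compact K" "K \<subseteq> open_ray (udir D k)" and "0 < \<theta>"
    and d: "d = udir D k \<or> d = - udir D k"
  shows "\<forall>\<^sub>F t in at_right 0. \<forall>y \<in> K \<times> {\<theta>..pi - \<theta>}. stolz_point d t y \<notin> star D"
proof -
  define R where "R = (\<Union>j\<in>{..<D} - {k}. ray D j)"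
  have "closed R" unfolding R_def by (intro closed_UN) (auto simp: closed_ray)
  moreover have "K \<inter> R = {}"
    using ray_unique[OF _ k] K(2) unfolding R_def ray_minus_0[symmetric] by blast
  ultimately obtain \<delta> where \<delta>: "\<delta> > 0" "\<And>x y. x \<in> K \<Longrightarrow> y \<in> R \<Longrightarrow> \<delta> \<le> dist x y"
    using separate_compact_closed[OF K(1)] by meson
  have "\<forall>\<^sub>F t in at_right (0::real). 0 < t \<and> t < \<delta>"
    using \<delta>(1) by (auto simp: eventually_at_right_field)
  then show ?thesis
  proof eventually_elim
    case (elim t)
    show ?case
    proof (intro ballI notI)
      fix y assume y: "y \<in> K \<times> {\<theta>..pi - \<theta>}" and "stolz_point d t y \<in> star D"
      then obtain x \<alpha> where x: "x \<in> K" and \<alpha>: "\<alpha> \<in> {\<theta>..pi - \<theta>}"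
        and s: "x + complex_of_real t * d * cis \<alpha> \<in> star D" by (auto simp: stolz_point_def)
      let ?z = "x + complex_of_real t * d * cis \<alpha>"
      have "dist x ?z = t" using d elim by (auto simp: dist_norm norm_mult)
      then have "?z \<notin> R" using \<delta>(2)[OF x] elim by force
      then have "?z \<in> ray D k" using s unfolding star_def R_def by blast
      then obtain r where r: "?z = of_real r * udir D k" unfolding ray_eq by blast
      obtain q where q: "x = of_real q * udir D k" using x K(2) unfolding open_ray_def by blast
      have "d = 1 * udir D k \<or> d = (-1) * udir D k" using d by simp
      then obtain \<sigma> :: real where \<sigma>: "d = of_real \<sigma> * udir D k" "\<sigma> \<noteq> 0"
        by (metis of_real_1 of_real_minus zero_neq_one neg_equal_0_iff_equal)
      have "udir D k * (of_real q + of_real t * of_real \<sigma> * cis \<alpha>) = udir D k * of_real r"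
        using r q \<sigma> by (simp add: algebra_simps)
      then have "of_real q + of_real t * of_real \<sigma> * cis \<alpha> = complex_of_real r"
        by (metis mult_cancel_left udir_nonzero)
      then have "Im (of_real q + of_real t * of_real \<sigma> * cis \<alpha>) = 0" by simp
      then have "sin \<alpha> = 0" using elim \<sigma>(2) by simp
      moreover have "0 < \<alpha>" "\<alpha> < pi" using \<alpha> \<open>0 < \<theta>\<close> by auto
      ultimately show False using sin_gt_zero[of \<alpha>] by simp
    qed
  qed
qed

text \<open>The entrywise content of \<open>rh_solution\<close> apart from the jump and the growth at infinity. Isolating it
  for scalar functions gives a class that is closed under polynomial operations, so that determinants
  and cofactors need no separate analysis.\<close>
definition ray_boundary_values ::
    "nat \<Rightarrow> (complex \<Rightarrow> complex) \<Rightarrow> (complex \<Rightarrow> complex) \<Rightarrow> (complex \<Rightarrow> complex) \<Rightarrow> bool" where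
  "ray_boundary_values D f fp fm \<longleftrightarrow>
     f holomorphic_on - star D \<and>
     continuous_on (star D - {0}) fp \<and> continuous_on (star D - {0}) fm \<and>
     (\<forall>k<D. nontangential_limit (ray_tangent D k) (ray D k - {0}) f fp \<and>
            nontangential_limit (- ray_tangent D k) (ray D k - {0}) f fm) \<and>
     (\<exists>r>0. bounded (f ` (ball 0 r - star D)))"

lemma ray_tangent_eq:
  assumes "even D" "k < D"
  shows "ray_tangent D k = (if k = D div 2 then - udir D k else udir D k)"
  using assms udir_half[of D] by (auto simp: ray_tangent_def udir_def)

lemma norm_ray_tangent [simp]: "norm (ray_tangent D k) = 1"
  by (auto simp: ray_tangent_def)

lemma ray_subset_star: "k < D \<Longrightarrow> ray D k - {0} \<subseteq> star D - {0}"
  by (auto simp: star_def)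

lemma ray_boundary_values_entire:
  assumes "h holomorphic_on UNIV"
  shows "ray_boundary_values D h h h"
proof -
  have c: "continuous_on UNIV h" using assms by (rule holomorphic_on_imp_continuous_on)
  have "compact (h ` cball 0 1)"
    by (intro compact_continuous_image) (auto intro: continuous_on_subset[OF c])
  then have "bounded (h ` cball 0 1)" by (rule compact_imp_bounded)
  then have "bounded (h ` (ball 0 1 - star D))" by (rule bounded_subset) auto
  then have "\<exists>r>0. bounded (h ` (ball 0 r - star D))" by (intro exI[of _ 1]) auto
  then show ?thesis unfolding ray_boundary_values_def
    using c assms by (auto intro: continuous_on_subset holomorphic_on_subset nontangential_limit_continuous)
qed

lemma ray_boundary_values_const: "ray_boundary_values D (\<lambda>z. c) (\<lambda>z. c) (\<lambda>z. c)"
  by (rule ray_boundary_values_entire) auto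

lemma ray_boundary_values_add:
  assumes "ray_boundary_values D f1 p1 m1" "ray_boundary_values D f2 p2 m2"
  shows "ray_boundary_values D (\<lambda>z. f1 z + f2 z) (\<lambda>z. p1 z + p2 z) (\<lambda>z. m1 z + m2 z)"
proof -
  obtain r1 r2 where r: "r1 > 0" "bounded (f1 ` (ball 0 r1 - star D))"
    "r2 > 0" "bounded (f2 ` (ball 0 r2 - star D))"
    using assms unfolding ray_boundary_values_def by blast
  have "bounded ((\<lambda>z. f1 z + f2 z) ` (ball 0 (min r1 r2) - star D))"
    by (rule bounded_plus_comp; rule bounded_subset[OF r(2)] bounded_subset[OF r(4)]) auto
  then have "\<exists>r>0. bounded ((\<lambda>z. f1 z + f2 z) ` (ball 0 r - star D))"
    using r by (intro exI[of _ "min r1 r2"]) auto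
  then show ?thesis
    using assms unfolding ray_boundary_values_def
    by (auto intro!: holomorphic_intros continuous_intros nontangential_limit_add)
qed

lemma ray_boundary_values_mult:
  assumes "ray_boundary_values D f1 p1 m1" "ray_boundary_values D f2 p2 m2"
  shows "ray_boundary_values D (\<lambda>z. f1 z * f2 z) (\<lambda>z. p1 z * p2 z) (\<lambda>z. m1 z * m2 z)"
proof -
  obtain r1 r2 where r: "r1 > 0" "bounded (f1 ` (ball 0 r1 - star D))"
    "r2 > 0" "bounded (f2 ` (ball 0 r2 - star D))"
    using assms unfolding ray_boundary_values_def by blast
  have b: "bounded (f1 ` (ball 0 (min r1 r2) - star D))" "bounded (f2 ` (ball 0 (min r1 r2) - star D))"
    by (rule bounded_subset[OF r(2)] bounded_subset[OF r(4)]; auto)+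
  obtain B1 B2 where B: "\<And>z. z \<in> ball 0 (min r1 r2) - star D \<Longrightarrow> norm (f1 z) \<le> B1"
     "\<And>z. z \<in> ball 0 (min r1 r2) - star D \<Longrightarrow> norm (f2 z) \<le> B2"
    using b unfolding bounded_iff by blast
  have "norm (f1 z * f2 z) \<le> B1 * B2" if "z \<in> ball 0 (min r1 r2) - star D" for z
    unfolding norm_mult using B[OF that] by (intro mult_mono) (auto intro: order_trans[OF norm_ge_zero])
  then have "bounded ((\<lambda>z. f1 z * f2 z) ` (ball 0 (min r1 r2) - star D))"
    unfolding bounded_iff by blast
  then have "\<exists>r>0. bounded ((\<lambda>z. f1 z * f2 z) ` (ball 0 r - star D))"
    using r by (intro exI[of _ "min r1 r2"]) auto
  moreover have "continuous_on (ray D k - {0}) g" if "continuous_on (star D - {0}) g" "k < D"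
    for g :: "complex \<Rightarrow> complex" and k
    using that continuous_on_subset ray_subset_star by blast
  ultimately show ?thesis
    using assms unfolding ray_boundary_values_def
    by (auto intro!: holomorphic_intros continuous_intros nontangential_limit_mult)
qed

lemma ray_boundary_values_sum:
  assumes "finite I" "\<And>i. i \<in> I \<Longrightarrow> ray_boundary_values D (f i) (p i) (m i)"
  shows "ray_boundary_values D (\<lambda>z. \<Sum>i\<in>I. f i z) (\<lambda>z. \<Sum>i\<in>I. p i z) (\<lambda>z. \<Sum>i\<in>I. m i z)"
  using assms by (induction I rule: finite_induct)
    (auto intro!: ray_boundary_values_const ray_boundary_values_add)

lemma ray_boundary_values_prod:
  assumes "finite I" "\<And>i. i \<in> I \<Longrightarrow> ray_boundary_values D (f i) (p i) (m i)"
  shows "ray_boundary_values D (\<lambda>z. \<Prod>i\<in>I. f i z) (\<lambda>z. \<Prod>i\<in>I. p i z) (\<lambda>z. \<Prod>i\<in>I. m i z)"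
  using assms by (induction I rule: finite_induct)
    (auto intro!: ray_boundary_values_const ray_boundary_values_mult)

lemma ray_boundary_values_cong:
  assumes "D > 0" "even D" and f: "ray_boundary_values D f p m"
    and eq: "\<And>z. z \<notin> star D \<Longrightarrow> f z = g z"
    and eqp: "\<And>z. z \<in> star D - {0} \<Longrightarrow> p z = p' z" and eqm: "\<And>z. z \<in> star D - {0} \<Longrightarrow> m z = m' z"
  shows "ray_boundary_values D g p' m'"
proof -
  have nt: "nontangential_limit d (ray D k - {0}) g h'"
    if n: "nontangential_limit d (ray D k - {0}) f h" and d: "d = udir D k \<or> d = - udir D k"
      and k: "k < D" and h: "\<And>z. z \<in> star D - {0} \<Longrightarrow> h z = h' z" for d k h h'
    unfolding nontangential_limit_iff
  proof (intro allI impI)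
    fix K :: "complex set" and \<theta> :: real
    assume *: "compact K \<and> K \<subseteq> ray D k - {0} \<and> 0 < \<theta> \<and> \<theta> < pi / 2"
    have "uniform_limit (K \<times> {\<theta>..pi - \<theta>}) (\<lambda>t y. f (stolz_point d t y)) (\<lambda>y. h (fst y)) (at_right 0)"
      using n * unfolding nontangential_limit_iff by blast
    moreover have "\<forall>\<^sub>F t in at_right 0. \<forall>y \<in> K \<times> {\<theta>..pi - \<theta>}. f (stolz_point d t y) = g (stolz_point d t y)"
      by (rule eventually_mono[OF eventually_notin_star[OF assms(1) k, of K \<theta> d]])
         (use * d eq in \<open>auto simp: ray_minus_0\<close>)
    moreover have "h (fst y) = h' (fst y)" if "y \<in> K \<times> {\<theta>..pi - \<theta>}" for y
    proof -
      have "K \<subseteq> star D - {0}" using * ray_subset_star[OF k] by blast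
      then show ?thesis using that by (auto intro!: h)
    qed
    ultimately show "uniform_limit (K \<times> {\<theta>..pi - \<theta>}) (\<lambda>t y. g (stolz_point d t y)) (\<lambda>y. h' (fst y)) (at_right 0)"
      by (rule uniform_limit_cong[THEN iffD1, rotated 2])
  qed
  have d: "ray_tangent D k = udir D k \<or> ray_tangent D k = - udir D k" if "k < D" for k
    using ray_tangent_eq[OF assms(2) that] by auto
  have im: "g ` (ball 0 r - star D) = f ` (ball 0 r - star D)" for r
    using eq by (intro image_cong) auto
  show ?thesis
    unfolding ray_boundary_values_def
  proof (intro conjI allI impI)
    show "g holomorphic_on - star D"
      using f eq holomorphic_cong[of "- star D" "- star D" f g] unfolding ray_boundary_values_def by auto
    show "continuous_on (star D - {0}) p'" "continuous_on (star D - {0}) m'"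
      using f eqp eqm continuous_on_cong[of "star D - {0}" "star D - {0}"]
      unfolding ray_boundary_values_def by metis+
    show "\<exists>r>0. bounded (g ` (ball 0 r - star D))" using f unfolding ray_boundary_values_def im by blast
  next
    fix k assume k: "k < D"
    show "nontangential_limit (ray_tangent D k) (ray D k - {0}) g p'"
      by (rule nt[where h = p]) (use f k eqp d[OF k] in \<open>auto simp: ray_boundary_values_def\<close>)
    show "nontangential_limit (- ray_tangent D k) (ray D k - {0}) g m'"
      by (rule nt[where h = m]) (use f k eqm d[OF k] in \<open>auto simp: ray_boundary_values_def\<close>)
  qed
qed

text \<open>The nontangential limit contains an unrestricted one-sided limit: a point \<open>z\<close> near \<open>x0\<close> is reached
  orthogonally from its projection \<open>x\<close> onto the ray, where \<open>f z\<close> is close to \<open>g x\<close> by uniformity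
  in \<open>x\<close>, and \<open>g x\<close> is close to \<open>g x0\<close> by continuity.\<close>
lemma nontangential_limit_half_plane:
  assumes nt: "nontangential_limit d (open_ray u) f g" and u: "norm u = 1" and d: "d = u \<or> d = - u"
    and x0: "x0 \<in> open_ray u" and g: "continuous_on (open_ray u) g"
  shows "(f \<longlongrightarrow> g x0) (at x0 within {z. 0 < Im (z / d)})"
proof -
  obtain \<rho> where \<rho>: "\<rho> > 0" "x0 = of_real \<rho> * u" using x0 unfolding open_ray_def by blast
  have "u \<noteq> 0" using u by auto
  obtain \<sigma> :: real where \<sigma>: "d = of_real \<sigma> * u" "\<bar>\<sigma>\<bar> = 1"
    using d that[of 1] that[of "-1"] by auto
  define K where "K = (\<lambda>r. complex_of_real r * u) ` {\<rho>/2..2*\<rho>}"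
  have K: "compact K" unfolding K_def by (intro compact_continuous_image continuous_intros) auto
  have Ku: "K \<subseteq> open_ray u" unfolding K_def open_ray_def using \<rho>(1) by fastforce
  have ul: "uniform_limit (K \<times> {pi/4..pi - pi/4}) (\<lambda>t y. f (stolz_point d t y)) (\<lambda>y. g (fst y)) (at_right 0)"
    using nt[unfolded nontangential_limit_iff, rule_format, of K "pi/4"] K Ku by auto
  show ?thesis
  proof (rule tendstoI)
    fix e :: real assume "e > 0"
    then have "e/2 > 0" by simp
    have "\<forall>\<^sub>F t in at_right 0. \<forall>y \<in> K \<times> {pi/4..pi - pi/4}. dist (f (stolz_point d t y)) (g (fst y)) < e/2"
      by (rule uniform_limitD[OF ul \<open>e/2 > 0\<close>])
    then obtain b where b0: "b > 0" "\<forall>t>0. t < b \<longrightarrow> (\<forall>y \<in> K \<times> {pi/4..pi - pi/4}. dist (f (stolz_point d t y)) (g (fst y)) < e/2)"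
      unfolding eventually_at_right_field by blast
    have b: "b > 0" "\<And>t x. 0 < t \<Longrightarrow> t < b \<Longrightarrow> x \<in> K \<Longrightarrow>
        dist (f (x + complex_of_real t * d * cis (pi/2))) (g x) < e/2"
      using b0(1) b0(2)[rule_format, of _ "(_, pi/2)"] by (auto simp: stolz_point_def)
    obtain \<delta> where \<delta>: "\<delta> > 0" "\<And>x. x \<in> open_ray u \<Longrightarrow> dist x x0 < \<delta> \<Longrightarrow> dist (g x) (g x0) < e/2"
      using g[unfolded continuous_on_iff, rule_format, OF x0 \<open>e/2 > 0\<close>] by blast
    have "dist (f z) (g x0) < e" if z: "0 < Im (z / d)" "dist z x0 < min b (min \<delta> (\<rho>/2))" for z
    proof -
      define w where "w = (z - x0) / d"
      have dn: "norm d = 1" "d \<noteq> 0" using \<sigma> u \<open>u \<noteq> 0\<close> by (auto simp: norm_mult)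
      have "x0 / d = of_real (\<rho> / \<sigma>)" using \<rho> \<sigma> \<open>u \<noteq> 0\<close> by simp
      then have imw: "Im w = Im (z / d)" unfolding w_def diff_divide_distrib by simp
      have nw: "norm w = dist z x0" unfolding w_def using dn by (simp add: dist_norm norm_divide)
      define x where "x = x0 + of_real (Re w) * d"
      have xeq: "x = of_real (\<rho> + Re w * \<sigma>) * u" unfolding x_def \<rho> \<sigma> by (simp add: algebra_simps)
      have "\<bar>Re w * \<sigma>\<bar> \<le> dist z x0" using abs_Re_le_cmod[of w] \<sigma>(2) nw by (simp add: abs_mult)
      then have bnd: "\<bar>Re w * \<sigma>\<bar> < \<rho>/2" "\<bar>Re w * \<sigma>\<bar> < \<delta>" using z by auto
      have "\<rho> + Re w * \<sigma> \<in> {\<rho>/2..2*\<rho>}" using bnd \<rho> by auto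
      then have "x \<in> K" unfolding K_def xeq by blast
      have "dist x x0 < \<delta>" using bnd(2) u by (simp add: xeq \<rho> dist_norm norm_mult flip: left_diff_distrib of_real_diff)
      moreover have "z = x + of_real (Im w) * d * cis (pi/2)"
      proof -
        have "z = x0 + w * d" unfolding w_def using dn by simp
        also have "w = of_real (Re w) + \<i> * of_real (Im w)" using complex_eq by blast
        finally show ?thesis unfolding x_def by (simp add: cis_pi_half algebra_simps)
      qed
      moreover have "Im w < b" using abs_Im_le_cmod[of w] abs_ge_self[of "Im w"] nw z by auto
      ultimately have "dist (f z) (g x) < e/2" "dist (g x) (g x0) < e/2"
        using b(2)[of "Im w" x] \<open>x \<in> K\<close> Ku z imw \<delta>(2)[of x] by auto
      then show ?thesis by (metis dist_triangle_half_l dist_commute)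
    qed
    then show "\<forall>\<^sub>F z in at x0 within {z. 0 < Im (z / d)}. dist (f z) (g x0) < e"
      unfolding eventually_at using b(1) \<delta>(1) \<rho>(1)
      by (intro exI[of _ "min b (min \<delta> (\<rho>/2))"]) auto
  qed
qed

section \<open>Removing rays without jump\<close>

lemma open_ray_neighbourhood:
  assumes k: "k < D" and x0: "x0 \<in> open_ray (udir D k)"
  obtains \<delta> where "\<delta> > 0" "\<And>z. dist z x0 < \<delta> \<Longrightarrow> z \<in> star D \<Longrightarrow> Im (z / udir D k) = 0"
    "\<And>z. dist z x0 < \<delta> \<Longrightarrow> Im (z / udir D k) = 0 \<Longrightarrow> z \<in> open_ray (udir D k)"
proof -
  define R where "R = (\<Union>j\<in>{..<D} - {k}. ray D j)"
  have "closed R" unfolding R_def by (intro closed_UN) (auto simp: closed_ray)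
  moreover have "x0 \<notin> R"
    using ray_unique[OF _ k] x0 unfolding R_def ray_minus_0[symmetric] by blast
  ultimately have "open (- R)" "x0 \<in> - R" by auto
  then obtain \<delta>1 where \<delta>1: "\<delta>1 > 0" "\<And>z. dist z x0 < \<delta>1 \<Longrightarrow> z \<notin> R"
    unfolding open_dist by blast
  obtain \<rho> where \<rho>: "\<rho> > 0" "x0 = of_real \<rho> * udir D k" using x0 unfolding open_ray_def by blast
  show ?thesis
  proof
    show "min \<delta>1 \<rho> > 0" using \<delta>1 \<rho> by simp
    show "Im (z / udir D k) = 0" if "dist z x0 < min \<delta>1 \<rho>" "z \<in> star D" for z
    proof -
      have "z \<in> ray D k" using that \<delta>1(2)[of z] unfolding star_def R_def by auto
      then show ?thesis unfolding ray_eq by auto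
    qed
    show "z \<in> open_ray (udir D k)" if "dist z x0 < min \<delta>1 \<rho>" "Im (z / udir D k) = 0" for z
    proof -
      have "z / udir D k = of_real (Re (z / udir D k))" using that(2) by (simp add: complex_eq_iff)
      then have z: "z = of_real (Re (z / udir D k)) * udir D k" by (simp add: field_simps)
      have "dist z x0 = norm (of_real (Re (z / udir D k) - \<rho>) * udir D k)"
        by (subst z) (simp add: \<rho> dist_norm left_diff_distrib)
      also have "\<dots> = \<bar>Re (z / udir D k) - \<rho>\<bar>" by (simp only: norm_of_real_mult_udir)
      finally have "Re (z / udir D k) > 0" using that(1) by linarith
      then show ?thesis using z unfolding open_ray_def by blast
    qed
  qed
qed

text \<open>The star has no interior, even within a circle around the origin: rotating a point of it by a small angle leaves it.
  So bounds that depend on the modulus only extend to the star.\<close>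
lemma star_limit_bound:
  fixes F :: "complex \<Rightarrow> complex"
  assumes "D > 0" "z \<noteq> 0" "isCont F z" "\<And>w. norm w = norm z \<Longrightarrow> w \<notin> star D \<Longrightarrow> norm (F w) \<le> B"
  shows "norm (F z) \<le> B"
proof (cases "z \<in> star D")
  case True
  have "((\<lambda>t. z * cis t) \<longlongrightarrow> z * cis 0) (at_right 0)"
    by (intro tendsto_intros continuous_within_tendsto_compose) (auto intro!: tendsto_eq_intros simp: cis_conv_exp)
  then have "((\<lambda>t. z * cis t) \<longlongrightarrow> z) (at_right 0)" by simp
  then have l: "((\<lambda>t. F (z * cis t)) \<longlongrightarrow> F z) (at_right 0)"
    using assms(3) isCont_tendsto_compose by blast
  have "2 * pi / real D > 0" using assms(1) by simp
  then have "\<forall>\<^sub>F t in at_right 0. 0 < t \<and> t < 2 * pi / real D"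
    unfolding eventually_at_right_field by blast
  then have "\<forall>\<^sub>F t in at_right 0. norm (F (z * cis t)) \<le> B"
    by eventually_elim (use mult_cis_notin_star[OF assms(1,2) True] in \<open>auto intro!: assms(4) simp: norm_mult\<close>)
  then show ?thesis using Lim_norm_ubound[OF _ l] by simp
qed (use assms in auto)

lemma ray_boundary_values_half_plane:
  assumes "even D" "k < D" "ray_boundary_values D f p m" "x \<in> open_ray (udir D k)"
  shows "(f \<longlongrightarrow> p x) (at x within {z. 0 < Im (z / ray_tangent D k)})"
    and "(f \<longlongrightarrow> m x) (at x within {z. Im (z / ray_tangent D k) < 0})"
proof -
  have rt: "ray_tangent D k = udir D k \<or> ray_tangent D k = - udir D k"
    "- ray_tangent D k = udir D k \<or> - ray_tangent D k = - udir D k"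
    using ray_tangent_eq[OF assms(1,2)] by auto
  have c: "continuous_on (open_ray (udir D k)) p" "continuous_on (open_ray (udir D k)) m"
    using assms(3) open_ray_udir_subset_star[OF assms(2)] continuous_on_subset
    unfolding ray_boundary_values_def by blast+
  show "(f \<longlongrightarrow> p x) (at x within {z. 0 < Im (z / ray_tangent D k)})"
    by (rule nontangential_limit_half_plane[OF _ _ rt(1) assms(4) c(1)])
       (use assms(2,3) in \<open>auto simp: ray_boundary_values_def ray_minus_0\<close>)
  have "(f \<longlongrightarrow> m x) (at x within {z. 0 < Im (z / (- ray_tangent D k))})"
    by (rule nontangential_limit_half_plane[OF _ _ rt(2) assms(4) c(2)])
       (use assms(2,3) in \<open>auto simp: ray_boundary_values_def ray_minus_0\<close>)
  then show "(f \<longlongrightarrow> m x) (at x within {z. Im (z / ray_tangent D k) < 0})" by simp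
qed

text \<open>For extending a function \<open>f\<close>, known on one or both sides \<open>H\<close> of a ray \<open>R\<close>, by its boundary values \<open>g\<close>.\<close>
lemma glued_limit:
  fixes f g F :: "complex \<Rightarrow> complex"
  assumes z0: "z0 \<in> R" "z0 \<in> N" "open N" and C: "C \<subseteq> R \<union> H"
    and g: "continuous_on R g" and f: "(f \<longlongrightarrow> g z0) (at z0 within H)"
    and F: "\<And>z. z \<in> N \<Longrightarrow> z \<in> R \<Longrightarrow> F z = g z" "\<And>z. z \<in> N \<Longrightarrow> z \<in> H \<Longrightarrow> F z = f z"
  shows "(F \<longlongrightarrow> F z0) (at z0 within C)"
proof -
  have N: "\<forall>\<^sub>F z in nhds z0. z \<in> N" by (rule eventually_nhds_in_open[OF z0(3,2)])
  have F0: "F z0 = g z0" by (rule F(1)[OF z0(2,1)])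
  have "\<forall>\<^sub>F z in at z0 within R. F z = g z"
    unfolding eventually_at_filter using N by eventually_elim (simp add: F(1))
  moreover have "(g \<longlongrightarrow> g z0) (at z0 within R)" using g z0(1) by (simp add: continuous_on)
  ultimately have R: "(F \<longlongrightarrow> F z0) (at z0 within R)" unfolding F0 by (rule tendsto_cong[THEN iffD2])
  have "\<forall>\<^sub>F z in at z0 within H. F z = f z"
    unfolding eventually_at_filter using N by eventually_elim (simp add: F(2))
  then have "(F \<longlongrightarrow> F z0) (at z0 within H)" unfolding F0 using f by (rule tendsto_cong[THEN iffD2])
  then show ?thesis using tendsto_within_subset[OF Lim_within_Un[THEN iffD2, OF conjI[OF R]] C] by blast
qed

text \<open>Without a jump, gluing \<open>f\<close> and \<open>g\<close> gives a continuous function off the origin. It is holomorphic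
  across each open ray by Morera's theorem, and Riemann's theorem removes the origin.\<close>
lemma ray_boundary_values_no_jump:
  assumes D: "even D" "D > 0" and f: "ray_boundary_values D f g g"
  obtains h where "h holomorphic_on UNIV" "\<And>z. z \<notin> star D \<Longrightarrow> h z = f z"
    "\<And>z. z \<in> star D - {0} \<Longrightarrow> h z = g z"
proof -
  define F where "F z = (if z \<in> star D then g z else f z)" for z
  have Fhol: "F holomorphic_on - star D"
    using f holomorphic_cong[of "- star D" "- star D" F f] unfolding ray_boundary_values_def F_def by auto
  have gcont: "continuous_on (star D - {0}) g" using f unfolding ray_boundary_values_def by blast
  have near: "\<exists>\<delta>>0. F holomorphic_on ball x \<delta>" if x: "x \<in> star D - {0}" for x
  proof -
    obtain k where k: "k < D" "x \<in> open_ray (udir D k)"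
      using x unfolding star_def ray_minus_0[symmetric] by auto
    obtain \<delta> where \<delta>: "\<delta> > 0" "\<And>z. dist z x < \<delta> \<Longrightarrow> z \<in> star D \<Longrightarrow> Im (z / udir D k) = 0"
      "\<And>z. dist z x < \<delta> \<Longrightarrow> Im (z / udir D k) = 0 \<Longrightarrow> z \<in> open_ray (udir D k)"
      by (rule open_ray_neighbourhood[OF k]) blast
    have cont: "isCont F y" if y: "y \<in> ball x \<delta>" for y
    proof (cases "y \<in> star D")
      case False
      have "open (- star D)" using closed_star[OF D(2)] by auto
      then show ?thesis using Fhol False
        by (meson ComplI continuous_on_eq_continuous_at holomorphic_on_imp_continuous_on)
    next
      case True
      have yr: "y \<in> open_ray (udir D k)" using \<delta>(2,3)[of y] y True by (simp add: dist_commute)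
      let ?H = "{z. 0 < Im (z / ray_tangent D k)} \<union> {z. Im (z / ray_tangent D k) < 0}"
      have H: "z \<in> ?H \<longleftrightarrow> Im (z / udir D k) \<noteq> 0" for z
        using ray_tangent_eq[OF D(1) k(1)] by (auto split: if_splits)
      have "(F \<longlongrightarrow> F y) (at y within ball x \<delta>)"
      proof (rule glued_limit[OF _ y open_ball _ gcont])
        show "y \<in> star D - {0}" using yr open_ray_udir_subset_star[OF k(1)] by blast
        show "(f \<longlongrightarrow> g y) (at y within ?H)"
          unfolding Lim_within_Un using ray_boundary_values_half_plane[OF D(1) k(1) f yr] by simp
        show "ball x \<delta> \<subseteq> (star D - {0}) \<union> ?H"
          using \<delta>(3) H open_ray_udir_subset_star[OF k(1)] by (force simp: dist_commute)
        show "F z = f z" if "z \<in> ball x \<delta>" "z \<in> ?H" for z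
          using \<delta>(2)[of z] that H[of z] by (auto simp: F_def dist_commute)
      qed (simp add: F_def)
      then show ?thesis unfolding isCont_def using at_within_open[OF y open_ball] by simp
    qed
    have "F holomorphic_on ball x \<delta>"
    proof (rule holomorphic_on_paste_across_line[where d = "\<i> * udir D k" and k = 0])
      have inner: "(\<i> * udir D k) \<bullet> z = Im (z / udir D k)" for z
      proof -
        have "udir D k * cnj (udir D k) = 1" by (simp add: complex_norm_square[symmetric])
        then have "z / udir D k = z * cnj (udir D k)" by (simp add: field_simps)
        then show ?thesis by (simp add: inner_complex_def)
      qed
      have "F holomorphic_on (ball x \<delta> \<inter> S)" if "\<And>z. z \<in> S \<Longrightarrow> Im (z / udir D k) \<noteq> 0" for S
      proof (rule holomorphic_on_subset[OF Fhol], rule subsetI)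
        fix z assume "z \<in> ball x \<delta> \<inter> S"
        then show "z \<in> - star D" using \<delta>(2)[of z] that[of z] by (auto simp: dist_commute)
      qed
      note * = this
      show "F holomorphic_on ball x \<delta> \<inter> {z. (\<i> * udir D k) \<bullet> z < 0}"
        "F holomorphic_on ball x \<delta> \<inter> {z. 0 < (\<i> * udir D k) \<bullet> z}"
        unfolding inner by (rule *; simp)+
      show "continuous_on (ball x \<delta>) F"
        using cont continuous_at_imp_continuous_on by blast
    qed auto
    then show ?thesis using \<delta>(1) by blast
  qed
  have diff: "F field_differentiable at z" if "z \<noteq> 0" for z
  proof (cases "z \<in> star D")
    case True
    then obtain \<delta> where "\<delta> > 0" "F holomorphic_on ball z \<delta>" using near[of z] \<open>z \<noteq> 0\<close> by auto
    then show ?thesis using holomorphic_on_imp_differentiable_at[of F "ball z \<delta>"] by auto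
  next
    case False
    then show ?thesis
      using holomorphic_on_imp_differentiable_at[OF Fhol] closed_star[OF D(2)] by auto
  qed
  then have Fhol0: "F holomorphic_on UNIV - {0}"
    unfolding holomorphic_on_def by (auto intro: field_differentiable_at_within)
  obtain r B where r: "r > 0" "\<And>z. z \<in> ball 0 r - star D \<Longrightarrow> norm (f z) \<le> B"
    using f unfolding ray_boundary_values_def bounded_iff by (metis imageI)
  have "norm (F z) \<le> B" if z: "z \<noteq> 0" "norm z < r" for z
  proof (rule star_limit_bound[OF D(2) z(1)])
    show "isCont F z" by (rule field_differentiable_imp_continuous_at[OF diff[OF z(1)]])
    show "norm (F w) \<le> B" if "norm w = norm z" "w \<notin> star D" for w
      using r(2)[of w] that z(2) by (simp add: F_def)
  qed
  then have "\<forall>\<^sub>F z in at 0. norm (F z) \<le> B"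
    unfolding eventually_at using r(1) by (intro exI[of _ r]) (auto simp: dist_norm)
  then have "\<exists>g. g holomorphic_on UNIV \<and> (\<forall>z\<in>UNIV - {0}. g z = F z)"
    using holomorphic_on_extend_bounded[OF Fhol0] by auto
  then obtain h where h: "h holomorphic_on UNIV" "\<And>z. z \<in> UNIV - {0} \<Longrightarrow> h z = F z"
    by blast
  show ?thesis
  proof
    show "h z = f z" if "z \<notin> star D" for z
    proof -
      have "z \<noteq> 0" using that zero_in_star[OF D(2)] by auto
      then show ?thesis using h(2)[of z] that by (simp add: F_def)
    qed
    show "h z = g z" if "z \<in> star D - {0}" for z using h(2)[of z] that by (simp add: F_def)
  qed (rule h(1))
qed

abbreviation off_star_at_infinity :: "nat \<Rightarrow> complex filter" where
  "off_star_at_infinity D \<equiv> inf at_infinity (principal (- star D))"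

lemma eventually_off_star:
  "eventually P (off_star_at_infinity D) \<longleftrightarrow> (\<exists>b. \<forall>z. b \<le> norm z \<longrightarrow> z \<notin> star D \<longrightarrow> P z)"
  unfolding eventually_inf_principal eventually_at_infinity by auto

text \<open>Liouville's theorem, with the growth known off the star only.\<close>
lemma entire_bound_off_star:
  assumes "D > 0" "h holomorphic_on UNIV" "h \<in> O[off_star_at_infinity D](\<lambda>z. z ^ n)"
  obtains q where "degree q \<le> n" "\<And>z. h z = poly q z"
proof -
  obtain c where "eventually (\<lambda>z. norm (h z) \<le> c * norm (z ^ n)) (off_star_at_infinity D)"
    using assms(3) by (elim landau_o.bigE)
  then obtain b where b: "\<And>z. b \<le> norm z \<Longrightarrow> z \<notin> star D \<Longrightarrow> norm (h z) \<le> c * norm z ^ n"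
    unfolding eventually_off_star norm_power by blast
  have bd: "norm (h z) \<le> c * norm z ^ n" if "max b 1 \<le> norm z" for z
  proof (rule star_limit_bound[where F = h and z = z, OF assms(1)])
    show "isCont h z" 
      using holomorphic_on_imp_continuous_on[OF assms(2)] continuous_on_eq_continuous_at[OF open_UNIV] by blast
    show "norm (h w) \<le> c * norm z ^ n" if "norm w = norm z" "w \<notin> star D" for w
      using b[of w] that \<open>max b 1 \<le> norm z\<close> by simp
  qed (use that in auto)
  define q where "q = (\<Sum>k\<le>n. monom ((deriv ^^ k) h 0 / fact k) k)"
  have "h z = poly q z" for z
    using Liouville_polynomial[OF assms(2), of "max b 1" c n z, OF bd] by (simp add: q_def poly_sum poly_monom)
  moreover have "degree q \<le> n"
    unfolding q_def by (intro degree_sum_le) (auto intro: order_trans[OF degree_monom_le])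
  ultimately show ?thesis using that by blast
qed

lemma off_star_nontrivial:
  assumes "D > 0"
  shows "off_star_at_infinity D \<noteq> bot"
proof
  assume "off_star_at_infinity D = bot"
  then obtain b where b: "\<And>z. b \<le> norm z \<Longrightarrow> z \<in> star D"
    using eventually_off_star[of "\<lambda>_. False" D] by auto
  define z where "z = complex_of_real (max b 1)"
  have "z \<in> star D" "z * cis (pi / real D) \<in> star D" using b by (auto simp: z_def norm_mult)
  moreover have "max b 1 \<noteq> 0" by linarith
  then have "z \<noteq> 0" unfolding z_def by (metis of_real_eq_0_iff)
  ultimately show False
    using mult_cis_notin_star[of D z "pi / real D"] assms by (auto simp: divide_strict_right_mono)
qed

lemma entire_limit_off_star:
  assumes "D > 0" "h holomorphic_on UNIV" "(h \<longlongrightarrow> c) (off_star_at_infinity D)"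
  shows "h z = c"
proof -
  have "h \<in> O[off_star_at_infinity D](\<lambda>z. z ^ 0)"
    by (rule bigoI_tendsto[of _ _ c]) (use assms(3) in auto)
  then obtain q where q: "degree q \<le> 0" "\<And>z. h z = poly q z"
    using entire_bound_off_star[OF assms(1,2)] by blast
  then have "degree q = 0" by simp
  then obtain a0 where "q = [:a0:]" by (rule degree_eq_zeroE)
  then obtain a where a: "\<And>z. h z = a" using q(2) by simp
  then have "((\<lambda>z. a) \<longlongrightarrow> c) (off_star_at_infinity D)" using assms(3) by (simp add: fun_eq_iff a[abs_def])
  then have "a = c" using off_star_nontrivial[OF assms(1)] by (simp add: tendsto_const_iff)
  then show ?thesis using a by simp
qed

section \<open>Determinants and adjugates\<close>

lemma adj_mat_index:
  assumes "A \<in> carrier_mat N N" "i < N" "j < N"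
  shows "adj_mat A $$ (i, j) = (- 1) ^ (j + i) *
    det (mat (N - 1) (N - 1) (\<lambda>(i', j'). A $$ (if i' < j then i' else Suc i', if j' < i then j' else Suc j')))"
  using assms by (simp add: adj_mat_def cofactor_def mat_delete_def)

lemma det_mat_permutes:
  "det (mat N N (\<lambda>(i, j). g i j)) =
    (\<Sum>\<pi>\<in>{\<pi>. \<pi> permutes {0..<N}}. signof \<pi> * (\<Prod>i = 0..<N. g i (\<pi> i)))" for g :: "nat \<Rightarrow> nat \<Rightarrow> complex"
  by (subst det_def'[of _ N]) (auto intro!: sum.cong prod.cong)

lemma ray_boundary_values_det:
  assumes "\<And>i j. i < N \<Longrightarrow> j < N \<Longrightarrow> ray_boundary_values D (f i j) (p i j) (m i j)"
  shows "ray_boundary_values D (\<lambda>z. det (mat N N (\<lambda>(i, j). f i j z)))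
     (\<lambda>z. det (mat N N (\<lambda>(i, j). p i j z))) (\<lambda>z. det (mat N N (\<lambda>(i, j). m i j z)))"
  unfolding det_mat_permutes
  by (intro ray_boundary_values_sum ray_boundary_values_mult ray_boundary_values_const
      ray_boundary_values_prod assms) (auto simp: finite_permutations)

lemma ray_boundary_values_adj_mat:
  assumes "even D" "D > 0"
    and M: "\<And>z. z \<in> - star D \<Longrightarrow> M z \<in> carrier_mat D D"
    and P: "\<And>z. z \<in> star D - {0} \<Longrightarrow> P z \<in> carrier_mat D D"
    and Q: "\<And>z. z \<in> star D - {0} \<Longrightarrow> Q z \<in> carrier_mat D D"
    and bv: "\<And>i j. i < D \<Longrightarrow> j < D \<Longrightarrow> ray_boundary_values D (\<lambda>z. M z $$ (i, j)) (\<lambda>z. P z $$ (i, j)) (\<lambda>z. Q z $$ (i, j))"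
    and ij: "i < D" "j < D"
  shows "ray_boundary_values D (\<lambda>z. adj_mat (M z) $$ (i, j)) (\<lambda>z. adj_mat (P z) $$ (i, j)) (\<lambda>z. adj_mat (Q z) $$ (i, j))"
proof (rule ray_boundary_values_cong[OF assms(2,1)])
  show "ray_boundary_values D 
    (\<lambda>z. (- 1) ^ (j + i) * det (mat (D - 1) (D - 1) (\<lambda>(i', j'). M z $$ (if i' < j then i' else Suc i', if j' < i then j' else Suc j'))))
    (\<lambda>z. (- 1) ^ (j + i) * det (mat (D - 1) (D - 1) (\<lambda>(i', j'). P z $$ (if i' < j then i' else Suc i', if j' < i then j' else Suc j'))))
    (\<lambda>z. (- 1) ^ (j + i) * det (mat (D - 1) (D - 1) (\<lambda>(i', j'). Q z $$ (if i' < j then i' else Suc i', if j' < i then j' else Suc j'))))"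
    by (intro ray_boundary_values_mult ray_boundary_values_const ray_boundary_values_det bv) auto
qed (use adj_mat_index[OF M ij] adj_mat_index[OF P ij] adj_mat_index[OF Q ij] in auto)

lemma tendsto_det:
  fixes f :: "nat \<Rightarrow> nat \<Rightarrow> 'a \<Rightarrow> complex"
  assumes "\<And>i j. i < N \<Longrightarrow> j < N \<Longrightarrow> (f i j \<longlongrightarrow> l i j) F"
  shows "((\<lambda>z. det (mat N N (\<lambda>(i, j). f i j z))) \<longlongrightarrow> det (mat N N (\<lambda>(i, j). l i j))) F"
  unfolding det_mat_permutes by (intro tendsto_intros assms) (auto)

lemma tendsto_adj_mat:
  fixes M :: "'a \<Rightarrow> complex mat"
  assumes "\<And>z. M z \<in> carrier_mat N N" "L \<in> carrier_mat N N"
    and "\<And>i j. i < N \<Longrightarrow> j < N \<Longrightarrow> ((\<lambda>z. M z $$ (i, j)) \<longlongrightarrow> L $$ (i, j)) F"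
    and "i < N" "j < N"
  shows "((\<lambda>z. adj_mat (M z) $$ (i, j)) \<longlongrightarrow> adj_mat L $$ (i, j)) F"
  unfolding adj_mat_index[OF assms(1) assms(4,5)] adj_mat_index[OF assms(2) assms(4,5)]
  by (intro tendsto_mult tendsto_const tendsto_det assms(3)) auto

lemma det_mat_diag: "det (mat_diag N f) = (\<Prod>i<N. f i)" for f :: "nat \<Rightarrow> complex"
proof -
  have "det (mat_diag N f) = prod_list (diag_mat (mat_diag N f))"
    by (rule det_upper_triangular[of _ N]) (auto simp: mat_diag_def)
  also have "\<dots> = (\<Prod>i<N. f i)"
    by (simp add: diag_mat_def mat_diag_def prod.distinct_set_conv_list[symmetric] lessThan_atLeast0)
  finally show ?thesis .
qed

lemma adj_mat_inverse:
  fixes M :: "complex mat"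
  assumes "M \<in> carrier_mat N N" "det M = 1"
  shows "M * adj_mat M = 1\<^sub>m N" "adj_mat M * M = 1\<^sub>m N" "adj_mat M \<in> carrier_mat N N"
  using adj_mat[OF assms(1)] assms(2) by auto

lemma adj_mat_eqI:
  fixes M :: "complex mat"
  assumes M: "M \<in> carrier_mat N N" "det M = 1" and K: "K \<in> carrier_mat N N" "K * M = 1\<^sub>m N"
  shows "adj_mat M = K"
proof -
  note a = adj_mat_inverse[OF M]
  have "adj_mat M = (K * M) * adj_mat M" unfolding K(2) using a(3) by simp
  also have "\<dots> = K * (M * adj_mat M)" by (rule assoc_mult_mat[OF K(1) M(1) a(3)])
  also have "\<dots> = K" unfolding a(1) using K(1) by simp
  finally show ?thesis .
qed

lemma mult_mat_cancel_middle:
  fixes P Q R S :: "complex mat"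
  assumes "P \<in> carrier_mat N N" "Q \<in> carrier_mat N N" "R \<in> carrier_mat N N" "S \<in> carrier_mat N N"
    and QR: "Q * R = 1\<^sub>m N"
  shows "(P * Q) * (R * S) = P * S"
proof -
  have "(P * Q) * (R * S) = P * (Q * (R * S))"
    by (rule assoc_mult_mat[OF assms(1,2) mult_carrier_mat[OF assms(3,4)]])
  also have "Q * (R * S) = (Q * R) * S" by (rule assoc_mult_mat[OF assms(2,3,4), symmetric])
  also have "\<dots> = S" unfolding QR using assms(4) by simp
  finally show ?thesis .
qed

lemma mat_inv_eq_adj_mat:
  assumes M: "M \<in> carrier_mat N N" "det M = 1"
  shows "mat_inv M = adj_mat M" "invertible_mat M"
proof -
  note a = adj_mat_inverse[OF M]
  show "invertible_mat M"
    unfolding invertible_mat_def inverts_mat_def using M a by auto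
  have "M \<in> Units (ring_mat TYPE(complex) N ())"
    unfolding Units_def ring_mat_def using M a by auto
  then obtain B where MB: "mat_inverse M = Some B"
    using mat_inverse(1)[OF M(1), where b = "()"] by (cases "mat_inverse M") auto
  then have "B * M = 1\<^sub>m N" "B \<in> carrier_mat N N" using mat_inverse(2)[OF M(1)] by auto
  then have "B = adj_mat M" using adj_mat_eqI[OF M] by simp
  then show "mat_inv M = adj_mat M" using MB by (simp add: mat_inv_def)
qed

section \<open>Duality of Riemann--Hilbert problems\<close>

text \<open>The boundary matrices and the error term, whose existence \<open>rh_solution\<close> asserts, become
  parameters, so that determinants and cofactors of all three matrices can be compared.\<close>
locale rh_problem =
  fixes D :: nat and J :: "complex \<Rightarrow> complex mat" and e :: "nat \<Rightarrow> int"
    and B Bp Bm E :: "complex \<Rightarrow> complex mat"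
  assumes carrier_off: "z \<in> - star D \<Longrightarrow> B z \<in> carrier_mat D D"
    and carrier_bdry: "x \<in> star D - {0} \<Longrightarrow> Bp x \<in> carrier_mat D D"
      "x \<in> star D - {0} \<Longrightarrow> Bm x \<in> carrier_mat D D"
    and bdry: "i < D \<Longrightarrow> j < D \<Longrightarrow>
      ray_boundary_values D (\<lambda>z. B z $$ (i, j)) (\<lambda>x. Bp x $$ (i, j)) (\<lambda>x. Bm x $$ (i, j))"
    and jump: "x \<in> star D - {0} \<Longrightarrow> Bp x = Bm x * J x"
    and error_carrier: "E z \<in> carrier_mat D D"
    and error: "i < D \<Longrightarrow> j < D \<Longrightarrow> (\<lambda>z. E z $$ (i, j)) \<in> O[off_star_at_infinity D](\<lambda>z. 1 / z)"
    and asymp: "\<forall>\<^sub>F z in off_star_at_infinity D. B z = (1\<^sub>m D + E z) * mat_diag D (\<lambda>i. z powi e i)"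

lemma rh_solutionE:
  assumes "rh_solution D J e B"
  obtains Bp Bm E where "rh_problem D J e B Bp Bm E"
proof -
  note sol = assms[unfolded rh_solution_def]
  note carr = sol[THEN conjunct1] and hol = sol[THEN conjunct2, THEN conjunct1]
  from sol[THEN conjunct2, THEN conjunct2, THEN conjunct1] obtain Bp Bm where B:
    "\<forall>x \<in> star D - {0}. Bp x \<in> carrier_mat D D \<and> Bm x \<in> carrier_mat D D"
    "\<forall>i<D. \<forall>j<D.
       continuous_on (star D - {0}) (\<lambda>x. Bp x $$ (i, j)) \<and>
       continuous_on (star D - {0}) (\<lambda>x. Bm x $$ (i, j)) \<and>
       (\<forall>k<D. nontangential_limit (ray_tangent D k) (ray D k - {0}) (\<lambda>z. B z $$ (i, j)) (\<lambda>x. Bp x $$ (i, j)) \<and>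
            nontangential_limit (- ray_tangent D k) (ray D k - {0}) (\<lambda>z. B z $$ (i, j)) (\<lambda>x. Bm x $$ (i, j)))"
    "\<forall>x \<in> star D - {0}. Bp x = Bm x * J x"
    by (elim exE conjE) blast
  from sol[THEN conjunct2, THEN conjunct2, THEN conjunct2, THEN conjunct2] obtain E where E: "\<forall>z. E z \<in> carrier_mat D D"
    "\<forall>i<D. \<forall>j<D. (\<lambda>z. E z $$ (i, j)) \<in> O[off_star_at_infinity D](\<lambda>z. 1 / z)"
    "\<forall>\<^sub>F z in off_star_at_infinity D. B z = (1\<^sub>m D + E z) * mat_diag D (\<lambda>i. z powi e i)"
    by (elim exE conjE) blast
  from sol[THEN conjunct2, THEN conjunct2, THEN conjunct2, THEN conjunct1]
  obtain r where r: "r > 0" "\<forall>i<D. \<forall>j<D. bounded ((\<lambda>z. B z $$ (i, j)) ` (ball 0 r - star D))"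
    by blast
  have "ray_boundary_values D (\<lambda>z. B z $$ (i, j)) (\<lambda>x. Bp x $$ (i, j)) (\<lambda>x. Bm x $$ (i, j))"
    if "i < D" "j < D" for i j
    unfolding ray_boundary_values_def
    using B(2) that hol r(2) by (intro conjI exI[of _ r] r(1)) auto
  then have "rh_problem D J e B Bp Bm E"
    unfolding rh_problem_def using carr B(1,3) E by auto
  then show ?thesis by (rule that)
qed

lemma rh_solutionI:
  assumes "rh_problem D J e B Bp Bm E"
  shows "rh_solution D J e B"
  unfolding rh_solution_def
proof (intro conjI)
  interpret rh_problem D J e B Bp Bm E by fact
  have "\<exists>r>0. bounded ((\<lambda>z. B z $$ (i, j)) ` (ball 0 r - star D))" if "i < D" "j < D" for i j
    using bdry[OF that] unfolding ray_boundary_values_def by blast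
  then obtain r where r: "\<And>i j. i < D \<Longrightarrow> j < D \<Longrightarrow> r i j > 0"
    "\<And>i j. i < D \<Longrightarrow> j < D \<Longrightarrow> bounded ((\<lambda>z. B z $$ (i, j)) ` (ball 0 (r i j) - star D))"
    by metis
  define S where "S = insert 1 ((\<lambda>(i, j). r i j) ` ({..<D} \<times> {..<D}))"
  have S: "finite S" "S \<noteq> {}" unfolding S_def by auto
  have "Min S > 0" using S r(1) by (auto simp: S_def)
  moreover have "bounded ((\<lambda>z. B z $$ (i, j)) ` (ball 0 (Min S) - star D))" if "i < D" "j < D" for i j
  proof (rule bounded_subset[OF r(2)[OF that]])
    have "Min S \<le> r i j" using S that by (intro Min_le) (auto simp: S_def)
    then show "(\<lambda>z. B z $$ (i, j)) ` (ball 0 (Min S) - star D) \<subseteq> (\<lambda>z. B z $$ (i, j)) ` (ball 0 (r i j) - star D)"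
      by (intro image_mono) auto
  qed
  ultimately show "\<exists>r>0. \<forall>i<D. \<forall>j<D. bounded ((\<lambda>z. B z $$ (i, j)) ` (ball 0 r - star D))" by blast
  show "\<exists>E. (\<forall>z. E z \<in> carrier_mat D D) \<and>
        (\<forall>i<D. \<forall>j<D. (\<lambda>z. E z $$ (i, j)) \<in> O[off_star_at_infinity D](\<lambda>z. 1 / z)) \<and>
        (\<forall>\<^sub>F z in off_star_at_infinity D. B z = (1\<^sub>m D + E z) * mat_diag D (\<lambda>i. z powi e i))"
    using error_carrier error asymp by blast
  show "\<exists>Bplus Bminus.
        (\<forall>x \<in> star D - {0}. Bplus x \<in> carrier_mat D D \<and> Bminus x \<in> carrier_mat D D) \<and>
        (\<forall>i<D. \<forall>j<D.
           continuous_on (star D - {0}) (\<lambda>x. Bplus x $$ (i, j)) \<and>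
           continuous_on (star D - {0}) (\<lambda>x. Bminus x $$ (i, j)) \<and>
           (\<forall>k<D.
              nontangential_limit (ray_tangent D k) (ray D k - {0})
                (\<lambda>z. B z $$ (i, j)) (\<lambda>x. Bplus x $$ (i, j)) \<and>
              nontangential_limit (- ray_tangent D k) (ray D k - {0})
                (\<lambda>z. B z $$ (i, j)) (\<lambda>x. Bminus x $$ (i, j)))) \<and>
        (\<forall>x \<in> star D - {0}. Bplus x = Bminus x * J x)"
    by (rule exI[of _ Bp], rule exI[of _ Bm])
       (use carrier_bdry bdry jump in \<open>auto simp: ray_boundary_values_def\<close>)
  show "\<forall>z \<in> - star D. B z \<in> carrier_mat D D" using carrier_off by blast
  show "\<forall>i<D. \<forall>j<D. (\<lambda>z. B z $$ (i, j)) holomorphic_on - star D"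
    using bdry by (auto simp: ray_boundary_values_def)
qed

lemma bigo_inverse_tendsto_0:
  assumes "f \<in> O[off_star_at_infinity D](\<lambda>z. 1 / z :: complex)"
  shows "(f \<longlongrightarrow> (0::complex)) (off_star_at_infinity D)"
proof -
  obtain c where c: "eventually (\<lambda>z. norm (f z) \<le> c * norm (1 / z)) (off_star_at_infinity D)"
    using assms by (elim landau_o.bigE)
  have "(\<lambda>z::complex. 1 / z) = inverse" by (simp add: fun_eq_iff inverse_eq_divide)
  then have "((\<lambda>z::complex. 1 / z) \<longlongrightarrow> 0) at_infinity"
    using tendsto_inverse_0[where 'a = complex] by simp
  then have "((\<lambda>z::complex. 1 / z) \<longlongrightarrow> 0) (off_star_at_infinity D)"
    by (rule tendsto_mono[rotated]) simp
  then have "((\<lambda>z::complex. c * norm (1 / z)) \<longlongrightarrow> c * norm (0::complex)) (off_star_at_infinity D)"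
    by (intro tendsto_intros)
  then have "((\<lambda>z::complex. c * norm (1 / z)) \<longlongrightarrow> 0) (off_star_at_infinity D)" by simp
  then show ?thesis by (rule Lim_null_comparison[OF c])
qed

lemma eventually_off_star_nonzero: "eventually (\<lambda>z. z \<notin> star D \<and> z \<noteq> 0) (off_star_at_infinity D)"
  unfolding eventually_off_star by (intro exI[of _ 1]) auto

lemma prod_powi: "(z::complex) \<noteq> 0 \<Longrightarrow> (\<Prod>i\<in>I. z powi e i) = z powi (\<Sum>i\<in>I. e i)"
  by (induction I rule: infinite_finite_induct) (auto simp: power_int_add)

context rh_problem
begin

text \<open>\<open>det B\<close> has no jump since \<open>det J = 1\<close>, and it tends to \<open>1\<close> because the exponents add up to zero, so
  Liouville's theorem applies. The boundary matrices inherit the determinant \<open>1\<close>: on the rays it is the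
  value of the entire extension.\<close>
lemma det_eq_1:
  assumes D: "even D" "D > 0" and e: "(\<Sum>i<D. e i) = 0"
    and J: "\<And>x. x \<in> star D - {0} \<Longrightarrow> J x \<in> carrier_mat D D \<and> det (J x) = 1"
  shows "\<And>z. z \<in> - star D \<Longrightarrow> det (B z) = 1"
    and "\<And>x. x \<in> star D - {0} \<Longrightarrow> det (Bp x) = 1"
    and "\<And>x. x \<in> star D - {0} \<Longrightarrow> det (Bm x) = 1"
proof -
  have eqm: "mat D D (($$) M) = M" if "M \<in> carrier_mat D D" for M :: "complex mat"
    using that by (intro eq_matI) auto
  have "ray_boundary_values D (\<lambda>z. det (B z)) (\<lambda>x. det (Bp x)) (\<lambda>x. det (Bp x))"
  proof (rule ray_boundary_values_cong[OF D(2,1) ray_boundary_values_det[OF bdry, of D]])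
    fix x assume x: "x \<in> star D - {0}"
    show "det (mat D D (\<lambda>(i, j). Bm x $$ (i, j))) = det (Bp x)"
      using det_mult[OF carrier_bdry(2)[OF x], of "J x"] J[OF x] jump[OF x] carrier_bdry(2)[OF x] by (simp add: eqm)
  qed (use carrier_off carrier_bdry in \<open>auto simp: eqm\<close>)
  then obtain h where h: "h holomorphic_on UNIV" "\<And>z. z \<notin> star D \<Longrightarrow> h z = det (B z)"
    "\<And>z. z \<in> star D - {0} \<Longrightarrow> h z = det (Bp z)"
    by (rule ray_boundary_values_no_jump[OF D]) blast
  have t1: "((\<lambda>z. det (mat D D (\<lambda>(i, j). (if i = j then 1 else 0) + E z $$ (i, j)))) \<longlongrightarrow>
     det (mat D D (\<lambda>(i, j). (if i = j then 1 else 0) + 0))) (off_star_at_infinity D)"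
    by (intro tendsto_det tendsto_add tendsto_const bigo_inverse_tendsto_0 error)
  have t2: "mat D D (\<lambda>(i, j). (if i = j then 1 else 0) + 0) = (1\<^sub>m D :: complex mat)"
    by (intro eq_matI) auto
  have t3: "mat D D (\<lambda>(i, j). (if i = j then 1 else 0) + E z $$ (i, j)) = 1\<^sub>m D + E z" for z
    using error_carrier[of z] by (intro eq_matI) auto
  have lim: "((\<lambda>z. det (1\<^sub>m D + E z)) \<longlongrightarrow> 1) (off_star_at_infinity D)"
    using t1 unfolding t2 t3 det_one .
  have "\<forall>\<^sub>F z in off_star_at_infinity D. h z = det (1\<^sub>m D + E z)"
    using asymp eventually_off_star_nonzero
  proof eventually_elim
    case (elim z)
    have "det (mat_diag D (\<lambda>i. z powi e i)) = z powi (\<Sum>i<D. e i)"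
      using elim by (simp add: det_mat_diag prod_powi)
    then show ?case using elim h(2)[of z] e error_carrier[of z] det_mult[of "1\<^sub>m D + E z" D "mat_diag D (\<lambda>i. z powi e i)"]
      by simp
  qed
  then have "(h \<longlongrightarrow> 1) (off_star_at_infinity D)" 
    using lim by (rule tendsto_cong[THEN iffD2])
  then have h1: "h z = 1" for z using entire_limit_off_star[OF D(2) h(1)] by blast
  show "det (B z) = 1" if "z \<in> - star D" for z using h(2) h1 that by auto
  show p: "det (Bp x) = 1" if "x \<in> star D - {0}" for x using h(3) h1 that by auto
  show "det (Bm x) = 1" if x: "x \<in> star D - {0}" for x
    using p[OF x] det_mult[OF carrier_bdry(2)[OF x], of "J x"] J[OF x] jump[OF x] by simp
qed

end

text \<open>The inverse is the adjugate, whose entries are polynomials in the entries of \<open>A\<close>; this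
  carries the boundary values over. At infinity \<open>(I + E)\<^bsup>-1\<^esup> - I = - (I + E)\<^bsup>-1\<^esup> E\<close>, a bounded factor times
  \<open>O(1/z)\<close>.\<close>
lemma rh_solution_inverse_transpose:
  assumes D: "even D" "D > 0" and e: "(\<Sum>i<D. e i) = 0"
    and J: "\<And>x. x \<in> star D - {0} \<Longrightarrow> J x \<in> carrier_mat D D \<and> det (J x) = 1"
    and J': "\<And>x. x \<in> star D - {0} \<Longrightarrow> J' x \<in> carrier_mat D D \<and> transpose_mat (J' x) * J x = 1\<^sub>m D"
    and A: "rh_solution D J e A"
  shows "\<And>z. z \<in> - star D \<Longrightarrow> A z \<in> carrier_mat D D \<and> det (A z) = 1"
    and "rh_solution D J' (\<lambda>i. - e i) (\<lambda>z. transpose_mat (mat_inv (A z)))"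
proof -
  obtain Ap Am E where "rh_problem D J e A Ap Am E" using A by (rule rh_solutionE)
  then interpret rh_problem D J e A Ap Am E .
  have det: "\<And>z. z \<in> - star D \<Longrightarrow> det (A z) = 1"
    "\<And>x. x \<in> star D - {0} \<Longrightarrow> det (Ap x) = 1" "\<And>x. x \<in> star D - {0} \<Longrightarrow> det (Am x) = 1"
    by (rule det_eq_1[OF D e J]; assumption)+
  show "A z \<in> carrier_mat D D \<and> det (A z) = 1" if "z \<in> - star D" for z
    using carrier_off det(1) that by blast
  have inv: "mat_inv (A z) = adj_mat (A z)" if "z \<in> - star D" for z
    by (rule mat_inv_eq_adj_mat(1)[OF carrier_off[OF that] det(1)[OF that]])
  have adj: "adj_mat (A z) \<in> carrier_mat D D" if "z \<in> - star D" for z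
    using adj_mat(1)[OF carrier_off[OF that]] .
  have adj_bdry: "adj_mat (Ap x) \<in> carrier_mat D D" "adj_mat (Am x) \<in> carrier_mat D D" if "x \<in> star D - {0}" for x
    using adj_mat(1)[OF carrier_bdry(1)[OF that]] adj_mat(1)[OF carrier_bdry(2)[OF that]] .
  have XE: "1\<^sub>m D + E z \<in> carrier_mat D D" for z using error_carrier[of z] by simp
  define E' where "E' z = transpose_mat (adj_mat (1\<^sub>m D + E z)) - 1\<^sub>m D" for z
  have good: "\<forall>\<^sub>F z in off_star_at_infinity D. det (1\<^sub>m D + E z) = 1 \<and>
      transpose_mat (mat_inv (A z)) = (1\<^sub>m D + E' z) * mat_diag D (\<lambda>i. z powi (- e i))"
    using asymp eventually_off_star_nonzero
  proof eventually_elim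
    case (elim z)
    let ?X = "1\<^sub>m D + E z" and ?\<Delta> = "mat_diag D (\<lambda>i. z powi e i)" and ?\<Delta>' = "mat_diag D (\<lambda>i. z powi (- e i))"
    have z: "z \<in> - star D" "z \<noteq> 0" using elim by auto
    have "det ?\<Delta> = 1" using z e by (simp add: det_mat_diag prod_powi)
    then have d1: "det ?X = 1"
      using det_mult[OF XE[of z], of ?\<Delta>] det(1)[OF z(1)] elim(1) by simp
    note X = adj_mat_inverse[OF XE d1]
    have carr: "?\<Delta> \<in> carrier_mat D D" "?\<Delta>' \<in> carrier_mat D D" by auto
    have "(?\<Delta>' * adj_mat ?X) * A z = ?\<Delta>' * ?\<Delta>"
      unfolding elim(1) by (rule mult_mat_cancel_middle[OF carr(2) X(3) XE carr(1) X(2)])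
    also have "\<dots> = 1\<^sub>m D" using z by (simp add: power_int_minus)
    finally have "adj_mat (A z) = ?\<Delta>' * adj_mat ?X"
      by (intro adj_mat_eqI[OF carrier_off[OF z(1)] det(1)[OF z(1)] mult_carrier_mat[OF carr(2) X(3)]])
    then have "transpose_mat (adj_mat (A z)) = transpose_mat (adj_mat ?X) * transpose_mat ?\<Delta>'"
      using transpose_mult[OF carr(2) X(3)] by simp
    also have "transpose_mat ?\<Delta>' = ?\<Delta>'" by (intro eq_matI) (auto simp: mat_diag_def)
    also have "transpose_mat (adj_mat ?X) = 1\<^sub>m D + E' z"
      unfolding E'_def using d1 X(3) by (intro eq_matI) auto
    finally show ?case using d1 inv[OF z(1)] by simp
  qed
  have "rh_problem D J' (\<lambda>i. - e i) (\<lambda>z. transpose_mat (mat_inv (A z)))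
     (\<lambda>x. transpose_mat (adj_mat (Ap x))) (\<lambda>x. transpose_mat (adj_mat (Am x))) E'"
  proof
    show "transpose_mat (mat_inv (A z)) \<in> carrier_mat D D" if "z \<in> - star D" for z
      using inv[OF that] adj[OF that] by simp
    show "transpose_mat (adj_mat (Ap x)) \<in> carrier_mat D D" "transpose_mat (adj_mat (Am x)) \<in> carrier_mat D D"
      if "x \<in> star D - {0}" for x
      using adj_bdry[OF that] by auto
    show "ray_boundary_values D (\<lambda>z. transpose_mat (mat_inv (A z)) $$ (i, j))
        (\<lambda>x. transpose_mat (adj_mat (Ap x)) $$ (i, j)) (\<lambda>x. transpose_mat (adj_mat (Am x)) $$ (i, j))"
      if ij: "i < D" "j < D" for i j
    proof (rule ray_boundary_values_cong[OF D(2,1)])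
      show "ray_boundary_values D (\<lambda>z. adj_mat (A z) $$ (j, i)) (\<lambda>z. adj_mat (Ap z) $$ (j, i)) (\<lambda>z. adj_mat (Am z) $$ (j, i))"
        by (rule ray_boundary_values_adj_mat[OF D carrier_off carrier_bdry bdry ij(2,1)])
      show "adj_mat (A z) $$ (j, i) = transpose_mat (mat_inv (A z)) $$ (i, j)" if "z \<notin> star D" for z
        using inv[of z] adj[of z] that ij by simp
      show "adj_mat (Ap z) $$ (j, i) = transpose_mat (adj_mat (Ap z)) $$ (i, j)"
        "adj_mat (Am z) $$ (j, i) = transpose_mat (adj_mat (Am z)) $$ (i, j)" if "z \<in> star D - {0}" for z
        using adj_bdry[OF that] ij by auto
    qed
    show "transpose_mat (adj_mat (Ap x)) = transpose_mat (adj_mat (Am x)) * J' x"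
      if x: "x \<in> star D - {0}" for x
    proof -
      note M = adj_mat_inverse[OF carrier_bdry(2)[OF x] det(3)[OF x]]
      have Jc: "J x \<in> carrier_mat D D" "transpose_mat (J' x) \<in> carrier_mat D D" using J[OF x] J'[OF x] by auto
      have "(transpose_mat (J' x) * adj_mat (Am x)) * Ap x = 1\<^sub>m D"
        unfolding jump[OF x] mult_mat_cancel_middle[OF Jc(2) M(3) carrier_bdry(2)[OF x] Jc(1) M(2)]
        using J'[OF x] by simp
      then have "adj_mat (Ap x) = transpose_mat (J' x) * adj_mat (Am x)"
        by (intro adj_mat_eqI[OF carrier_bdry(1)[OF x] det(2)[OF x] mult_carrier_mat[OF Jc(2) M(3)]])
      then show ?thesis using transpose_mult[OF Jc(2) M(3)] by simp
    qed
    show "E' z \<in> carrier_mat D D" for z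
      using adj_mat(1)[OF XE[of z]] by (auto simp: E'_def)
    show "\<forall>\<^sub>F z in off_star_at_infinity D.
        transpose_mat (mat_inv (A z)) = (1\<^sub>m D + E' z) * mat_diag D (\<lambda>i. z powi (- e i))"
      using good by eventually_elim simp
    show "(\<lambda>z. E' z $$ (i, j)) \<in> O[off_star_at_infinity D](\<lambda>z. 1 / z)" if ij: "i < D" "j < D" for i j
    proof -
      have "\<forall>\<^sub>F z in off_star_at_infinity D. E' z $$ (i, j) = (\<Sum>k<D. - (adj_mat (1\<^sub>m D + E z) $$ (j, k) * E z $$ (k, i)))"
        using good
      proof eventually_elim
        case (elim z)
        then have d: "det (1\<^sub>m D + E z) = 1" by simp
        note X = adj_mat_inverse[OF XE d]
        have "adj_mat (1\<^sub>m D + E z) * (1\<^sub>m D + E z) = adj_mat (1\<^sub>m D + E z) * 1\<^sub>m D + adj_mat (1\<^sub>m D + E z) * E z"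
          by (rule mult_add_distrib_mat[OF X(3) _ error_carrier]) simp
        then have "1\<^sub>m D = adj_mat (1\<^sub>m D + E z) + adj_mat (1\<^sub>m D + E z) * E z"
          unfolding X(2) right_mult_one_mat[OF X(3)] .
        then have "1\<^sub>m D $$ (j, i) = (adj_mat (1\<^sub>m D + E z) + adj_mat (1\<^sub>m D + E z) * E z) $$ (j, i)"
          by simp
        also have "\<dots> = adj_mat (1\<^sub>m D + E z) $$ (j, i) + (\<Sum>k<D. adj_mat (1\<^sub>m D + E z) $$ (j, k) * E z $$ (k, i))"
          using X(3) error_carrier[of z] ij by (simp add: scalar_prod_def lessThan_atLeast0)
        finally have "1\<^sub>m D $$ (j, i) - adj_mat (1\<^sub>m D + E z) $$ (j, i) = (\<Sum>k<D. adj_mat (1\<^sub>m D + E z) $$ (j, k) * E z $$ (k, i))"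
          by (simp only: add_diff_cancel_left')
        moreover have "E' z $$ (i, j) = adj_mat (1\<^sub>m D + E z) $$ (j, i) - 1\<^sub>m D $$ (j, i)"
          using d X(3) ij by (auto simp: E'_def)
        ultimately show ?case by (simp only: sum_negf flip: minus_diff_eq[of "1\<^sub>m D $$ (j, i)"])
      qed
      moreover have "(\<lambda>z. \<Sum>k<D. - (adj_mat (1\<^sub>m D + E z) $$ (j, k) * E z $$ (k, i))) \<in> O[off_star_at_infinity D](\<lambda>z. 1 / z)"
      proof (rule big_sum_in_bigo)
        fix k assume "k \<in> {..<D}"
        then have k: "k < D" by simp
        have "((\<lambda>z. (1\<^sub>m D + E z) $$ (i', j')) \<longlongrightarrow> (1\<^sub>m D) $$ (i', j')) (off_star_at_infinity D)" if "i' < D" "j' < D" for i' j'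
        proof -
          have "((\<lambda>z. (1\<^sub>m D) $$ (i', j') + E z $$ (i', j')) \<longlongrightarrow> (1\<^sub>m D) $$ (i', j') + 0) (off_star_at_infinity D)"
            by (intro tendsto_intros bigo_inverse_tendsto_0 error that)
          moreover have "(1\<^sub>m D + E z) $$ (i', j') = (1\<^sub>m D) $$ (i', j') + E z $$ (i', j')" for z
            using error_carrier[of z] that by auto
          ultimately show ?thesis by simp
        qed
        then have "((\<lambda>z. adj_mat (1\<^sub>m D + E z) $$ (j, k)) \<longlongrightarrow> adj_mat (1\<^sub>m D) $$ (j, k)) (off_star_at_infinity D)"
          by (intro tendsto_adj_mat[OF XE one_carrier_mat] ij k)
        then have "(\<lambda>z. adj_mat (1\<^sub>m D + E z) $$ (j, k)) \<in> O[off_star_at_infinity D](\<lambda>_. 1)"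
          by (intro bigoI_tendsto) auto
        then have "(\<lambda>z. adj_mat (1\<^sub>m D + E z) $$ (j, k) * E z $$ (k, i)) \<in> O[off_star_at_infinity D](\<lambda>z. 1 * (1 / z))"
          using error[OF k ij(1)] by (rule landau_o.big.mult)
        then show "(\<lambda>z. - (adj_mat (1\<^sub>m D + E z) $$ (j, k) * E z $$ (k, i))) \<in> O[off_star_at_infinity D](\<lambda>z. 1 / z)"
          by simp
      qed
      ultimately show ?thesis by (rule landau_o.big.in_cong[THEN iffD2])
    qed
  qed
  then show "rh_solution D J' (\<lambda>i. - e i) (\<lambda>z. transpose_mat (mat_inv (A z)))" by (rule rh_solutionI)
qed

text \<open>In \<open>B A\<^sup>T\<close> the jumps cancel, \<open>J' J\<^sup>T = I\<close>, and so do the powers of \<open>z\<close> at infinity. Every entry is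
  thus entire with the corresponding entry of the identity matrix as its limit.\<close>
lemma rh_solution_unique:
  assumes D: "even D" "D > 0"
    and e: "(\<Sum>i<D. e i) = 0"
    and J: "\<And>x. x \<in> star D - {0} \<Longrightarrow> J x \<in> carrier_mat D D \<and> det (J x) = 1"
    and J': "\<And>x. x \<in> star D - {0} \<Longrightarrow> J' x \<in> carrier_mat D D \<and> transpose_mat (J' x) * J x = 1\<^sub>m D"
    and A: "rh_solution D J e A" and B: "rh_solution D J' (\<lambda>i. - e i) B" and z: "z \<in> - star D"
  shows "B z = transpose_mat (mat_inv (A z))"
proof -
  obtain Ap Am E where "rh_problem D J e A Ap Am E" using A by (rule rh_solutionE)
  then interpret A: rh_problem D J e A Ap Am E .
  obtain Bp Bm E' where "rh_problem D J' (\<lambda>i. - e i) B Bp Bm E'" using B by (rule rh_solutionE)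
  then interpret B: rh_problem D J' "\<lambda>i. - e i" B Bp Bm E' .
  have idx: "(M * transpose_mat N) $$ (i, j) = (\<Sum>k<D. M $$ (i, k) * N $$ (j, k))"
    if "M \<in> carrier_mat D D" "N \<in> carrier_mat D D" "i < D" "j < D" for M N :: "complex mat" and i j
    using that by (simp add: scalar_prod_def lessThan_atLeast0)
  have nojump: "Bp x * transpose_mat (Ap x) = Bm x * transpose_mat (Am x)" if x: "x \<in> star D - {0}" for x
  proof -
    have c: "J x \<in> carrier_mat D D" "J' x \<in> carrier_mat D D" "transpose_mat (J x) \<in> carrier_mat D D" "transpose_mat (J' x) \<in> carrier_mat D D"
      "transpose_mat (Am x) \<in> carrier_mat D D"
      using J[OF x] J'[OF x] A.carrier_bdry(2)[OF x] by auto
    have "J x * transpose_mat (J' x) = 1\<^sub>m D"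
      by (rule mat_mult_left_right_inverse[OF c(4,1)]) (use J'[OF x] in simp)
    then have "transpose_mat (J x * transpose_mat (J' x)) = 1\<^sub>m D" by simp
    then have JJ: "J' x * transpose_mat (J x) = 1\<^sub>m D"
      using transpose_mult[OF c(1,4)] by simp
    have "Bp x * transpose_mat (Ap x) = (Bm x * J' x) * (transpose_mat (J x) * transpose_mat (Am x))"
      using B.jump[OF x] A.jump[OF x] transpose_mult[OF A.carrier_bdry(2)[OF x] c(1)] by simp
    also have "\<dots> = Bm x * transpose_mat (Am x)"
      by (rule mult_mat_cancel_middle[OF B.carrier_bdry(2)[OF x] c(2,3,5) JJ])
    finally show ?thesis .
  qed
  have entry: "(B z * transpose_mat (A z)) $$ (i, j) = 1\<^sub>m D $$ (i, j)" if ij: "i < D" "j < D" for i j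
  proof -
    have "ray_boundary_values D (\<lambda>z. \<Sum>k<D. B z $$ (i, k) * A z $$ (j, k))
       (\<lambda>z. \<Sum>k<D. Bp z $$ (i, k) * Ap z $$ (j, k)) (\<lambda>z. \<Sum>k<D. Bp z $$ (i, k) * Ap z $$ (j, k))"
    proof (rule ray_boundary_values_cong[OF D(2,1)])
      show "ray_boundary_values D (\<lambda>z. \<Sum>k<D. B z $$ (i, k) * A z $$ (j, k))
       (\<lambda>z. \<Sum>k<D. Bp z $$ (i, k) * Ap z $$ (j, k)) (\<lambda>z. \<Sum>k<D. Bm z $$ (i, k) * Am z $$ (j, k))"
        by (intro ray_boundary_values_sum ray_boundary_values_mult A.bdry B.bdry ij) auto
      show "(\<Sum>k<D. Bm x $$ (i, k) * Am x $$ (j, k)) = (\<Sum>k<D. Bp x $$ (i, k) * Ap x $$ (j, k))"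
        if x: "x \<in> star D - {0}" for x
        using idx[OF B.carrier_bdry(2)[OF x] A.carrier_bdry(2)[OF x] ij] idx[OF B.carrier_bdry(1)[OF x] A.carrier_bdry(1)[OF x] ij] nojump[OF x] by simp
    qed auto
    then obtain h where h: "h holomorphic_on UNIV"
      "\<And>z. z \<notin> star D \<Longrightarrow> h z = (\<Sum>k<D. B z $$ (i, k) * A z $$ (j, k))"
      by (rule ray_boundary_values_no_jump[OF D]) blast
    have lim: "((\<lambda>z. \<Sum>k<D. (1\<^sub>m D $$ (i, k) + E' z $$ (i, k)) * (1\<^sub>m D $$ (j, k) + E z $$ (j, k))) \<longlongrightarrow>
        (\<Sum>k<D. (1\<^sub>m D $$ (i, k) + 0) * (1\<^sub>m D $$ (j, k) + 0))) (off_star_at_infinity D)"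
      by (intro tendsto_sum tendsto_mult tendsto_add tendsto_const bigo_inverse_tendsto_0 A.error B.error ij) auto
    have lim_eq: "(\<Sum>k<D. (1\<^sub>m D $$ (i, k) + 0) * (1\<^sub>m D $$ (j, k) + 0)) = (1\<^sub>m D $$ (i, j) :: complex)"
      using idx[of "1\<^sub>m D" "1\<^sub>m D" i j] ij by simp
    have "\<forall>\<^sub>F z in off_star_at_infinity D. h z =
        (\<Sum>k<D. (1\<^sub>m D $$ (i, k) + E' z $$ (i, k)) * (1\<^sub>m D $$ (j, k) + E z $$ (j, k)))"
      using A.asymp B.asymp eventually_off_star_nonzero
    proof eventually_elim
      case (elim z)
      have "B z $$ (i, k) = (1\<^sub>m D $$ (i, k) + E' z $$ (i, k)) * z powi (- e k)"
        "A z $$ (j, k) = (1\<^sub>m D $$ (j, k) + E z $$ (j, k)) * z powi (e k)" if "k < D" for k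
        using elim A.error_carrier[of z] B.error_carrier[of z] ij that by (auto simp: mat_diag_mult_right[of _ D])
      then have "h z = (\<Sum>k<D. ((1\<^sub>m D $$ (i, k) + E' z $$ (i, k)) * z powi (- e k)) * ((1\<^sub>m D $$ (j, k) + E z $$ (j, k)) * z powi (e k)))"
        using h(2)[of z] elim by simp
      also have "\<dots> = (\<Sum>k<D. (1\<^sub>m D $$ (i, k) + E' z $$ (i, k)) * (1\<^sub>m D $$ (j, k) + E z $$ (j, k)))"
        using elim by (intro sum.cong) (auto simp: power_int_minus)
      finally show ?case .
    qed
    then have "(h \<longlongrightarrow> 1\<^sub>m D $$ (i, j)) (off_star_at_infinity D)"
      using lim unfolding lim_eq by (rule tendsto_cong[THEN iffD2])
    then have "h z = 1\<^sub>m D $$ (i, j)" by (rule entire_limit_off_star[OF D(2) h(1)])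
    then show ?thesis using h(2)[of z] z idx[OF B.carrier_off[OF z] A.carrier_off[OF z] ij] by simp
  qed
  have BA: "B z * transpose_mat (A z) = 1\<^sub>m D"
    using entry B.carrier_off[OF z] A.carrier_off[OF z] by (intro eq_matI) auto
  have "A z \<in> carrier_mat D D \<and> det (A z) = 1"
    by (rule rh_solution_inverse_transpose(1)[OF D e J J' A z])
  then have Az: "A z \<in> carrier_mat D D" "det (A z) = 1" by auto
  have Bz: "transpose_mat (B z) \<in> carrier_mat D D" using B.carrier_off[OF z] by simp
  have "A z * transpose_mat (B z) = transpose_mat (B z * transpose_mat (A z))"
    using transpose_mult[OF B.carrier_off[OF z], of "transpose_mat (A z)"] Az by simp
  then have "transpose_mat (B z) * A z = 1\<^sub>m D"
    unfolding BA by (intro mat_mult_left_right_inverse[OF Az(1) Bz]) simp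
  then have "adj_mat (A z) = transpose_mat (B z)" by (rule adj_mat_eqI[OF Az Bz])
  then show ?thesis using mat_inv_eq_adj_mat(1)[OF Az] by simp
qed

section \<open>Jumps across the rays have vanishing total integral\<close>

lemma udir_Suc: "udir D (Suc k) = udir D k * cis (2 * pi / real D)"
  by (simp add: udir_def cis_mult add_divide_distrib algebra_simps)

lemma sector_disjoint_star:
  assumes D: "D \<ge> 4" and k: "k < D"
    and z: "0 < Im (z / udir D k)" "Im (z / udir D (Suc k)) < 0"
  shows "z \<notin> star D"
proof -
  define \<phi> where "\<phi> = 2 * pi / real D"
  have \<phi>: "0 < \<phi>" "\<phi> \<le> pi / 2" using D by (auto simp: \<phi>_def field_simps)
  define w where "w = z / udir D k"
  have "z \<noteq> 0" using z by auto
  then have w: "w \<noteq> 0" "w = of_real (norm w) * cis (Arg w)"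
    using cis_Arg[of w] by (auto simp: w_def sgn_eq field_simps)
  have nw: "norm w > 0" using w by simp
  have "Im w = norm w * sin (Arg w)" by (subst w(2)) simp
  then have s: "sin (Arg w) > 0" using z(1) nw by (simp add: w_def zero_less_mult_iff)
  have "0 < Arg w"
  proof (rule ccontr)
    assume "\<not> 0 < Arg w"
    then have "sin (- Arg w) \<ge> 0" using Arg_bounded[of w] by (intro sin_ge_zero) auto
    then show False using s by simp
  qed
  have "z / udir D (Suc k) = w / cis \<phi>" by (simp add: udir_Suc w_def \<phi>_def)
  also have "\<dots> = of_real (norm w) * cis (Arg w - \<phi>)"
    by (subst w(2)) (simp add: cis_divide[symmetric])
  finally have "norm w * sin (Arg w - \<phi>) < 0" using z(2) by simp
  then have s2: "sin (Arg w - \<phi>) < 0" using nw by (simp add: mult_less_0_iff)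
  have "Arg w < \<phi>"
  proof (rule ccontr)
    assume "\<not> Arg w < \<phi>"
    then have "sin (Arg w - \<phi>) \<ge> 0" using Arg_bounded[of w] \<phi> by (intro sin_ge_zero) auto
    then show False using s2 by simp
  qed
  have "of_real (norm w) * udir D k \<in> star D" unfolding star_def ray_eq using k by force
  moreover have "z = of_real (norm w) * udir D k * cis (Arg w)"
  proof -
    have "z = w * udir D k" by (simp add: w_def)
    also have "\<dots> = of_real (norm w) * cis (Arg w) * udir D k" using w(2) by metis
    finally show ?thesis by (simp add: algebra_simps)
  qed
  ultimately show ?thesis
    using mult_cis_notin_star[of D "of_real (norm w) * udir D k" "Arg w"] w(1) \<open>0 < Arg w\<close> \<open>Arg w < \<phi>\<close> D
    by (simp add: \<phi>_def)
qed

lemma on_open_ray_if_Im_0: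
  assumes "Im (z / u) = 0" "u \<noteq> 0" "0 < Re (z / u)"
  shows "z \<in> open_ray u"
proof -
  have "z / u = of_real (Re (z / u))" using assms by (simp add: complex_eq_iff)
  then have "z = of_real (Re (z / u)) * u" using assms(2) by (simp add: field_simps)
  then show ?thesis using assms(3) unfolding open_ray_def by blast
qed

lemma Im_divide_open_ray: "z \<in> open_ray u \<Longrightarrow> u \<noteq> 0 \<Longrightarrow> Im (z / u) = 0"
  by (auto simp: open_ray_def)

text \<open>\<open>G\<close> is a primitive of \<open>f\<close> on the closed sector between two consecutive rays without its vertex. The
  sector is described by the three half-planes in the definition of \<open>C\<close>: the strict one
  removes exactly the vertex, so the set is convex and Cauchy's theorem applies on it
  although \<open>f\<close> is merely bounded near the origin. The last estimate compares the two rays along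
  a chord, which stays in the annulus \<open>r / 2 \<le> \<bar>z\<bar> \<le> r\<close> because the opening angle is
  at most \<open>pi / 2\<close>.\<close>
lemma sector_primitive:
  fixes gL gR :: "complex \<Rightarrow> complex"
  assumes D: "D \<ge> 4" and k: "k < D"
  defines "u \<equiv> udir D k" and "v \<equiv> udir D (Suc k)"
  assumes f: "f holomorphic_on - star D"
    and gL: "\<And>x. x \<in> open_ray u \<Longrightarrow> (f \<longlongrightarrow> gL x) (at x within {z. 0 < Im (z / u)})" "continuous_on (open_ray u) gL"
    and gR: "\<And>x. x \<in> open_ray v \<Longrightarrow> (f \<longlongrightarrow> gR x) (at x within {z. Im (z / v) < 0})" "continuous_on (open_ray v) gR"
  obtains G where
    "\<And>r. r > 0 \<Longrightarrow> ((\<lambda>r. G (of_real r * u)) has_vector_derivative u * gL (of_real r * u)) (at r)"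
    "\<And>r. r > 0 \<Longrightarrow> ((\<lambda>r. G (of_real r * v)) has_vector_derivative v * gR (of_real r * v)) (at r)"
    "\<And>r M. r > 0 \<Longrightarrow> (\<And>z. z \<notin> star D \<Longrightarrow> r / 2 \<le> norm z \<Longrightarrow> norm z \<le> r \<Longrightarrow> norm (f z) \<le> M) \<Longrightarrow>
       norm (G (of_real r * u) - G (of_real r * v)) \<le> 2 * M * r"
proof -
  define \<phi> where "\<phi> = 2 * pi / real D"
  define c s where "c = cos \<phi>" and "s = sin \<phi>"
  have \<phi>: "0 < \<phi>" "\<phi> \<le> pi / 2" using D by (auto simp: \<phi>_def field_simps)
  have cs: "0 \<le> c" "0 < s" "c\<^sup>2 + s\<^sup>2 = 1"
    unfolding c_def s_def using \<phi> by (auto intro!: cos_ge_zero sin_gt_zero simp: sin_cos_squared_add2)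
  have uv: "u \<noteq> 0" "v \<noteq> 0" "norm u = 1" "norm v = 1" by (auto simp: u_def v_def)
  have v_u: "v / u = Complex c s" and u_v: "u / v = Complex c (- s)"
  proof -
    have *: "v = u * cis \<phi>" by (simp add: u_def v_def udir_Suc \<phi>_def)
    have "v / u = cis \<phi>" using uv * by simp
    then show "v / u = Complex c s" by (simp add: c_def s_def complex_eq_iff)
    have "u / v = cis (- \<phi>)" using uv * by (simp add: cis_inverse[symmetric] field_simps)
    then show "u / v = Complex c (- s)" by (simp add: c_def s_def complex_eq_iff)
  qed
  have Im_v: "Im (z / v) = Im (z / u) * c - Re (z / u) * s" for z
  proof -
    have *: "z / v = (z / u) * (u / v)" using uv by simp
    show ?thesis unfolding * unfolding u_v times_complex.sel complex.sel by simp
  qed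
  have Im_u: "Im (z / u) = Im (z / v) * c + Re (z / v) * s" for z
  proof -
    have *: "z / u = (z / v) * (v / u)" using uv by simp
    show ?thesis unfolding * unfolding v_u times_complex.sel complex.sel by simp
  qed
  define C where "C = {z. 0 \<le> Im (z / u) \<and> Im (z / v) \<le> 0 \<and> Im (z / v) < Im (z / u)}"
  define U where "U = {z. 0 < Im (z / u) \<and> Im (z / v) < 0}"
  have UC: "U \<subseteq> C" by (auto simp: U_def C_def)
  have opU: "open U" unfolding U_def by (intro open_Collect_conj open_Collect_less continuous_intros) (use uv in auto)
  have Ustar: "U \<subseteq> - star D" using sector_disjoint_star[OF D k] by (auto simp: U_def u_def v_def)
  have C_u: "z \<in> open_ray u" if "z \<in> C" "Im (z / u) = 0" for z
  proof (rule on_open_ray_if_Im_0[OF that(2) uv(1)])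
    have "0 < Re (z / u) * s" using that Im_v[of z] by (auto simp: C_def)
    then show "0 < Re (z / u)" using cs by (simp add: zero_less_mult_iff)
  qed
  have C_v: "z \<in> open_ray v" if "z \<in> C" "Im (z / v) = 0" for z
  proof (rule on_open_ray_if_Im_0[OF that(2) uv(2)])
    have "0 < Re (z / v) * s" using that Im_u[of z] by (auto simp: C_def)
    then show "0 < Re (z / v)" using cs by (simp add: zero_less_mult_iff)
  qed
  have uC: "open_ray u \<subseteq> C"
  proof
    fix z assume "z \<in> open_ray u"
    then obtain r where "r > 0" "z = of_real r * u" unfolding open_ray_def by blast
    then have "z / u = of_real r" using uv by simp
    then show "z \<in> C" using Im_v[of z] cs \<open>r > 0\<close> by (simp add: C_def)
  qed
  have vC: "open_ray v \<subseteq> C"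
  proof
    fix z assume "z \<in> open_ray v"
    then obtain r where "r > 0" "z = of_real r * v" unfolding open_ray_def by blast
    then have "z / v = of_real r" using uv by simp
    then show "z \<in> C" using Im_u[of z] cs \<open>r > 0\<close> by (simp add: C_def)
  qed
  have lin: "linear (\<lambda>z. Im (z / w))" for w
    by (intro linearI) (simp_all add: add_divide_distrib scaleR_conv_of_real times_divide_eq_right[symmetric]
        del: times_divide_eq_right)
  have "C = (\<lambda>z. Im (z / u)) -` {0..} \<inter> (\<lambda>z. Im (z / v)) -` {..0} \<inter> (\<lambda>z. Im (z / u) - Im (z / v)) -` {0<..}"
    by (auto simp: C_def)
  then have convC: "convex C"
    by (auto intro!: convex_Int convex_linear_vimage lin linear_compose_sub)
  have intC: "interior C \<subseteq> U"
  proof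
    fix z assume z: "z \<in> interior C"
    then obtain e where e: "e > 0" "ball z e \<subseteq> C" by (auto simp: mem_interior)
    have "z - of_real (e/2) * \<i> * u \<in> ball z e" "z + of_real (e/2) * \<i> * v \<in> ball z e"
      using e uv by (auto simp: dist_norm norm_mult)
    then have "z - of_real (e/2) * \<i> * u \<in> C" "z + of_real (e/2) * \<i> * v \<in> C" using e by auto
    moreover have "(z - of_real (e/2) * \<i> * u) / u = z / u - of_real (e/2) * \<i>"
      "(z + of_real (e/2) * \<i> * v) / v = z / v + of_real (e/2) * \<i>"
      using uv by (auto simp: field_simps)
    ultimately show "z \<in> U" using e by (auto simp: C_def U_def)
  qed
  define F where "F z = (if Im (z / u) = 0 then gL z else if Im (z / v) = 0 then gR z else f z)" for z
  have FU: "F z = f z" if "z \<in> U" for z using that by (auto simp: F_def U_def)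
  have holU: "F holomorphic_on U"
    using holomorphic_on_subset[OF f Ustar] FU holomorphic_cong[of U U F f] by auto
  have contC: "continuous_on C F"
    unfolding continuous_on
  proof
    fix z0 assume z0: "z0 \<in> C"
    consider "z0 \<in> U" | "Im (z0 / u) = 0" | "Im (z0 / v) = 0"
      using z0 by (fastforce simp: C_def U_def)
    then show "(F \<longlongrightarrow> F z0) (at z0 within C)"
    proof cases
      case 1
      then have "isCont F z0"
        using holU opU by (meson continuous_on_eq_continuous_at holomorphic_on_imp_continuous_on)
      then show ?thesis unfolding isCont_def by (rule tendsto_within_subset) simp
    next
      case 2
      show ?thesis
      proof (rule glued_limit[OF C_u[OF z0 2] _ _ _ gL(2) gL(1)[OF C_u[OF z0 2]]])
        show "z0 \<in> {z. Im (z / v) < 0}" using 2 z0 by (auto simp: C_def)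
        show "open {z. Im (z / v) < 0}" by (intro open_Collect_less continuous_intros) (use uv in auto)
        show "C \<subseteq> open_ray u \<union> {z. 0 < Im (z / u)}" using C_u by (force simp: C_def)
      qed (use Im_divide_open_ray[of _ u] uv in \<open>auto simp: F_def\<close>)
    next
      case 3
      show ?thesis
      proof (rule glued_limit[OF C_v[OF z0 3] _ _ _ gR(2) gR(1)[OF C_v[OF z0 3]]])
        show "z0 \<in> {z. 0 < Im (z / u)}" using 3 z0 by (auto simp: C_def)
        show "open {z. 0 < Im (z / u)}" by (intro open_Collect_less continuous_intros) (use uv in auto)
        show "C \<subseteq> open_ray v \<union> {z. Im (z / v) < 0}" using C_v by (force simp: C_def)
      qed (use Im_divide_open_ray[of _ v] uv in \<open>auto simp: F_def\<close>)
    qed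
  qed
  obtain G where G: "\<And>z. z \<in> C \<Longrightarrow> (G has_field_derivative F z) (at z within C)"
  proof (rule holomorphic_convex_primitive[OF convC _ contC])
    show "F field_differentiable at x" if "x \<in> interior C - {}" for x
      using holomorphic_on_imp_differentiable_at[OF holU opU] intC that by auto
  qed auto
  have der: "((\<lambda>r. G (of_real r * w)) has_vector_derivative w * F (of_real r * w)) (at r)"
    if "open_ray w \<subseteq> C" "r > 0" for r w
  proof -
    have sub: "(\<lambda>r. of_real r * w) ` {0<..} \<subseteq> C" using that(1) by (auto simp: open_ray_def)
    have "((\<lambda>r. of_real r * w) has_vector_derivative w) (at r within {0<..})"
      by (auto intro!: derivative_eq_intros)
    moreover have "(G has_field_derivative F (of_real r * w)) (at (of_real r * w) within (\<lambda>r. of_real r * w) ` {0<..})"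
      by (rule DERIV_subset[OF G sub]) (use sub that(2) in blast)
    ultimately have "(G \<circ> (\<lambda>r. of_real r * w) has_vector_derivative w * F (of_real r * w)) (at r within {0<..})"
      by (rule field_vector_diff_chain_within)
    then have "(G \<circ> (\<lambda>r. of_real r * w) has_vector_derivative w * F (of_real r * w)) (at r)"
      by (rule has_vector_derivative_within_open[THEN iffD1, rotated 2]) (use that(2) in auto)
    then show ?thesis unfolding o_def .
  qed
  show ?thesis
  proof
    show "((\<lambda>r. G (of_real r * u)) has_vector_derivative u * gL (of_real r * u)) (at r)" if "r > 0" for r
    proof -
      have "F (of_real r * u) = gL (of_real r * u)" using uv by (simp add: F_def)
      then show ?thesis using der[OF uC that] by (simp only:)
    qed
    show "((\<lambda>r. G (of_real r * v)) has_vector_derivative v * gR (of_real r * v)) (at r)" if "r > 0" for r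
    proof -
      have *: "of_real r * v / u = of_real r * (v / u)" by simp
      have "Im (of_real r * v / u) = r * s" unfolding * v_u by simp
      then have "F (of_real r * v) = gR (of_real r * v)" using uv cs that by (simp add: F_def)
      then show ?thesis using der[OF vC that] by (simp only:)
    qed
    fix r M :: real
    assume r: "r > 0" and M: "\<And>z. z \<notin> star D \<Longrightarrow> r / 2 \<le> norm z \<Longrightarrow> norm z \<le> r \<Longrightarrow> norm (f z) \<le> M"
    define p where "p t = of_real ((1 - t) * r) * u + of_real (t * r) * v" for t
    have pC: "p t \<in> C" "0 < t \<Longrightarrow> t < 1 \<Longrightarrow> p t \<in> U" if "0 \<le> t" "t \<le> 1" for t
    proof -
      have "p t / u = of_real ((1 - t) * r) + of_real (t * r) * (v / u)"
        using uv by (simp add: p_def add_divide_distrib)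
      then have 1: "Im (p t / u) = t * r * s" unfolding v_u by simp
      have "p t / v = of_real ((1 - t) * r) * (u / v) + of_real (t * r)"
        using uv by (simp add: p_def add_divide_distrib)
      then have 2: "Im (p t / v) = - ((1 - t) * r * s)" unfolding u_v by simp
      have "t * r * s + (1 - t) * r * s = r * s" by (simp add: algebra_simps)
      moreover have "0 < r * s" using r cs by simp
      ultimately have "- ((1 - t) * r * s) < t * r * s" by linarith
      then show "p t \<in> C" unfolding C_def using that r cs by (simp add: 1 2)
      show "0 < t \<Longrightarrow> t < 1 \<Longrightarrow> p t \<in> U" unfolding U_def using r cs by (simp add: 1 2)
    qed
    have pn: "r / 2 \<le> norm (p t)" "norm (p t) \<le> r" if t: "0 \<le> t" "t \<le> 1" for t
    proof -
      have "norm (of_real ((1 - t) * r) * u) = (1 - t) * r" "norm (of_real (t * r) * v) = t * r"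
        unfolding norm_mult norm_of_real uv using t r by simp_all
      then have "norm (p t) \<le> (1 - t) * r + t * r"
        unfolding p_def by (intro norm_triangle_le) simp
      then show "norm (p t) \<le> r" by (simp add: algebra_simps)
      have "p t / u = of_real ((1 - t) * r) + of_real (t * r) * (v / u)"
        using uv by (simp add: p_def add_divide_distrib)
      then have "p t / u = Complex (((1 - t) + t * c) * r) (t * r * s)" unfolding v_u
        by (simp add: complex_eq_iff algebra_simps)
      moreover have "norm (p t) = norm (p t / u)" using uv by (simp add: norm_divide)
      ultimately have "(norm (p t))\<^sup>2 = (((1 - t) + t * c) * r)\<^sup>2 + (t * r * s)\<^sup>2"
        by (simp add: cmod_power2)
      also have "\<dots> = r\<^sup>2 * ((1 - t)\<^sup>2 + 2 * (t * (1 - t)) * c + t\<^sup>2 * (c\<^sup>2 + s\<^sup>2))"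
        by (simp add: power2_eq_square algebra_simps)
      also have "\<dots> \<ge> r\<^sup>2 * (1 / 4)"
      proof (rule mult_left_mono)
        have "0 \<le> 2 * (t * (1 - t)) * c" using t cs by simp
        moreover have "(1 - t)\<^sup>2 + t\<^sup>2 = 2 * (t - 1/2)\<^sup>2 + 1/2" by (simp add: power2_eq_square field_simps)
        moreover have "0 \<le> 2 * (t - 1/2)\<^sup>2" by simp
        ultimately show "1 / 4 \<le> (1 - t)\<^sup>2 + 2 * (t * (1 - t)) * c + t\<^sup>2 * (c\<^sup>2 + s\<^sup>2)"
          unfolding cs(3) by linarith
      qed simp
      finally have "(r / 2)\<^sup>2 \<le> (norm (p t))\<^sup>2" by (simp add: power_divide)
      then show "r / 2 \<le> norm (p t)" by (rule power2_le_imp_le) simp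
    qed
    have pd: "(p has_vector_derivative (of_real r * (v - u))) (at t within S)" for t S
      unfolding p_def by (auto intro!: derivative_eq_intros simp: algebra_simps)
    have Gd: "((\<lambda>t. G (p t)) has_vector_derivative of_real r * (v - u) * F (p t)) (at t within {0..1})"
      if "t \<in> {0..1}" for t
    proof -
      have sub: "p ` {0..1} \<subseteq> C" using pC(1) by auto
      have "(G \<circ> p has_vector_derivative of_real r * (v - u) * F (p t)) (at t within {0..1})"
        by (rule field_vector_diff_chain_within[OF pd DERIV_subset[OF G sub]]) (use sub that in auto)
      then show ?thesis by (simp add: o_def)
    qed
    have nvu: "norm (v - u) \<le> 2" using norm_triangle_ineq4[of v u] uv by simp
    have "norm (G (p 1) - G (p 0)) \<le> 2 * M * r * 1 - 2 * M * r * 0"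
    proof (rule differentiable_bound_general)
      show "continuous_on {0..1} (\<lambda>t. G (p t))"
        unfolding continuous_on_eq_continuous_within using Gd has_vector_derivative_continuous by blast
      fix t :: real assume t: "0 < t" "t < 1"
      show "((\<lambda>t. G (p t)) has_vector_derivative of_real r * (v - u) * F (p t)) (at t)"
        using Gd[of t] t at_within_interior[of t "{0..1}"] by auto
      have "norm (f (p t)) \<le> M" using M[of "p t"] Ustar pC(2)[of t] pn[of t] t by auto
      then have "r * (norm (v - u) * norm (f (p t))) \<le> r * (2 * M)"
        using nvu r by (intro mult_left_mono mult_mono) auto
      moreover have "norm (of_real r * (v - u) * F (p t)) = r * (norm (v - u) * norm (f (p t)))"
        using FU[of "p t"] pC(2)[of t] t r by (simp only: norm_mult norm_of_real)
      ultimately show "norm (of_real r * (v - u) * F (p t)) \<le> 2 * M * r" by (simp add: algebra_simps)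
    qed (auto intro!: continuous_intros derivative_eq_intros)
    then show "norm (G (of_real r * u) - G (of_real r * v)) \<le> 2 * M * r"
      by (simp add: p_def norm_minus_commute)
  qed
qed

text \<open>If \<open>h k\<close> is a primitive of the jump along the ray with number \<open>k\<close>, then the sum of all \<open>h k\<close> has the same
  limit at \<open>0\<close> and at infinity, that is, the jump has total integral zero. Up to a constant this sum is the sum over
  the sectors of the differences of \<open>sector_primitive\<close>, and these tend to \<open>0\<close> at both ends.
  The sign accounts for the negative half-line, which is oriented towards the origin.\<close>
lemma ray_jump_primitives:
  assumes D: "even D" "D \<ge> 4" and f: "ray_boundary_values D f fp fm"
    and decay: "f \<in> O[off_star_at_infinity D](\<lambda>z. 1 / z ^ 2)"
    and h: "\<And>k r. k < D \<Longrightarrow> r > 0 \<Longrightarrow> (h k has_vector_derivative udir D k *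
      ((if k = D div 2 then - 1 else 1) * (fp (of_real r * udir D k) - fm (of_real r * udir D k)))) (at r)"
  obtains c :: complex where "((\<lambda>r. \<Sum>k<D. h k r) \<longlongrightarrow> c) (at_right 0)" "((\<lambda>r. \<Sum>k<D. h k r) \<longlongrightarrow> c) at_top"
proof -
  have D0: "D > 0" using D by simp
  define u where "u = udir D"
  have uD: "u D = u 0" using D0 by (simp add: u_def)
  define gL where "gL k = (if k = D div 2 then fm else fp)" for k
  define gR where "gR k = (if k = D div 2 then fp else fm)" for k
  have lim: "(f \<longlongrightarrow> gL k x) (at x within {z. 0 < Im (z / u k)})"
     "(f \<longlongrightarrow> gR k x) (at x within {z. Im (z / u k) < 0})" if "k < D" "x \<in> open_ray (u k)" for k x
    using ray_boundary_values_half_plane[OF D(1) that(1) f that(2)[unfolded u_def]] ray_tangent_eq[OF D(1) that(1)]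
    by (auto simp: gL_def gR_def u_def split: if_splits)
  have cont: "continuous_on (open_ray (u k)) (gL k)" "continuous_on (open_ray (u k)) (gR k)" if "k < D" for k
    using f continuous_on_subset[OF _ open_ray_udir_subset_star[OF that]]
    by (auto simp: gL_def gR_def u_def ray_boundary_values_def)
  \<comment> \<open>The last sector ends at the ray number \<open>D\<close>, which is the ray number \<open>0\<close>.\<close>
  define gR' where "gR' k = (if k = D then gR 0 else gR k)" for k
  have lim': "(f \<longlongrightarrow> gR' (Suc k) x) (at x within {z. Im (z / u (Suc k)) < 0})"
    if "k < D" "x \<in> open_ray (u (Suc k))" for k x
    using lim(2)[of "Suc k" x] lim(2)[of 0 x] that D0 uD by (cases "Suc k = D") (auto simp: gR'_def)
  have cont': "continuous_on (open_ray (u (Suc k))) (gR' (Suc k))" if "k < D" for k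
    using cont(2)[of "Suc k"] cont(2)[of 0] that D0 uD by (cases "Suc k = D") (auto simp: gR'_def)
  have hol: "f holomorphic_on - star D" using f by (simp add: ray_boundary_values_def)
  have "\<exists>G. (\<forall>r>0. ((\<lambda>r. G (of_real r * u k)) has_vector_derivative u k * gL k (of_real r * u k)) (at r)) \<and>
     (\<forall>r>0. ((\<lambda>r. G (of_real r * u (Suc k))) has_vector_derivative u (Suc k) * gR' (Suc k) (of_real r * u (Suc k))) (at r)) \<and>
     (\<forall>r M. r > 0 \<longrightarrow> (\<forall>z. z \<notin> star D \<longrightarrow> r / 2 \<le> norm z \<longrightarrow> norm z \<le> r \<longrightarrow> norm (f z) \<le> M) \<longrightarrow>
       norm (G (of_real r * u k) - G (of_real r * u (Suc k))) \<le> 2 * M * r)" if k: "k < D" for k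
    using sector_primitive[OF D(2) k hol lim(1)[OF k, unfolded u_def] cont(1)[OF k, unfolded u_def]
        lim'[OF k, unfolded u_def] cont'[OF k, unfolded u_def]] unfolding u_def by metis
  then obtain G where
     G1: "\<And>k r. k < D \<Longrightarrow> r > 0 \<Longrightarrow> ((\<lambda>r. G k (of_real r * u k)) has_vector_derivative u k * gL k (of_real r * u k)) (at r)"
     and G2: "\<And>k r. k < D \<Longrightarrow> r > 0 \<Longrightarrow> ((\<lambda>r. G k (of_real r * u (Suc k))) has_vector_derivative u (Suc k) * gR' (Suc k) (of_real r * u (Suc k))) (at r)"
     and G3: "\<And>k r M. k < D \<Longrightarrow> r > 0 \<Longrightarrow> (\<forall>z. z \<notin> star D \<longrightarrow> r / 2 \<le> norm z \<longrightarrow> norm z \<le> r \<longrightarrow> norm (f z) \<le> M) \<Longrightarrow>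
       norm (G k (of_real r * u k) - G k (of_real r * u (Suc k))) \<le> 2 * M * r"
    by metis
  define \<Delta> where "\<Delta> r = (\<Sum>k<D. G k (of_real r * u k) - G k (of_real r * u (Suc k)))" for r
  have "((\<lambda>r. \<Delta> r - (\<Sum>k<D. h k r)) has_vector_derivative 0) (at r within {0<..})" if r: "r > 0" for r
  proof -
    define q where "q k = u k * gR' k (of_real r * u k)" for k
    have "q D = q 0" using uD D0 by (simp add: q_def gR'_def)
    then have "(\<Sum>k<D. q (Suc k)) = (\<Sum>k<D. q k)"
      using sum_lessThan_telescope[of q D] by (simp add: sum_subtractf)
    moreover have "(\<Sum>k<D. udir D k * ((if k = D div 2 then - 1 else 1) * (fp (of_real r * udir D k) - fm (of_real r * udir D k))))
        = (\<Sum>k<D. u k * gL k (of_real r * u k)) - (\<Sum>k<D. q k)"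
      unfolding sum_subtractf[symmetric]
      by (intro sum.cong) (auto simp: q_def gR'_def gL_def gR_def u_def algebra_simps)
    ultimately have "(\<Sum>k<D. u k * gL k (of_real r * u k) - q (Suc k)) -
        (\<Sum>k<D. udir D k * ((if k = D div 2 then - 1 else 1) * (fp (of_real r * udir D k) - fm (of_real r * udir D k)))) = 0"
      by (simp add: sum_subtractf)
    moreover have "((\<lambda>r. \<Delta> r - (\<Sum>k<D. h k r)) has_vector_derivative
        (\<Sum>k<D. u k * gL k (of_real r * u k) - q (Suc k)) -
        (\<Sum>k<D. udir D k * ((if k = D div 2 then - 1 else 1) * (fp (of_real r * udir D k) - fm (of_real r * udir D k))))) (at r)"
      unfolding \<Delta>_def q_def
      by (intro has_vector_derivative_diff has_vector_derivative_sum G1 G2 h r) auto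
    ultimately show ?thesis by (simp add: has_vector_derivative_at_within)
  qed
  then obtain c where c: "\<And>r. r > 0 \<Longrightarrow> \<Delta> r - (\<Sum>k<D. h k r) = c"
    using has_vector_derivative_zero_constant[of "{0<..}" "\<lambda>r. \<Delta> r - (\<Sum>k<D. h k r)"] by auto
  have bound: "norm (\<Delta> r) \<le> real D * (2 * M * r)"
    if "r > 0" "\<And>z. z \<notin> star D \<Longrightarrow> r / 2 \<le> norm z \<Longrightarrow> norm z \<le> r \<Longrightarrow> norm (f z) \<le> M" for r M
    unfolding \<Delta>_def using that
    by (intro order_trans[OF norm_sum] order_trans[OF sum_bounded_above[of _ _ "2 * M * r"]] G3) auto
  obtain r0 M0 where r0: "r0 > 0" "\<And>z. z \<in> ball 0 r0 - star D \<Longrightarrow> norm (f z) \<le> M0"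
    using f unfolding ray_boundary_values_def bounded_iff by (metis imageI)
  have "((\<lambda>r. \<Delta> r) \<longlongrightarrow> 0) (at_right 0)"
  proof (rule Lim_null_comparison)
    have "\<forall>\<^sub>F r in at_right 0. 0 < r \<and> r < r0" using r0(1) unfolding eventually_at_right_field by blast
    then show "\<forall>\<^sub>F r in at_right 0. norm (\<Delta> r) \<le> real D * (2 * M0 * r)"
      by eventually_elim (intro bound r0(2), auto)
    show "((\<lambda>r. real D * (2 * M0 * r)) \<longlongrightarrow> 0) (at_right 0)" by (auto intro!: tendsto_eq_intros)
  qed
  moreover have "\<forall>\<^sub>F r in at_right 0. \<Delta> r - c = (\<Sum>k<D. h k r)"
    using eventually_at_right_less[of 0] by eventually_elim (simp flip: c)
  ultimately have l0: "((\<lambda>r. \<Sum>k<D. h k r) \<longlongrightarrow> - c) (at_right 0)"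
    using tendsto_diff[OF _ tendsto_const, of \<Delta> 0 "at_right 0" c] by (auto elim: Lim_transform_eventually)
  obtain B where "\<forall>\<^sub>F z in off_star_at_infinity D. norm (f z) \<le> B * norm (1 / z ^ 2)"
    using decay by (elim landau_o.bigE)
  then obtain b where b: "\<And>z. b \<le> norm z \<Longrightarrow> z \<notin> star D \<Longrightarrow> norm (f z) \<le> B * norm (1 / z ^ 2)"
    unfolding eventually_off_star by blast
  have "((\<lambda>r. \<Delta> r) \<longlongrightarrow> 0) at_top"
  proof (rule Lim_null_comparison)
    have "\<forall>\<^sub>F r in at_top. r > 0 \<and> r \<ge> 2 * b" using eventually_gt_at_top eventually_ge_at_top eventually_conj by blast
    then show "\<forall>\<^sub>F r in at_top. norm (\<Delta> r) \<le> real D * (8 * \<bar>B\<bar> / r)"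
    proof eventually_elim
      case (elim r)
      have "norm (\<Delta> r) \<le> real D * (2 * (\<bar>B\<bar> * (4 / r\<^sup>2)) * r)"
      proof (rule bound)
        fix z assume z: "z \<notin> star D" "r / 2 \<le> norm z"
        then have nz: "norm z > 0" "norm z \<ge> b" using elim by linarith+
        have "norm (f z) \<le> \<bar>B\<bar> * norm (1 / z ^ 2)"
          by (rule order_trans[OF b[OF nz(2) z(1)]]) (intro mult_right_mono, auto)
        also have "norm (1 / z ^ 2) = 1 / (norm z)\<^sup>2" by (simp add: norm_divide norm_power)
        also have "\<dots> \<le> 1 / (r / 2)\<^sup>2" using z nz elim by (intro divide_left_mono power_mono mult_pos_pos zero_less_power) auto
        also have "\<dots> = 4 / r\<^sup>2" by (simp add: power_divide)
        finally show "norm (f z) \<le> \<bar>B\<bar> * (4 / r\<^sup>2)" by (simp add: mult_left_mono)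
      qed (use elim in auto)
      also have "2 * (\<bar>B\<bar> * (4 / r\<^sup>2)) * r = 8 * \<bar>B\<bar> / r" using elim by (simp add: power2_eq_square field_simps)
      finally show ?case .
    qed
    show "((\<lambda>r. real D * (8 * \<bar>B\<bar> / r)) \<longlongrightarrow> 0) at_top"
      by (intro tendsto_mult_right_zero tendsto_divide_0[OF tendsto_const] filterlim_at_top_imp_at_infinity filterlim_ident)
  qed
  moreover have "\<forall>\<^sub>F r in at_top. \<Delta> r - c = (\<Sum>k<D. h k r)"
    using eventually_gt_at_top[of 0] by eventually_elim (simp flip: c)
  ultimately have "((\<lambda>r. \<Sum>k<D. h k r) \<longlongrightarrow> - c) at_top"
    using tendsto_diff[OF _ tendsto_const, of \<Delta> 0 at_top c] by (auto elim: Lim_transform_eventually)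
  then show ?thesis using l0 that by blast
qed

section \<open>Sibuya solutions\<close>

lemma cpoly_0 [simp]: "cpoly 0 z = 0"
  by (simp add: cpoly_def)

lemma cpoly_pCons [simp]: "cpoly (pCons a p) z = of_real a + z * cpoly p z"
  by (simp add: cpoly_def map_poly_pCons)

lemma cpoly_of_real [simp]: "cpoly p (of_real x) = of_real (poly p x)"
  by (induction p) auto

lemma cpoly_add [simp]: "cpoly (p + q) z = cpoly p z + cpoly q z"
  by (induction p q rule: poly_induct2) (auto simp: algebra_simps)

lemma cpoly_smult [simp]: "cpoly (Polynomial.smult a p) z = of_real a * cpoly p z"
  by (induction p) (auto simp: algebra_simps)

lemma cpoly_minus [simp]: "cpoly (- p) z = - cpoly p z"
  by (induction p) auto

lemma cpoly_diff [simp]: "cpoly (p - q) z = cpoly p z - cpoly q z"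
  using cpoly_add[of p "- q" z] by simp

lemma cpoly_mult [simp]: "cpoly (p * q) z = cpoly p z * cpoly q z"
  by (induction p) (auto simp: algebra_simps)

lemma cpoly_has_field_derivative: "(cpoly p has_field_derivative cpoly (pderiv p) z) (at z)"
proof (induction p arbitrary: z)
  case 0
  have "cpoly 0 = (\<lambda>z. 0)" by (rule ext) simp
  then show ?case by simp
next
  case (pCons a p)
  have "((\<lambda>z. of_real a + z * cpoly p z) has_field_derivative (cpoly p z + z * cpoly (pderiv p) z)) (at z)"
    by (auto intro!: derivative_eq_intros pCons.IH)
  moreover have "cpoly (pCons a p) = (\<lambda>z. of_real a + z * cpoly p z)" by (rule ext) simp
  ultimately show ?case by (simp add: pderiv_pCons)
qed

lemma cpoly_holomorphic [holomorphic_intros]: "cpoly p holomorphic_on S"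
  using cpoly_has_field_derivative
  by (meson field_differentiable_at_within field_differentiable_def holomorphic_on_def)

lemma cpoly_eq_poly: "cpoly p = poly (map_poly of_real p)"
  by (simp add: cpoly_def fun_eq_iff)

text \<open>On the rays with \<open>u\<^sup>D = 1\<close> the real part of \<open>V\<close> behaves like \<open>\<gamma> r\<^sup>D\<close>.\<close>
lemma poly_exp_decay:
  fixes q :: "complex poly" and u :: complex
  assumes V: "degree V > 0" "lead_coeff V > 0" and u: "u ^ degree V = 1"
  shows "((\<lambda>r. poly q (of_real r * u) * exp (- cpoly V (of_real r * u))) \<longlongrightarrow> 0) at_top"
proof -
  define D \<gamma> where "D = degree V" and "\<gamma> = lead_coeff V"
  have nu: "norm u = 1"
    using u V(1) by (metis norm_one norm_power power_eq_1_iff norm_ge_zero less_irrefl abs_norm_cancel)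
  then have "u \<noteq> 0" by auto
  have ru: "filterlim (\<lambda>r. of_real r * u) at_infinity at_top"
    unfolding filterlim_at_infinity_conv_norm_at_top using nu
    by (auto simp: norm_mult intro: filterlim_abs_real filterlim_ident)
  have dV: "degree (map_poly complex_of_real V) = D" "lead_coeff (map_poly complex_of_real V) = of_real \<gamma>"
    by (simp_all add: D_def \<gamma>_def degree_map_poly coeff_map_poly)
  have "((\<lambda>r. poly (map_poly complex_of_real V) (of_real r * u) / (of_real r * u) ^ D) \<longlongrightarrow> of_real \<gamma>) at_top"
    using filterlim_compose[OF poly_divide_tendsto_aux[of "map_poly complex_of_real V"] ru] dV by simp
  then have "((\<lambda>r. Re (cpoly V (of_real r * u) / (of_real r * u) ^ D)) \<longlongrightarrow> Re (of_real \<gamma>)) at_top"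
    unfolding cpoly_def by (rule tendsto_Re)
  moreover have "(of_real r * u) ^ D = of_real (r ^ D)" for r
    using u by (simp add: power_mult_distrib D_def)
  ultimately have limV: "((\<lambda>r. Re (cpoly V (of_real r * u)) / r ^ D) \<longlongrightarrow> \<gamma>) at_top"
    by (simp add: Re_divide_of_real del: of_real_power)
  have \<gamma>: "\<gamma> > 0" "\<gamma> / 2 < \<gamma>" using V(2) by (simp_all add: \<gamma>_def)
  have evV: "\<forall>\<^sub>F r in at_top. \<gamma> / 2 * r \<le> Re (cpoly V (of_real r * u))"
    using order_tendstoD(1)[OF limV \<gamma>(2)] eventually_ge_at_top[of 1]
  proof eventually_elim
    case (elim r)
    have "r ^ 1 \<le> r ^ D" using elim V(1) by (intro power_increasing) (auto simp: D_def)
    then have "\<gamma> / 2 * r \<le> \<gamma> / 2 * r ^ D" using \<gamma> by (intro mult_left_mono) auto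
    also have "\<dots> \<le> Re (cpoly V (of_real r * u))" using elim by (simp add: field_simps)
    finally show ?case .
  qed
  define m where "m = degree q"
  have "((\<lambda>r. norm (poly q (of_real r * u) / (of_real r * u) ^ m)) \<longlongrightarrow> norm (lead_coeff q)) at_top"
    using filterlim_compose[OF poly_divide_tendsto_aux[of q] ru] unfolding m_def by (rule tendsto_norm)
  then have "\<forall>\<^sub>F r in at_top. norm (poly q (of_real r * u) / (of_real r * u) ^ m) < norm (lead_coeff q) + 1"
    by (rule order_tendstoD) simp
  then have evq: "\<forall>\<^sub>F r in at_top. norm (poly q (of_real r * u)) \<le> (norm (lead_coeff q) + 1) * r ^ m"
    using eventually_gt_at_top[of 0]
  proof eventually_elim
    case (elim r)
    then show ?case using nu by (simp add: norm_divide norm_mult norm_power field_simps)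
  qed
  define c where "c = (norm (lead_coeff q) + 1) * (2 / \<gamma>) ^ m"
  show ?thesis
  proof (rule Lim_null_comparison)
    show "\<forall>\<^sub>F r in at_top. norm (poly q (of_real r * u) * exp (- cpoly V (of_real r * u)))
        \<le> c * ((\<gamma> / 2 * r) ^ m / exp (\<gamma> / 2 * r))"
      using evV evq eventually_gt_at_top[of 0]
    proof eventually_elim
      case (elim r)
      have "norm (poly q (of_real r * u) * exp (- cpoly V (of_real r * u)))
          = norm (poly q (of_real r * u)) * exp (- Re (cpoly V (of_real r * u)))"
        by (simp add: norm_mult)
      also have "\<dots> \<le> ((norm (lead_coeff q) + 1) * r ^ m) * exp (- (\<gamma> / 2 * r))"
        using elim by (intro mult_mono) auto
      also have "\<dots> = c * ((\<gamma> / 2 * r) ^ m / exp (\<gamma> / 2 * r))"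
        using \<gamma> by (simp add: c_def exp_minus field_simps)
      finally show ?case .
    qed
    have "filterlim (\<lambda>r. \<gamma> / 2 * r) at_top at_top"
      using \<gamma> by (intro filterlim_tendsto_pos_mult_at_top[OF tendsto_const _ filterlim_ident]) auto
    from filterlim_compose[OF tendsto_power_div_exp_0 this, of m]
    show "((\<lambda>r. c * ((\<gamma> / 2 * r) ^ m / exp (\<gamma> / 2 * r))) \<longlongrightarrow> 0) at_top"
      by (rule tendsto_mult_right_zero)
  qed
qed

text \<open>The bisector of a Sibuya sector lies in it together with a tube of constant width: the coordinate
  \<open>\<phi>\<close> moves points by a bounded amount, which is a small angle far out. The tube, rather than
  the ray alone, is what Cauchy's estimate for the derivative requires.\<close>
lemma sibuya_sector_tube:
  assumes coord: "sibuya_coordinate V \<rho> \<phi> \<psi>" and D: "degree V = D" "D > 0"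
  shows "\<exists>R. \<forall>r\<ge>R. \<forall>z. dist z (of_real r * cis (pi * real k / real D)) \<le> 1 \<longrightarrow> z \<in> sibuya_sector D \<rho> \<psi> k"
proof -
  define u where "u = cis (pi * real k / real D)"
  have u: "norm u = 1" "u \<noteq> 0" by (auto simp: u_def)
  have \<rho>: "\<rho> > 0" "(\<lambda>z. \<phi> z / z - 1) \<in> O[at_infinity](\<lambda>z. 1 / z)"
    "\<forall>\<^sub>F z in at_infinity. \<psi> (\<phi> z) = z"
    "\<forall>z. \<rho> \<le> norm z \<longrightarrow> norm z / 2 \<le> norm (\<phi> z)"
    using coord unfolding sibuya_coordinate_def Let_def by blast+
  obtain c0 where c0: "\<forall>\<^sub>F z in at_infinity. norm (\<phi> z / z - 1) \<le> c0 * norm (1 / z)"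
    using \<rho>(2) by (elim landau_o.bigE)
  obtain b where b: "\<And>z. b \<le> norm z \<Longrightarrow> \<psi> (\<phi> z) = z" "\<And>z. b \<le> norm z \<Longrightarrow> norm (\<phi> z / z - 1) \<le> c0 * norm (1 / z)"
    using eventually_conj[OF \<rho>(3) c0] unfolding eventually_at_infinity by blast
  have "isCont Arg 1" by (rule continuous_at_Arg) auto
  then have "\<forall>\<^sub>F y in at 1. dist (Arg y) (Arg 1) < pi / real D"
    unfolding isCont_def using D(2) by (intro tendstoD) auto
  then obtain \<delta> where \<delta>: "\<delta> > 0" "\<And>y. y \<noteq> 1 \<Longrightarrow> dist y 1 < \<delta> \<Longrightarrow> \<bar>Arg y\<bar> < pi / real D"
    unfolding eventually_at by (auto simp: dist_real_def)
  have Arg_small: "\<bar>Arg y\<bar> \<le> pi / real D" if "dist y 1 < \<delta>" for y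
    using \<delta>(2)[of y] that by (cases "y = 1") auto
  \<comment> \<open>In a tube of radius \<open>1\<close> the modulus drops by at most \<open>1\<close>, so \<open>b + 1\<close> and \<open>2 * \<rho> + 1\<close> keep the estimates
    on \<open>\<phi>\<close> available; the last entry bounds the angle, as \<open>\<phi> z\<close> is within \<open>\<bar>c0\<bar> + 1\<close> of the
    given point of the bisector.\<close>
  define R where "R = Max {b + 1, 2 * \<rho> + 1, 2, 2 * (\<bar>c0\<bar> + 1) / min \<delta> 1}"
  have R: "b + 1 \<le> R" "2 * \<rho> + 1 \<le> R" "2 \<le> R" "2 * (\<bar>c0\<bar> + 1) / min \<delta> 1 \<le> R"
    unfolding R_def by (rule Max_ge; simp)+
  show ?thesis
  proof (intro exI[of _ R] allI impI)
    fix r z assume r: "R \<le> r" and "dist z (of_real r * cis (pi * real k / real D)) \<le> 1"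
    then have z: "norm (z - of_real r * u) \<le> 1" by (simp add: dist_norm u_def)
    have "norm (of_real r * u) = r" using u r R by (simp add: norm_mult)
    then have nz: "norm z \<ge> r - 1"
      using norm_triangle_ineq2[of "of_real r * u" z] z by (simp add: norm_minus_commute)
    have z0: "z \<noteq> 0" "b \<le> norm z" "2 * \<rho> \<le> norm z" using nz r R by auto
    define w where "w = \<phi> z"
    have "norm (w - z) = norm (\<phi> z / z - 1) * norm z"
    proof -
      have "(\<phi> z / z - 1) * z = w - z" using z0 by (simp add: w_def left_diff_distrib)
      then show ?thesis by (simp flip: norm_mult)
    qed
    also have "\<dots> \<le> (c0 * norm (1 / z)) * norm z" using b(2)[OF z0(2)] by (rule mult_right_mono) simp
    also have "\<dots> = c0" using z0 by (simp add: norm_divide)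
    finally have "norm (w - of_real r * u) \<le> \<bar>c0\<bar> + 1"
      using norm_triangle_ineq[of "w - z" "z - of_real r * u"] z by simp
    moreover have "dist (w / (of_real r * u)) 1 = norm (w - of_real r * u) / r"
    proof -
      have "w / (of_real r * u) - 1 = (w - of_real r * u) / (of_real r * u)"
        using u r R by (simp add: diff_divide_distrib)
      then show ?thesis using u r R by (simp add: dist_norm norm_divide norm_mult)
    qed
    ultimately have "dist (w / (of_real r * u)) 1 \<le> (\<bar>c0\<bar> + 1) / r"
      using r R by (simp add: divide_right_mono)
    also have "\<dots> < \<delta>"
    proof -
      have m: "min \<delta> 1 > 0" using \<delta> by simp
      have "2 * (\<bar>c0\<bar> + 1) / min \<delta> 1 \<le> r" using R(4) r by linarith
      then have "2 * (\<bar>c0\<bar> + 1) \<le> r * min \<delta> 1" using m by (simp add: pos_divide_le_eq)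
      also have "\<dots> \<le> r * \<delta>" using r R by (intro mult_left_mono) auto
      finally have "2 * (\<bar>c0\<bar> + 1) \<le> r * \<delta>" .
      moreover have "\<bar>c0\<bar> + 1 < 2 * (\<bar>c0\<bar> + 1)" by simp
      ultimately have "\<bar>c0\<bar> + 1 < r * \<delta>" by (rule order.strict_trans2[rotated])
      then show ?thesis using r R by (simp add: pos_divide_less_eq mult.commute)
    qed
    finally have arg: "\<bar>Arg (w / (of_real r * u))\<bar> \<le> pi / real D" by (rule Arg_small)
    have "\<rho> \<le> norm z" using \<rho>(1) z0(3) by linarith
    then have nw: "\<rho> \<le> norm w" using \<rho>(4)[rule_format, of z] z0(3) unfolding w_def by linarith
    define t where "t = pi * real k / real D + Arg (w / (of_real r * u))"
    have "w / (of_real r * u) \<noteq> 0" using nw \<rho>(1) u r R by auto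
    then have "w / (of_real r * u) = of_real (norm (w / (of_real r * u))) * cis (Arg (w / (of_real r * u)))"
      by (simp add: cis_Arg sgn_eq)
    moreover have "norm (w / (of_real r * u)) = norm w / r" using u r R by (simp add: norm_divide norm_mult)
    ultimately have "w / (of_real r * u) = of_real (norm w / r) * cis (Arg (w / (of_real r * u)))" by metis
    then have "w / (of_real r * u) * (of_real r * u) = of_real (norm w / r) * cis (Arg (w / (of_real r * u))) * (of_real r * u)"
      by (rule arg_cong)
    then have "w = of_real (norm w) * (u * cis (Arg (w / (of_real r * u))))"
      using u r R by (simp add: mult.commute mult.left_commute)
    also have "\<dots> = rcis (norm w) t" by (simp add: u_def t_def cis_mult rcis_def)
    finally have "w = rcis (norm w) t" .
    moreover have "pi * (real k - 1) / real D \<le> t" "t \<le> pi * (real k + 1) / real D"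
      using arg by (auto simp: t_def abs_le_iff diff_divide_distrib add_divide_distrib algebra_simps)
    ultimately have "w \<in> {rcis r t | r t. \<rho> \<le> r \<and> pi * (real k - 1) / real D \<le> t \<and> t \<le> pi * (real k + 1) / real D}"
      using nw by blast
    then show "z \<in> sibuya_sector D \<rho> \<psi> k" unfolding sibuya_sector_def using b(1)[OF z0(2)]
      by (auto simp: w_def intro!: image_eqI[of z \<psi> "\<phi> z"])
  qed
qed

lemma sibuya_solution_bounds:
  assumes coord: "sibuya_coordinate V \<rho> \<phi> \<psi>" and D: "degree V = D" "D \<ge> 3"
    and f: "sibuya_solution V lam \<rho> \<psi> k f"
  obtains R where "\<And>r. r \<ge> R \<Longrightarrow> norm (f (of_real r * cis (pi * real k / real D)) - 1) \<le> 1 / 2"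
    "\<And>r. r \<ge> R \<Longrightarrow> norm (deriv f (of_real r * cis (pi * real k / real D))) \<le> 2"
proof -
  define S where "S = sibuya_sector D \<rho> \<psi> k"
  have hol: "f holomorphic_on UNIV"
    and asym: "(\<lambda>z. f z - 1) \<in> O[inf at_infinity (principal S)](\<lambda>z. complex_of_real (norm z powi (2 - int D)))"
    using f D(1) unfolding sibuya_solution_def Let_def S_def by auto
  obtain c where "\<forall>\<^sub>F z in inf at_infinity (principal S). norm (f z - 1) \<le> c * norm (complex_of_real (norm z powi (2 - int D)))"
    using asym by (elim landau_o.bigE)
  then obtain b where b: "\<And>z. b \<le> norm z \<Longrightarrow> z \<in> S \<Longrightarrow> norm (f z - 1) \<le> c * norm (complex_of_real (norm z powi (2 - int D)))"
    unfolding eventually_inf_principal eventually_at_infinity by blast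
  obtain R0 where R0: "\<And>r z. r \<ge> R0 \<Longrightarrow> dist z (of_real r * cis (pi * real k / real D)) \<le> 1 \<Longrightarrow> z \<in> S"
    using sibuya_sector_tube[OF coord D(1), of k] D(2) unfolding S_def by auto
  define R where "R = Max {R0, b + 1, 2, 2 * \<bar>c\<bar> + 1}"
  have R: "R0 \<le> R" "b + 1 \<le> R" "2 \<le> R" "2 * \<bar>c\<bar> + 1 \<le> R" unfolding R_def by (rule Max_ge; simp)+
  have close: "norm (f z - 1) \<le> 1 / 2"
    if r: "r \<ge> R" and z: "dist z (of_real r * cis (pi * real k / real D)) \<le> 1" for r z
  proof -
    have "norm (of_real r * cis (pi * real k / real D)) = r" using r R by (simp add: norm_mult)
    then have nz: "norm z \<ge> r - 1"
      using norm_triangle_ineq2[of "of_real r * cis (pi * real k / real D)" z] z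
      by (simp add: dist_norm norm_minus_commute)
    then have z1: "norm z \<ge> 1" "norm z \<ge> b" "norm z \<ge> 2 * \<bar>c\<bar>" using r R by auto
    have e: "2 - int D = - int (D - 2)" using D(2) by simp
    have "norm z powi (2 - int D) = 1 / norm z ^ (D - 2)"
      unfolding e by (simp only: power_int_minus power_int_of_nat inverse_eq_divide)
    also have "\<dots> \<le> 1 / norm z ^ 1"
      using z1 D(2) by (intro divide_left_mono power_increasing mult_pos_pos zero_less_power) auto
    finally have p: "norm z powi (2 - int D) \<le> 1 / norm z" by simp
    have "norm (f z - 1) \<le> c * norm (complex_of_real (norm z powi (2 - int D)))"
      by (rule b[OF z1(2) R0[OF _ z]]) (use r R in linarith)
    also have "\<dots> = c * (norm z powi (2 - int D))"
      by (simp only: norm_of_real abs_of_nonneg zero_le_power_int norm_ge_zero)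
    also have "\<dots> \<le> \<bar>c\<bar> * (1 / norm z)" using p by (intro mult_mono) auto
    also have "\<dots> \<le> 1 / 2" using z1 by (auto simp: divide_simps)
    finally show ?thesis .
  qed
  show ?thesis
  proof
    fix r assume r: "r \<ge> R"
    let ?z = "of_real r * cis (pi * real k / real D)"
    show "norm (f ?z - 1) \<le> 1 / 2" by (rule close[OF r]) simp
    have "norm ((deriv ^^ 1) f ?z) \<le> fact 1 * 2 / 1 ^ 1"
    proof (rule Cauchy_inequality)
      show "norm (f x) \<le> 2" if "norm (?z - x) = 1" for x
        using close[OF r, of x] that norm_triangle_ineq[of "f x - 1" 1] by (simp add: dist_norm norm_minus_commute)
      show "f holomorphic_on ball ?z 1" by (rule holomorphic_on_subset[OF hol]) simp
      show "continuous_on (cball ?z 1) f"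
        by (rule continuous_on_subset[OF holomorphic_on_imp_continuous_on[OF hol]]) simp
    qed simp
    then show "norm (deriv f ?z) \<le> 2" by simp
  qed
qed

lemma sibuya_solution_even:
  assumes "sibuya_solution V lam \<rho> \<psi> k f" "even k" "lam > 0"
  shows "(f has_field_derivative deriv f z) (at z)"
    and "(deriv f has_field_derivative (cpoly (pderiv V) z * deriv f z + f z / of_real lam)) (at z)"
proof -
  have hol: "f holomorphic_on UNIV"
    and ode: "(-1) ^ k * cpoly (pderiv V) z * deriv f z - (deriv ^^ 2) f z + f z / of_real lam = 0" for z
    using assms(1) unfolding sibuya_solution_def Let_def by blast+
  show "(f has_field_derivative deriv f z) (at z)"
    by (rule holomorphic_derivI[OF hol]) auto
  have "deriv f holomorphic_on UNIV" by (rule holomorphic_deriv[OF hol]) auto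
  then have "(deriv f has_field_derivative deriv (deriv f) z) (at z)" by (rule holomorphic_derivI) auto
  moreover have "deriv (deriv f) z = cpoly (pderiv V) z * deriv f z + f z / of_real lam"
    using ode[of z] assms(2) by (simp add: numeral_2_eq_2 algebra_simps)
  ultimately show "(deriv f has_field_derivative (cpoly (pderiv V) z * deriv f z + f z / of_real lam)) (at z)"
    by simp
qed

lemma exp_cpoly_has_field_derivative:
  "((\<lambda>z. exp (- cpoly V z)) has_field_derivative - cpoly (pderiv V) z * exp (- cpoly V z)) (at z)"
  by (rule derivative_eq_intros refl cpoly_has_field_derivative)+ simp

text \<open>The equation says \<open>(e\<^bsup>-V\<^esup> f')' = e\<^bsup>-V\<^esup> f / \<lambda>\<close>. On the half-line in direction \<open>\<sigma>\<close> the derivative of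
  \<open>Re (\<sigma> e\<^bsup>-V\<^esup> f' f\<^sup>*)\<close>, with \<open>f\<^sup>*\<close> the conjugate, is \<open>e\<^bsup>-V\<^esup> (\<bar>f\<bar>\<^sup>2 / \<lambda> + \<bar>f'\<bar>\<^sup>2)\<close>. The
  quantity increases to its limit \<open>0\<close>, strictly where \<open>f\<close> is near \<open>1\<close>, so it starts below \<open>0\<close>.\<close>
lemma energy_negative:
  fixes \<sigma> :: real
  assumes f': "\<And>z. (f has_field_derivative f' z) (at z)"
    and f'': "\<And>z. (f' has_field_derivative (cpoly (pderiv V) z * f' z + f z / of_real lam)) (at z)"
    and lam: "lam > 0" and \<sigma>: "\<sigma>\<^sup>2 = 1" and V: "degree V > 0" "lead_coeff V > 0" "complex_of_real \<sigma> ^ degree V = 1"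
    and bd: "\<And>r. r \<ge> R \<Longrightarrow> norm (f (of_real r * of_real \<sigma>) - 1) \<le> 1 / 2" "\<And>r. r \<ge> R \<Longrightarrow> norm (f' (of_real r * of_real \<sigma>)) \<le> 2"
  shows "\<sigma> * Re (f' 0 * cnj (f 0)) < 0"
proof -
  define e where "e t = exp (- cpoly V (of_real t * of_real \<sigma>))" for t
  have e_real: "e t = of_real (exp (- poly V (t * \<sigma>)))" for t
    unfolding e_def by (simp flip: of_real_mult of_real_minus exp_of_real)
  define g where "g t = of_real \<sigma> * (e t * f' (of_real t * of_real \<sigma>)) * cnj (f (of_real t * of_real \<sigma>))" for t
  have line: "((\<lambda>t. of_real t * of_real \<sigma> :: complex) has_vector_derivative of_real \<sigma>) (at t)" for t
    by (auto intro!: derivative_eq_intros)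
  have chain: "((\<lambda>t. h (of_real t * of_real \<sigma>)) has_vector_derivative of_real \<sigma> * h' (of_real t * of_real \<sigma>)) (at t)"
    if "\<And>z. (h has_field_derivative h' z) (at z)" for h h' :: "complex \<Rightarrow> complex" and t
    using field_vector_diff_chain_at[OF line that] by (simp add: o_def)
  have d1: "((\<lambda>t. e t * f' (of_real t * of_real \<sigma>)) has_vector_derivative
      of_real \<sigma> * (e t * f (of_real t * of_real \<sigma>) / of_real lam)) (at t)" for t
    unfolding e_def
    by (rule chain[where h = "\<lambda>z. exp (- cpoly V z) * f' z" and h' = "\<lambda>z. exp (- cpoly V z) * f z / of_real lam"])
       (use DERIV_mult[OF exp_cpoly_has_field_derivative[of V] f''] in \<open>simp add: algebra_simps\<close>)
  have d2: "((\<lambda>t. cnj (f (of_real t * of_real \<sigma>))) has_vector_derivative cnj (of_real \<sigma> * f' (of_real t * of_real \<sigma>))) (at t)" for t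
    by (rule has_vector_derivative_cnj[OF chain[OF f']])
  define E where "E t = exp (- poly V (t * \<sigma>)) * ((norm (f (of_real t * of_real \<sigma>)))\<^sup>2 / lam + (norm (f' (of_real t * of_real \<sigma>)))\<^sup>2)" for t
  have gd: "(g has_vector_derivative of_real (E t)) (at t)" for t
  proof -
    let ?F = "f (of_real t * of_real \<sigma>)" and ?F' = "f' (of_real t * of_real \<sigma>)"
    have "(g has_vector_derivative
       (of_real \<sigma> * (e t * ?F') * cnj (of_real \<sigma> * ?F') + of_real \<sigma> * (of_real \<sigma> * (e t * ?F / of_real lam)) * cnj ?F)) (at t)"
      unfolding g_def by (intro has_vector_derivative_mult has_vector_derivative_mult_right d1 d2)
    also have "of_real \<sigma> * (e t * ?F') * cnj (of_real \<sigma> * ?F') + of_real \<sigma> * (of_real \<sigma> * (e t * ?F / of_real lam)) * cnj ?F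
      = of_real (\<sigma>\<^sup>2) * e t * (?F' * cnj ?F' + ?F * cnj ?F / of_real lam)"
      by (simp add: power2_eq_square algebra_simps)
    also have "\<dots> = of_real (E t)"
      unfolding \<sigma> e_real E_def complex_norm_square[symmetric] by (simp add: algebra_simps)
    finally show ?thesis .
  qed
  have dh: "((\<lambda>t. Re (g t)) has_real_derivative E t) (at t)" for t
    using has_field_derivative_Re[OF gd[of t]] by simp
  have E0: "E t \<ge> 0" for t unfolding E_def using lam by simp
  have lim: "((\<lambda>t. Re (g t)) \<longlongrightarrow> 0) at_top"
  proof (rule Lim_null_comparison)
    show "\<forall>\<^sub>F t in at_top. norm (Re (g t)) \<le> norm (poly 1 (of_real t * complex_of_real \<sigma>) * exp (- cpoly V (of_real t * of_real \<sigma>))) * 3"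
      using eventually_ge_at_top[of R]
    proof eventually_elim
      case (elim t)
      have "\<bar>\<sigma>\<bar> = 1" using \<sigma> by (auto simp: power2_eq_1_iff)
      have nf: "norm (f (of_real t * of_real \<sigma>)) \<le> 3 / 2"
        using bd(1)[OF elim] norm_triangle_ineq[of "f (of_real t * of_real \<sigma>) - 1" 1] by simp
      have "norm (Re (g t)) \<le> norm (g t)" using abs_Re_le_cmod by simp
      also have "\<dots> = norm (e t) * (norm (f' (of_real t * of_real \<sigma>)) * norm (f (of_real t * of_real \<sigma>)))"
        unfolding g_def using \<open>\<bar>\<sigma>\<bar> = 1\<close> by (simp add: norm_mult)
      also have "\<dots> \<le> norm (e t) * (2 * (3 / 2))"
        using bd(2)[OF elim] nf by (intro mult_left_mono mult_mono) auto
      finally show ?case by (simp add: e_def)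
    qed
    have "((\<lambda>t. norm (poly 1 (of_real t * complex_of_real \<sigma>) * exp (- cpoly V (of_real t * of_real \<sigma>))) * 3) \<longlongrightarrow> norm (0::complex) * 3) at_top"
      by (intro tendsto_intros poly_exp_decay V)
    then show "((\<lambda>t. norm (poly 1 (of_real t * complex_of_real \<sigma>) * exp (- cpoly V (of_real t * of_real \<sigma>))) * 3) \<longlongrightarrow> 0) at_top" by simp
  qed
  have mono: "Re (g a) \<le> Re (g b)" if "a \<le> b" for a b
    using DERIV_nonneg_imp_nondecreasing[OF that, of "\<lambda>t. Re (g t)"] dh E0 by blast
  define T where "T = max 0 R"
  have "Re (g (T + 1)) \<le> 0"
  proof (rule tendsto_lowerbound[OF lim])
    show "\<forall>\<^sub>F t in at_top. Re (g (T + 1)) \<le> Re (g t)"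
      using eventually_ge_at_top[of "T + 1"] by eventually_elim (rule mono)
  qed simp
  moreover have "Re (g T) < Re (g (T + 1))"
  proof (rule DERIV_pos_imp_increasing[of T "T + 1" "\<lambda>t. Re (g t)"])
    fix t assume "T \<le> t" "t \<le> T + 1"
    then have "norm (f (of_real t * of_real \<sigma>) - 1) \<le> 1 / 2" by (intro bd(1)) (simp add: T_def)
    then have "f (of_real t * of_real \<sigma>) \<noteq> 0" by auto
    then have "E t > 0" unfolding E_def using lam by (intro mult_pos_pos add_pos_nonneg) auto
    then show "\<exists>y. ((\<lambda>t. Re (g t)) has_real_derivative y) (at t) \<and> 0 < y" using dh by blast
  qed simp
  moreover have "Re (g 0) \<le> Re (g T)" by (rule mono) (simp add: T_def)
  ultimately have "Re (g 0) < 0" by linarith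
  moreover have "Re (g 0) = exp (- poly V 0) * (\<sigma> * Re (f' 0 * cnj (f 0)))"
    unfolding g_def e_real by (simp add: algebra_simps)
  ultimately show ?thesis by (simp add: mult_less_0_iff)
qed

section \<open>Weights, primitives and the connection formula\<close>

lemma sibuya_Y_even:
  assumes "even k"
  shows "sibuya_Y V lam F k z = \<i> ^ k * cis (- pi / 4) * exp (- cpoly V z / 2) * F k z"
  using assms by (simp add: sibuya_Y_def)

lemma sibuya_Y_even_deriv:
  assumes "even k" "\<And>z. (F k has_field_derivative F' z) (at z)"
  shows "deriv (sibuya_Y V lam F k) z =
    \<i> ^ k * cis (- pi / 4) * exp (- cpoly V z / 2) * (F' z - cpoly (pderiv V) z / 2 * F k z)"
proof (rule DERIV_imp_deriv)
  have "((\<lambda>z. exp (- cpoly V z / 2)) has_field_derivative exp (- cpoly V z / 2) * (- cpoly (pderiv V) z / 2)) (at z)"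
    by (intro DERIV_fun_exp DERIV_cdivide DERIV_minus cpoly_has_field_derivative)
  then have "((\<lambda>z. (\<i> ^ k * cis (- pi / 4)) * (exp (- cpoly V z / 2) * F k z)) has_field_derivative
     (\<i> ^ k * cis (- pi / 4)) * (exp (- cpoly V z / 2) * F' z + exp (- cpoly V z / 2) * (- cpoly (pderiv V) z / 2) * F k z)) (at z)"
    by (intro DERIV_cmult DERIV_mult' assms(2)) 
  moreover have "sibuya_Y V lam F k = (\<lambda>z. (\<i> ^ k * cis (- pi / 4)) * (exp (- cpoly V z / 2) * F k z))"
    using assms(1) by (auto simp: sibuya_Y_def fun_eq_iff)
  ultimately show "(sibuya_Y V lam F k has_field_derivative
      \<i> ^ k * cis (- pi / 4) * exp (- cpoly V z / 2) * (F' z - cpoly (pderiv V) z / 2 * F k z)) (at z)"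
    by (simp add: algebra_simps)
qed

lemma wronskian_sibuya_Y:
  assumes "even k" "\<And>z. (F k has_field_derivative F' k z) (at z)"
    and "even l" "\<And>z. (F l has_field_derivative F' l z) (at z)"
  shows "wronskian (sibuya_Y V lam F k) (sibuya_Y V lam F l) z =
    exp (- cpoly V z) * ((\<i> ^ k * cis (- pi / 4) * F k z) * (\<i> ^ l * cis (- pi / 4) * F' l z) -
      (\<i> ^ k * cis (- pi / 4) * F' k z) * (\<i> ^ l * cis (- pi / 4) * F l z))"
proof -
  have e: "exp (- cpoly V z) = exp (- cpoly V z / 2) * exp (- cpoly V z / 2)"
    by (simp flip: exp_add)
  show ?thesis
    unfolding wronskian_def sibuya_Y_even_deriv[where F = F and F' = "F' k", OF assms(1,2)]
      sibuya_Y_even_deriv[where F = F and F' = "F' l", OF assms(3,4)]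
      sibuya_Y_even[OF assms(1)] sibuya_Y_even[OF assms(3)] e
    by (simp add: algebra_simps)
qed

text \<open>\<open>\<lambda>\<close> times the operator of the Sibuya equation for even \<open>k\<close>. Integration by parts gives
  \<open>\<integral> p (sobolev_op V \<lambda> q) e\<^bsup>-V\<^esup> = \<langle>p, q\<rangle>\<close> with the Sobolev product on the right.\<close>
definition sobolev_op :: "real poly \<Rightarrow> real \<Rightarrow> real poly \<Rightarrow> real poly" where
  "sobolev_op V lam q = q + Polynomial.smult lam (pderiv V * pderiv q - pderiv (pderiv q))"

lemma degree_sobolev_op:
  assumes "degree V \<ge> 2"
  shows "degree (sobolev_op V lam q) \<le> degree q + degree V - 2"
proof (cases "degree q = 0")
  case True
  then have "pderiv q = 0" by (simp add: pderiv_eq_0_iff)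
  then show ?thesis using True assms by (simp add: sobolev_op_def)
next
  case False
  have "degree (pderiv V * pderiv q) \<le> degree q + degree V - 2"
    using degree_mult_le[of "pderiv V" "pderiv q"] False assms by (simp add: degree_pderiv)
  moreover have "degree (pderiv (pderiv q)) \<le> degree q + degree V - 2"
    using assms by (simp add: degree_pderiv)
  moreover have "degree q \<le> degree q + degree V - 2" using assms by simp
  ultimately show ?thesis unfolding sobolev_op_def
    by (meson degree_add_le degree_diff_le degree_smult_le order_trans)
qed

text \<open>The boundary term of Lagrange's identity for \<open>q\<close> and \<open>F\<^sub>k\<close>, with the constant factor
  of \<open>Y\<^sub>k\<close>.\<close>
definition sibuya_boundary_form where
  "sibuya_boundary_form V lam F q k z =
     - of_real lam * (\<i> ^ k * cis (- pi / 4)) * exp (- cpoly V z) * (cpoly (pderiv q) z * F k z - cpoly q z * deriv (F k) z)"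

lemma sibuya_boundary_form_has_field_derivative:
  assumes sol: "sibuya_solution V lam \<rho> \<psi> k (F k)" and k: "even k" and lam: "lam > 0"
  shows "(sibuya_boundary_form V lam F q k has_field_derivative
     sibuya_Y V lam F k z * exp (- cpoly V z / 2) * cpoly (sobolev_op V lam q) z) (at z)"
proof -
  note d = sibuya_solution_even[OF sol k lam]
  have e: "exp (- cpoly V z) = exp (- cpoly V z / 2) * exp (- cpoly V z / 2)"
    by (simp flip: exp_add)
  let ?e = "exp (- cpoly V z)" and ?V' = "cpoly (pderiv V) z" and ?q = "cpoly q z" and ?q' = "cpoly (pderiv q) z"
    and ?q'' = "cpoly (pderiv (pderiv q)) z" and ?F = "F k z" and ?F' = "deriv (F k) z"
    and ?c = "- of_real lam * (\<i> ^ k * cis (- pi / 4))"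
  have "((\<lambda>z. ?c * (exp (- cpoly V z) * (cpoly (pderiv q) z * F k z - cpoly q z * deriv (F k) z))) has_field_derivative
      ?c * (?e * ((?q' * ?F' + ?q'' * ?F) - (?q * (?V' * ?F' + ?F / of_real lam) + ?q' * ?F')) + (- ?V' * ?e) * (?q' * ?F - ?q * ?F'))) (at z)"
    by (intro DERIV_cmult DERIV_mult' DERIV_diff exp_cpoly_has_field_derivative cpoly_has_field_derivative d)
  moreover have "?c * (?e * ((?q' * ?F' + ?q'' * ?F) - (?q * (?V' * ?F' + ?F / of_real lam) + ?q' * ?F')) + (- ?V' * ?e) * (?q' * ?F - ?q * ?F'))
     = sibuya_Y V lam F k z * exp (- cpoly V z / 2) * cpoly (sobolev_op V lam q) z"
  proof -
    define x where "x = ?F / of_real lam"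
    have lx: "of_real lam * x = ?F" using lam by (simp add: x_def)
    have calc: "- l * y * (E * ((q1 * F1 + q2 * F0) - (q0 * (V1 * F1 + x) + q1 * F1)) + (- V1 * E) * (q1 * F0 - q0 * F1))
        = y * E * ((q0 + l * (V1 * q1 - q2)) * F0)" if "l * x = F0" for l y E q0 q1 q2 F0 F1 V1 x :: complex
      unfolding that[symmetric] by (simp add: algebra_simps)
    note calc[OF lx, of "\<i> ^ k * cis (- pi / 4)" ?e ?q' ?F' ?q'' ?q ?V']
    then show ?thesis by (simp add: x_def sibuya_Y_even[OF k] sobolev_op_def e algebra_simps)
  qed
  moreover have "sibuya_boundary_form V lam F q k = (\<lambda>z. ?c * (exp (- cpoly V z) * (cpoly (pderiv q) z * F k z - cpoly q z * deriv (F k) z)))"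
    by (simp add: sibuya_boundary_form_def fun_eq_iff mult.assoc)
  ultimately show ?thesis by simp
qed

lemma sibuya_boundary_form_decay:
  assumes coord: "sibuya_coordinate V \<rho> \<phi> \<psi>" and D: "degree V = D" "D \<ge> 3" and lc: "lead_coeff V > 0"
    and sol: "sibuya_solution V lam \<rho> \<psi> (2 * j) (F (2 * j))"
  shows "((\<lambda>r. sibuya_boundary_form V lam F q (2 * j) (of_real r * udir D j)) \<longlongrightarrow> 0) at_top"
proof -
  define u where "u = udir D j"
  have u: "u = cis (pi * real (2 * j) / real D)" unfolding u_def udir_def by (simp add: mult_ac)
  have uD: "u ^ degree V = 1" unfolding u_def using D by simp
  obtain R where R: "\<And>r. r \<ge> R \<Longrightarrow> norm (F (2 * j) (of_real r * u) - 1) \<le> 1 / 2"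
    "\<And>r. r \<ge> R \<Longrightarrow> norm (deriv (F (2 * j)) (of_real r * u)) \<le> 2"
    using sibuya_solution_bounds[OF coord D sol] unfolding u by blast
  let ?P = "\<lambda>q r. norm (poly (map_poly of_real q) (of_real r * u) * exp (- cpoly V (of_real r * u)))"
  show ?thesis unfolding u_def[symmetric]
  proof (rule Lim_null_comparison)
    show "\<forall>\<^sub>F r in at_top. norm (sibuya_boundary_form V lam F q (2 * j) (of_real r * u))
       \<le> \<bar>lam\<bar> * (?P (pderiv q) r * 2 + ?P q r * 2)"
      using eventually_ge_at_top[of R]
    proof eventually_elim
      case (elim r)
      let ?z = "of_real r * u"
      have F: "norm (F (2 * j) ?z) \<le> 2" using R(1)[OF elim] norm_triangle_ineq[of "F (2 * j) ?z - 1" 1] by simp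
      have "norm (sibuya_boundary_form V lam F q (2 * j) ?z) =
          \<bar>lam\<bar> * norm ((cpoly (pderiv q) ?z * exp (- cpoly V ?z)) * F (2 * j) ?z - (cpoly q ?z * exp (- cpoly V ?z)) * deriv (F (2 * j)) ?z)"
        unfolding sibuya_boundary_form_def
        by (simp add: norm_mult norm_power mult.commute[of _ "exp _"] mult.assoc right_diff_distrib[symmetric] del: norm_exp_eq_Re)
      also have "\<dots> \<le> \<bar>lam\<bar> * (norm ((cpoly (pderiv q) ?z * exp (- cpoly V ?z)) * F (2 * j) ?z) + norm ((cpoly q ?z * exp (- cpoly V ?z)) * deriv (F (2 * j)) ?z))"
        by (intro mult_left_mono norm_triangle_ineq4) simp
      also have "\<dots> \<le> \<bar>lam\<bar> * (?P (pderiv q) r * 2 + ?P q r * 2)"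
        unfolding norm_mult[of _ "F (2 * j) ?z"] norm_mult[of _ "deriv (F (2 * j)) ?z"] cpoly_def
        using F R(2)[OF elim] by (intro mult_left_mono add_mono) (auto simp: cpoly_def)
      finally show ?case .
    qed
    have "((\<lambda>r. \<bar>lam\<bar> * (?P (pderiv q) r * 2 + ?P q r * 2)) \<longlongrightarrow> \<bar>lam\<bar> * (norm (0::complex) * 2 + norm (0::complex) * 2)) at_top"
      by (intro tendsto_intros poly_exp_decay lc uD) (use D in auto)
    then show "((\<lambda>r. \<bar>lam\<bar> * (?P (pderiv q) r * 2 + ?P q r * 2)) \<longlongrightarrow> 0) at_top" by simp
  qed
qed

text \<open>If the Wronskian vanished, \<open>F\<^sub>0\<close> and \<open>F\<^sub>D\<close> would have the same logarithmic derivative at \<open>0\<close>, but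
  \<open>energy_negative\<close> gives its real part opposite signs: \<open>F\<^sub>0\<close> is close to \<open>1\<close> far out on the positive half-line, \<open>F\<^sub>D\<close> on
  the negative one.\<close>
lemma sibuya_wronskian_nonzero:
  assumes coord: "sibuya_coordinate V \<rho> \<phi> \<psi>" and D: "degree V = D" "D \<ge> 3" "even D" and lc: "lead_coeff V > 0" and lam: "lam > 0"
    and sol: "sibuya_solution V lam \<rho> \<psi> 0 (F 0)" "sibuya_solution V lam \<rho> \<psi> D (F D)"
  shows "F 0 0 * deriv (F D) 0 - deriv (F 0) 0 * F D 0 \<noteq> 0"
proof
  assume W: "F 0 0 * deriv (F D) 0 - deriv (F 0) 0 * F D 0 = 0"
  have 1: "1 * Re (deriv (F 0) 0 * cnj (F 0 0)) < 0"
  proof -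
    obtain R where R: "\<And>r. r \<ge> R \<Longrightarrow> norm (F 0 (of_real r * cis (pi * real 0 / real D)) - 1) \<le> 1 / 2"
      "\<And>r. r \<ge> R \<Longrightarrow> norm (deriv (F 0) (of_real r * cis (pi * real 0 / real D))) \<le> 2"
      using sibuya_solution_bounds[OF coord D(1,2) sol(1)] by blast
    show ?thesis
      by (rule energy_negative[OF sibuya_solution_even[OF sol(1) _ lam] lam, of 1 R]) (use R D lc in auto)
  qed
  have 2: "- 1 * Re (deriv (F D) 0 * cnj (F D 0)) < 0"
  proof -
    obtain R where R: "\<And>r. r \<ge> R \<Longrightarrow> norm (F D (of_real r * cis (pi * real D / real D)) - 1) \<le> 1 / 2"
      "\<And>r. r \<ge> R \<Longrightarrow> norm (deriv (F D) (of_real r * cis (pi * real D / real D))) \<le> 2"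
      using sibuya_solution_bounds[OF coord D(1,2) sol(2)] by blast
    have "cis (pi * real D / real D) = - 1" using D by simp
    then show ?thesis
      by (intro energy_negative[OF sibuya_solution_even[OF sol(2) D(3) lam] lam, of "-1" R]) (use R D lc in auto)
  qed
  have nz: "F 0 0 \<noteq> 0" "F D 0 \<noteq> 0" using 1 2 by auto
  define m where "m = deriv (F 0) 0 / F 0 0"
  have "deriv (F 0) 0 = m * F 0 0" "deriv (F D) 0 = m * F D 0"
    using W nz by (simp_all add: m_def field_simps)
  then have "Re (deriv (F 0) 0 * cnj (F 0 0)) = Re m * (norm (F 0 0))\<^sup>2"
    "Re (deriv (F D) 0 * cnj (F D 0)) = Re m * (norm (F D 0))\<^sup>2"
    by (simp_all add: mult.assoc complex_norm_square[symmetric] flip: of_real_power)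
  then have "Re m < 0" "Re m > 0" using 1 2 by (simp_all add: mult_less_0_iff zero_less_mult_iff)
  then show False by simp
qed

text \<open>The form depends linearly on the pair formed by \<open>Y\<^sub>k\<close> and its derivative at \<open>0\<close>, and \<open>\<beta>\<^sub>j\<close>, \<open>\<kappa>\<^sub>j\<close> are, by
  Cramer's rule, the coordinates of the pair of \<open>Y\<^bsub>2j\<^esub>\<close> in terms of those of \<open>Y\<^sub>0\<close> and \<open>Y\<^sub>D\<close>.\<close>
lemma sibuya_boundary_form_connection:
  assumes coord: "sibuya_coordinate V \<rho> \<phi> \<psi>" and D: "degree V = D" "D \<ge> 3" "even D" and lc: "lead_coeff V > 0" and lam: "lam > 0"
    and sol: "\<And>k. k < 2 * D \<Longrightarrow> sibuya_solution V lam \<rho> \<psi> k (F k)" and j: "j < D"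
  shows "sibuya_boundary_form V lam F q (2 * j) 0 =
    stokes_\<beta> V lam F j * sibuya_boundary_form V lam F q 0 0 + stokes_\<kappa> V lam F j * sibuya_boundary_form V lam F q D 0"
proof -
  define y where "y k = \<i> ^ k * cis (- pi / 4)" for k :: nat
  define a b where "a k = y k * F k 0" and "b k = y k * deriv (F k) 0" for k
  have der: "(F k has_field_derivative deriv (F k) z) (at z)" if "k < 2 * D" "even k" for k z
    by (rule sibuya_solution_even(1)[OF sol[OF that(1)] that(2) lam])
  have w: "wronskian (sibuya_Y V lam F k) (sibuya_Y V lam F l) 0 = exp (- cpoly V 0) * (a k * b l - b k * a l)"
    if "k < 2 * D" "even k" "l < 2 * D" "even l" for k l
    using wronskian_sibuya_Y[where F' = "\<lambda>k. deriv (F k)", OF that(2) der[OF that(1,2)] that(4) der[OF that(3,4)]]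
    by (simp add: a_def b_def y_def)
  have "F 0 0 * deriv (F D) 0 - deriv (F 0) 0 * F D 0 \<noteq> 0"
    by (rule sibuya_wronskian_nonzero[OF coord D lc lam]) (use sol D in auto)
  moreover have "a 0 * b D - b 0 * a D = y 0 * y D * (F 0 0 * deriv (F D) 0 - deriv (F 0) 0 * F D 0)"
    by (simp add: a_def b_def algebra_simps)
  ultimately have nz: "a 0 * b D - b 0 * a D \<noteq> 0" by (simp add: y_def)
  have \<beta>: "stokes_\<beta> V lam F j = - ((a D * b (2 * j) - b D * a (2 * j)) / (a 0 * b D - b 0 * a D))"
    unfolding stokes_\<beta>_def Let_def D(1) using D j by (simp add: w)
  have \<kappa>: "stokes_\<kappa> V lam F j = (a 0 * b (2 * j) - b 0 * a (2 * j)) / (a 0 * b D - b 0 * a D)"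
    unfolding stokes_\<kappa>_def Let_def D(1) using D j by (simp add: w)
  have cramer: "w * x2 = w * (s * x0 + t * xD)"
    if "w * s = - (aD * b2 - bD * a2)" "w * t = a0 * b2 - b0 * a2" "w = a0 * bD - b0 * aD"
       "(x0, xD, x2) = (a0, aD, a2) \<or> (x0, xD, x2) = (b0, bD, b2)"
    for w s t a0 aD a2 b0 bD b2 x0 xD x2 :: complex
  proof -
    have "w * (s * x0 + t * xD) = (w * s) * x0 + (w * t) * xD" by (simp add: algebra_simps)
    also have "\<dots> = w * x2"
      unfolding that(1,2) unfolding that(3) using that(4) by (auto simp: algebra_simps)
    finally show ?thesis by (rule sym)
  qed
  have w\<beta>: "(a 0 * b D - b 0 * a D) * stokes_\<beta> V lam F j = - (a D * b (2 * j) - b D * a (2 * j))"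
    unfolding \<beta> using nz by (simp add: minus_divide_left)
  have w\<kappa>: "(a 0 * b D - b 0 * a D) * stokes_\<kappa> V lam F j = a 0 * b (2 * j) - b 0 * a (2 * j)"
    unfolding \<kappa> using nz by simp
  have A: "a (2 * j) = stokes_\<beta> V lam F j * a 0 + stokes_\<kappa> V lam F j * a D"
  proof -
    have "(a 0 * b D - b 0 * a D) * a (2 * j) =
        (a 0 * b D - b 0 * a D) * (stokes_\<beta> V lam F j * a 0 + stokes_\<kappa> V lam F j * a D)"
      by (rule cramer[OF w\<beta> w\<kappa> refl]) simp
    then show ?thesis using nz by simp
  qed
  have B: "b (2 * j) = stokes_\<beta> V lam F j * b 0 + stokes_\<kappa> V lam F j * b D"
  proof -
    have "(a 0 * b D - b 0 * a D) * b (2 * j) =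
        (a 0 * b D - b 0 * a D) * (stokes_\<beta> V lam F j * b 0 + stokes_\<kappa> V lam F j * b D)"
      by (rule cramer[OF w\<beta> w\<kappa> refl]) simp
    then show ?thesis using nz by simp
  qed
  have form: "sibuya_boundary_form V lam F q k 0 =
      - of_real lam * exp (- cpoly V 0) * (cpoly (pderiv q) 0 * a k - cpoly q 0 * b k)" for k
    by (simp add: sibuya_boundary_form_def a_def b_def y_def algebra_simps)
  show ?thesis unfolding form A B by (simp add: algebra_simps)
qed

section \<open>Orthogonality from the Riemann--Hilbert problem\<close>

lemma indicator_ray:
  assumes "j < D" "k < D" "z \<in> open_ray (udir D k)"
  shows "indicator (ray D j) z = (if k = j then 1 else 0 :: complex)"
proof -
  have "z \<in> ray D k" "z \<noteq> 0" using assms(3) unfolding ray_minus_0[symmetric] by auto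
  then have "z \<in> ray D j \<longleftrightarrow> k = j" using ray_unique[OF assms(1,2)] by auto
  then show ?thesis by (simp add: indicator_def)
qed

lemma indicator_Reals_ray:
  assumes D: "even D" "D > 0" and k: "k < D" and z: "z \<in> open_ray (udir D k)"
  shows "indicator \<real> z = (if k = 0 then 1 else 0 :: complex) + (if k = D div 2 then 1 else 0)"
proof -
  have zk: "z \<in> ray D k" "z \<noteq> 0" using z unfolding ray_minus_0[symmetric] by auto
  have half: "udir D (D div 2) = -1" "D div 2 < D" "D div 2 \<noteq> 0" using D by (auto simp: udir_half elim!: evenE)
  have "z \<in> \<real> \<longleftrightarrow> k = 0 \<or> k = D div 2"
  proof
    assume "z \<in> \<real>"
    then obtain x where x: "z = of_real x" by (auto elim: Reals_cases)
    show "k = 0 \<or> k = D div 2"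
    proof (cases "x \<ge> 0")
      case True
      then have "z \<in> ray D 0" unfolding ray_eq using x by auto
      then show ?thesis using ray_unique[OF D(2) k zk(2) _ zk(1)] by auto
    next
      case False
      then have "z = of_real (- x) * udir D (D div 2)" "- x \<ge> 0" using x half by auto
      then have "z \<in> ray D (D div 2)" unfolding ray_eq by blast
      then show ?thesis using ray_unique[OF half(2) k zk(2) _ zk(1)] by auto
    qed
  next
    assume "k = 0 \<or> k = D div 2"
    then show "z \<in> \<real>" using z half unfolding open_ray_def by auto
  qed
  then show ?thesis using half by (auto simp: indicator_def)
qed

lemma weight_number_props:
  assumes "even D" "D \<ge> 4" "i \<in> {2..<D}"
  shows "weight_number D i < D" "weight_number D i \<noteq> D div 2"
  using assms by (auto simp: weight_number_def)

lemma poly_bigo_at_infinity: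
  fixes p :: "complex poly"
  assumes "degree p \<le> m"
  shows "poly p \<in> O[off_star_at_infinity D](\<lambda>z. z ^ m)"
proof -
  have "(\<lambda>z. \<Sum>i\<le>degree p. coeff p i * z ^ i) \<in> O[off_star_at_infinity D](\<lambda>z. z ^ m)"
  proof (rule big_sum_in_bigo)
    fix i assume "i \<in> {..degree p}"
    then have i: "i \<le> m" using assms by simp
    show "(\<lambda>z. coeff p i * z ^ i) \<in> O[off_star_at_infinity D](\<lambda>z. z ^ m)"
    proof (rule bigoI[of _ "norm (coeff p i)"])
      show "\<forall>\<^sub>F z in off_star_at_infinity D. norm (coeff p i * z ^ i) \<le> norm (coeff p i) * norm (z ^ m)"
        unfolding eventually_off_star norm_mult norm_power using i
        by (intro exI[of _ 1] allI impI mult_left_mono power_increasing) auto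
    qed
  qed
  then show ?thesis by (simp add: poly_altdef[abs_def])
qed

lemma field_derivative_along_ray:
  assumes "\<And>z. (h has_field_derivative h' z) (at z)"
  shows "((\<lambda>r. h (of_real r * u)) has_vector_derivative u * h' (of_real r * u)) (at r)"
proof -
  have "((\<lambda>r. of_real r * u) has_vector_derivative u) (at r)"
    by (auto intro!: derivative_eq_intros)
  from field_vector_diff_chain_at[OF this assms] show ?thesis by (simp add: o_def)
qed

text \<open>Row and column indices start at \<open>0\<close>, so this is the second row. Outside the first column of the jump matrix there are only
  the entries of the identity matrix, which leaves entire functions there; \<open>p\<close> and \<open>c i\<close> are
  identified by their growth.\<close>
lemma hat_second_row:
  assumes D: "even D" "D \<ge> 4" "degree V = D" and n: "n \<ge> 1"
    and sol: "solves_rhp_A_hat V lam F n B"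
  obtains p c fp fm where
    "\<And>z. z \<notin> star D \<Longrightarrow> B z $$ (1, 1) = poly p z" "degree p = n" "lead_coeff p = 1"
    "ray_boundary_values D (\<lambda>z. B z $$ (1, 0)) fp fm"
    "(\<lambda>z. B z $$ (1, 0)) \<in> O[off_star_at_infinity D](\<lambda>z. 1 / z ^ (n + D - 1))"
    "\<And>x. x \<in> star D - {0} \<Longrightarrow> fp x - fm x =
       - (poly p x * (exp (- cpoly V x) * indicator \<real> x) + (\<Sum>i = 2..<D. c i * sibuya_weight V lam F (weight_number D i) x))"
proof -
  have D0: "D > 0" "1 < D" using D by auto
  define e where "e = (\<lambda>i::nat. if i = 0 then - int n - int D + 2 else if i = 1 then int n else 1)"
  obtain Bp Bm E where "rh_problem D (jump_A_hat V lam F) e B Bp Bm E"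
    using sol unfolding solves_rhp_A_hat_def D(3) e_def by (rule rh_solutionE)
  then interpret rh_problem D "jump_A_hat V lam F" e B Bp Bm E .
  have prod: "(M * jump_A_hat V lam F x) $$ (1, j) = (\<Sum>l<D. M $$ (1, l) * jump_A_hat V lam F x $$ (l, j))"
    if "M \<in> carrier_mat D D" "j < D" for M x j
    using that D0 D(3) by (simp add: scalar_prod_def lessThan_atLeast0 jump_A_hat_def Let_def)
  have col: "Bp x $$ (1, j) = Bm x $$ (1, j)" if x: "x \<in> star D - {0}" and j: "j < D" "j \<noteq> 0" for x j
  proof -
    have "Bp x $$ (1, j) = (\<Sum>l<D. Bm x $$ (1, l) * jump_A_hat V lam F x $$ (l, j))"
      using jump[OF x] prod[OF carrier_bdry(2)[OF x] j(1)] by simp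
    also have "\<dots> = (\<Sum>l<D. if l = j then Bm x $$ (1, l) else 0)"
      by (intro sum.cong) (use j D(3) in \<open>auto simp: jump_A_hat_def Let_def\<close>)
    also have "\<dots> = Bm x $$ (1, j)" using j by simp
    finally show ?thesis .
  qed
  have entire: "\<exists>h. h holomorphic_on UNIV \<and> (\<forall>z. z \<notin> star D \<longrightarrow> h z = B z $$ (1, j)) \<and> (\<forall>z \<in> star D - {0}. h z = Bm z $$ (1, j))"
    if j: "j < D" "j \<noteq> 0" for j
  proof -
    have "ray_boundary_values D (\<lambda>z. B z $$ (1, j)) (\<lambda>x. Bm x $$ (1, j)) (\<lambda>x. Bm x $$ (1, j))"
      by (rule ray_boundary_values_cong[OF D0(1) D(1) bdry[OF D0(2) j(1)]]) (use col j in auto)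
    then show ?thesis by (rule ray_boundary_values_no_jump[OF D(1) D0(1)]) blast
  qed
  have entry: "\<forall>\<^sub>F z in off_star_at_infinity D. z \<notin> star D \<and> z \<noteq> 0 \<and>
      (\<forall>j<D. B z $$ (1, j) = (1\<^sub>m D $$ (1, j) + E z $$ (1, j)) * z powi e j)"
    using asymp eventually_off_star_nonzero
  proof eventually_elim
    case (elim z)
    then show ?case using error_carrier[of z] D0 by (auto simp: mat_diag_mult_right[of _ D])
  qed
  obtain h where h: "h holomorphic_on UNIV" "\<And>z. z \<notin> star D \<Longrightarrow> h z = B z $$ (1, 1)" "\<And>z. z \<in> star D - {0} \<Longrightarrow> h z = Bm z $$ (1, 1)"
    using entire[of 1] D0 by auto
  have "(\<lambda>z. h z - z ^ n) \<in> O[off_star_at_infinity D](\<lambda>z. z ^ (n - 1))"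
  proof -
    have "(\<lambda>z. E z $$ (1, 1) * z ^ n) \<in> O[off_star_at_infinity D](\<lambda>z. 1 / z * z ^ n)"
      by (intro landau_o.big.mult error D0) auto
    moreover have "\<forall>\<^sub>F z in off_star_at_infinity D. 1 / z * z ^ n = z ^ (n - 1)"
      using eventually_off_star_nonzero by eventually_elim (use n in \<open>simp add: power_eq_if\<close>)
    moreover have "\<forall>\<^sub>F z in off_star_at_infinity D. h z - z ^ n = E z $$ (1, 1) * z ^ n"
      using entry
    proof eventually_elim
      case (elim z)
      then have "B z $$ (1, 1) = (1\<^sub>m D $$ (1, 1) + E z $$ (1, 1)) * z powi e 1" using D0 by blast
      then show ?case using h(2)[of z] elim D0 by (simp add: e_def algebra_simps power_int_of_nat)
    qed
    ultimately show ?thesis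
      using landau_o.big.in_cong landau_o.big.cong by fast
  qed
  moreover have "(\<lambda>z. h z - z ^ n) holomorphic_on UNIV" by (intro holomorphic_intros h)
  ultimately obtain p0 where p0: "degree p0 \<le> n - 1" "\<And>z. h z - z ^ n = poly p0 z"
    using entire_bound_off_star[OF D0(1)] by blast
  define p where "p = monom 1 n + p0"
  have hp: "h z = poly p z" for z using p0(2)[of z] by (simp add: p_def poly_monom algebra_simps)
  have dp: "degree p = n" unfolding p_def using p0(1) n by (subst degree_add_eq_left) (auto simp: degree_monom_eq)
  have lp: "lead_coeff p = 1"
    unfolding dp using p0(1) n by (simp add: p_def coeff_eq_0)
  have const: "\<exists>c. \<forall>z \<in> star D - {0}. Bm z $$ (1, j) = c" if j: "j < D" "j \<ge> 2" for j
  proof -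
    obtain g where g: "g holomorphic_on UNIV" "\<And>z. z \<notin> star D \<Longrightarrow> g z = B z $$ (1, j)" "\<And>z. z \<in> star D - {0} \<Longrightarrow> g z = Bm z $$ (1, j)"
      using entire[of j] j by auto
    have "(\<lambda>z. E z $$ (1, j) * z) \<in> O[off_star_at_infinity D](\<lambda>z. 1 / z * z)"
      by (intro landau_o.big.mult error D0 j) auto
    moreover have "\<forall>\<^sub>F z in off_star_at_infinity D. 1 / z * z = z ^ 0"
      using eventually_off_star_nonzero by eventually_elim simp
    moreover have "\<forall>\<^sub>F z in off_star_at_infinity D. g z = E z $$ (1, j) * z"
      using entry
    proof eventually_elim
      case (elim z)
      then have "B z $$ (1, j) = (1\<^sub>m D $$ (1, j) + E z $$ (1, j)) * z powi e j" using j by blast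
      then show ?case using g(2)[of z] elim j D0 by (simp add: e_def)
    qed
    ultimately have "g \<in> O[off_star_at_infinity D](\<lambda>z. z ^ 0)"
      using landau_o.big.in_cong landau_o.big.cong by fast
    then obtain q where q: "degree q \<le> 0" "\<And>z. g z = poly q z"
      using entire_bound_off_star[OF D0(1) g(1)] by blast
    then have "degree q = 0" by simp
    then obtain a where "q = [:a:]" by (rule degree_eq_zeroE)
    then have "g z = a" for z using q(2) by simp
    then have "\<forall>z \<in> star D - {0}. Bm z $$ (1, j) = a" using g(3) by metis
    then show ?thesis by blast
  qed
  then obtain c where c: "\<And>j z. j < D \<Longrightarrow> j \<ge> 2 \<Longrightarrow> z \<in> star D - {0} \<Longrightarrow> Bm z $$ (1, j) = c j"
    by metis
  show ?thesis
  proof (rule that[of p "\<lambda>x. Bp x $$ (1, 0)" "\<lambda>x. Bm x $$ (1, 0)" c])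
    show "B z $$ (1, 1) = poly p z" if "z \<notin> star D" for z using h(2)[OF that] hp by simp
    show "ray_boundary_values D (\<lambda>z. B z $$ (1, 0)) (\<lambda>x. Bp x $$ (1, 0)) (\<lambda>x. Bm x $$ (1, 0))"
      by (rule bdry) (use D0 in auto)
    show "(\<lambda>z. B z $$ (1, 0)) \<in> O[off_star_at_infinity D](\<lambda>z. 1 / z ^ (n + D - 1))"
    proof -
      have "(\<lambda>z. E z $$ (1, 0) * (1 / z ^ (n + D - 2))) \<in> O[off_star_at_infinity D](\<lambda>z. 1 / z * (1 / z ^ (n + D - 2)))"
        by (intro landau_o.big.mult error D0) auto
      moreover have "1 / z * (1 / z ^ (n + D - 2)) = 1 / z ^ (n + D - 1)" for z :: complex
      proof -
        have "n + D - 1 = Suc (n + D - 2)" using D0 n by simp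
        then show ?thesis by simp
      qed
      moreover have "\<forall>\<^sub>F z in off_star_at_infinity D. B z $$ (1, 0) = E z $$ (1, 0) * (1 / z ^ (n + D - 2))"
        using entry
      proof eventually_elim
        case (elim z)
        then have "B z $$ (1, 0) = (1\<^sub>m D $$ (1, 0) + E z $$ (1, 0)) * z powi e 0" using D0 by blast
        moreover have e0: "e 0 = - int (n + D - 2)" using D0 n by (simp add: e_def)
        have "z powi e 0 = 1 / z ^ (n + D - 2)"
          unfolding e0 by (simp only: power_int_minus power_int_of_nat inverse_eq_divide)
        ultimately show ?case using D0 by simp
      qed
      ultimately show ?thesis using landau_o.big.in_cong by (metis (no_types, lifting) ext)
    qed
    show "Bp x $$ (1, 0) - Bm x $$ (1, 0) = - (poly p x * (exp (- cpoly V x) * indicator \<real> x)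
       + (\<Sum>i = 2..<D. c i * sibuya_weight V lam F (weight_number D i) x))" if x: "x \<in> star D - {0}" for x
    proof -
      have "Bp x $$ (1, 0) = (\<Sum>l<D. Bm x $$ (1, l) * jump_A_hat V lam F x $$ (l, 0))"
        using jump[OF x] prod[OF carrier_bdry(2)[OF x] D0(1)] by simp
      also have "{..<D} = {0, 1} \<union> {2..<D}" using D0 by auto
      also have "(\<Sum>l\<in>{0, 1} \<union> {2..<D}. Bm x $$ (1, l) * jump_A_hat V lam F x $$ (l, 0))
        = (\<Sum>l\<in>{0, 1}. Bm x $$ (1, l) * jump_A_hat V lam F x $$ (l, 0)) + (\<Sum>l\<in>{2..<D}. Bm x $$ (1, l) * jump_A_hat V lam F x $$ (l, 0))"
        by (rule sum.union_disjoint) auto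
      also have "(\<Sum>l\<in>{0, 1}. Bm x $$ (1, l) * jump_A_hat V lam F x $$ (l, 0))
        = Bm x $$ (1, 0) - poly p x * (exp (- cpoly V x) * indicator \<real> x)"
        using D0 D(3) h(3)[OF x] hp[of x] by (simp add: jump_A_hat_def Let_def)
      also have "(\<Sum>l\<in>{2..<D}. Bm x $$ (1, l) * jump_A_hat V lam F x $$ (l, 0))
        = (\<Sum>l\<in>{2..<D}. - (c l * sibuya_weight V lam F (weight_number D l) x))"
        by (intro sum.cong) (use D(3) D0 c x in \<open>auto simp: jump_A_hat_def Let_def\<close>)
      finally show ?thesis by (simp add: sum_negf)
    qed
  qed (use dp lp in auto)
qed

text \<open>The vanishing of \<open>\<integral> p s e\<^bsup>-V\<^esup>\<close> over the real line, expressed through a primitive \<open>\<Theta>\<close> of the integrand.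
  All contributions of the weights are boundary terms: they cancel at the origin by
  \<open>sibuya_boundary_form_connection\<close> and decay at infinity.\<close>
lemma hat_second_row_moments:
  assumes D: "even D" "D \<ge> 4" "degree V = D" and lam: "lam > 0" and lc: "lead_coeff V > 0"
    and coord: "sibuya_coordinate V \<rho> \<phi> \<psi>"
    and sib: "\<And>k. k < 2 * D \<Longrightarrow> sibuya_solution V lam \<rho> \<psi> k (F k)"
    and n: "n \<ge> 1" and sol: "solves_rhp_A_hat V lam F n B"
  obtains p where "\<And>z. z \<notin> star D \<Longrightarrow> B z $$ (1, 1) = poly p z" "degree p = n" "lead_coeff p = 1"
    "\<And>q \<Theta>. degree q < n \<Longrightarrow>
       (\<And>z. (\<Theta> has_field_derivative (poly p z * cpoly (sobolev_op V lam q) z * exp (- cpoly V z))) (at z)) \<Longrightarrow>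
       ((\<lambda>r. \<Theta> (of_real r) - \<Theta> (- of_real r)) \<longlongrightarrow> 0) at_top"
proof -
  obtain p c fp fm where
    p: "\<And>z. z \<notin> star D \<Longrightarrow> B z $$ (1, 1) = poly p z" "degree p = n" "lead_coeff p = 1"
    and bv: "ray_boundary_values D (\<lambda>z. B z $$ (1, 0)) fp fm"
    and decay: "(\<lambda>z. B z $$ (1, 0)) \<in> O[off_star_at_infinity D](\<lambda>z. 1 / z ^ (n + D - 1))"
    and jump: "\<And>x. x \<in> star D - {0} \<Longrightarrow> fp x - fm x =
       - (poly p x * (exp (- cpoly V x) * indicator \<real> x) + (\<Sum>i = 2..<D. c i * sibuya_weight V lam F (weight_number D i) x))"
    by (rule hat_second_row[OF D n sol]) blast
  have half: "udir D (D div 2) = -1" "D div 2 < D" "D div 2 \<noteq> 0" using D by (auto simp: udir_half elim!: evenE)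
  note wn = weight_number_props[OF D(1,2)]
  show ?thesis
  proof (rule that[OF p])
    fix q \<Theta>
    assume q: "degree q < n"
      and \<Theta>: "\<And>z. (\<Theta> has_field_derivative (poly p z * cpoly (sobolev_op V lam q) z * exp (- cpoly V z))) (at z)"
    define s where "s = cpoly (sobolev_op V lam q)"
    define \<Phi> where "\<Phi> = sibuya_boundary_form V lam F q"
    have \<Phi>: "(\<Phi> k has_field_derivative (sibuya_Y V lam F k z * exp (- cpoly V z / 2) * s z)) (at z)" if "k < 2 * D" "even k" for k z
      unfolding \<Phi>_def s_def by (rule sibuya_boundary_form_has_field_derivative[where F = F, OF sib[OF that(1)] that(2) lam])
    define \<beta> \<kappa> where "\<beta> i = stokes_\<beta> V lam F (weight_number D i)" and "\<kappa> i = stokes_\<kappa> V lam F (weight_number D i)" for i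
    \<comment> \<open>\<open>on m g k\<close> places the function \<open>g\<close> on the ray number \<open>m\<close>, as a function of the ray number \<open>k\<close>, and \<open>T\<close> distributes
      the terms of the jump over the rays. It is linear, so it maps primitives of the terms to primitives.\<close>
    define on where "on m g k z = (if k = m then g z else 0)" for m k :: nat and g :: "complex \<Rightarrow> complex" and z
    define T where "T g \<omega> k z = on 0 g k z + on (D div 2) g k z + (\<Sum>i = 2..<D. c i *
      (on (weight_number D i) (\<omega> (2 * weight_number D i)) k z - \<beta> i * on 0 (\<omega> 0) k z + \<kappa> i * on (D div 2) (\<omega> D) k z))"
      for g :: "complex \<Rightarrow> complex" and \<omega> k z
    define g' where "g' z = poly p z * s z * exp (- cpoly V z)" for z
    define \<omega>' where "\<omega>' k z = sibuya_Y V lam F k z * exp (- cpoly V z / 2) * s z" for k z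
    have on_deriv: "(on m g k has_field_derivative on m g' k z) (at z)"
      if "(g has_field_derivative g' z) (at z)" for m k g g' z
      using that unfolding on_def[abs_def] by (cases "k = m") auto
    have \<Theta>': "(\<Theta> has_field_derivative g' z) (at z)" for z using \<Theta> by (simp add: g'_def s_def)
    have X: "(T \<Theta> \<Phi> k has_field_derivative T g' \<omega>' k z) (at z)" for k z
      unfolding T_def[abs_def]
      by (intro DERIV_add DERIV_sum DERIV_cmult DERIV_diff on_deriv \<Theta>' \<Phi>[folded \<omega>'_def])
         (use wn D in auto)
    have jump_T: "s z * (fp z - fm z) = - T g' \<omega>' k z" if k: "k < D" and z: "z \<in> open_ray (udir D k)" for k z
    proof -
      have zs: "z \<in> star D - {0}" using z open_ray_udir_subset_star[OF k] by blast
      have w: "s z * sibuya_weight V lam F (weight_number D i) z =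
          on (weight_number D i) (\<omega>' (2 * weight_number D i)) k z - \<beta> i * on 0 (\<omega>' 0) k z + \<kappa> i * on (D div 2) (\<omega>' D) k z"
        if "i \<in> {2..<D}" for i
        using indicator_ray[OF wn(1)[OF that] k z] indicator_ray[of 0, OF _ k z] indicator_ray[OF half(2) k z] D
        by (simp add: sibuya_weight_def Let_def \<beta>_def \<kappa>_def on_def \<omega>'_def algebra_simps)
      have "s z * (\<Sum>i = 2..<D. c i * sibuya_weight V lam F (weight_number D i) z) =
         (\<Sum>i = 2..<D. c i * (s z * sibuya_weight V lam F (weight_number D i) z))"
        unfolding sum_distrib_left by (simp only: mult.left_commute)
      also have "\<dots> = T g' \<omega>' k z - (on 0 g' k z + on (D div 2) g' k z)"
        unfolding T_def by (simp add: w)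
      finally show ?thesis
        unfolding jump[OF zs] using indicator_Reals_ray[OF D(1) _ k z] D by (auto simp: on_def g'_def algebra_simps split: if_splits)
    qed
    \<comment> \<open>The negative half-line is oriented towards the origin.\<close>
    define \<sigma> where "\<sigma> k = (if k = D div 2 then - 1 else 1 :: complex)" for k
    define h where "h k r = - \<sigma> k * T \<Theta> \<Phi> k (of_real r * udir D k)" for k and r :: real
    have sbv: "ray_boundary_values D (\<lambda>z. s z * B z $$ (1, 0)) (\<lambda>z. s z * fp z) (\<lambda>z. s z * fm z)"
      by (rule ray_boundary_values_mult[OF ray_boundary_values_entire bv]) (simp add: s_def holomorphic_intros)
    have sdecay: "(\<lambda>z. s z * B z $$ (1, 0)) \<in> O[off_star_at_infinity D](\<lambda>z. 1 / z ^ 2)"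
    proof -
      have "degree (map_poly complex_of_real (sobolev_op V lam q)) \<le> n + D - 3"
        using degree_sobolev_op[of V lam q] q D map_poly_degree_leq[of complex_of_real "sobolev_op V lam q"] by linarith
      then have "s \<in> O[off_star_at_infinity D](\<lambda>z. z ^ (n + D - 3))"
        unfolding s_def cpoly_eq_poly by (rule poly_bigo_at_infinity)
      then have "(\<lambda>z. s z * B z $$ (1, 0)) \<in> O[off_star_at_infinity D](\<lambda>z. z ^ (n + D - 3) * (1 / z ^ (n + D - 1)))"
        using decay by (rule landau_o.big.mult)
      moreover have "\<forall>\<^sub>F z in off_star_at_infinity D. z ^ (n + D - 3) * (1 / z ^ (n + D - 1)) = 1 / z ^ 2"
        using eventually_off_star_nonzero
      proof eventually_elim
        case (elim z)
        have "n + D - 1 = (n + D - 3) + 2" using D by simp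
        then show ?case using elim by (simp add: power_add power2_eq_square)
      qed
      ultimately show ?thesis using landau_o.big.cong by fast
    qed
    have hder: "(h k has_vector_derivative udir D k *
      ((if k = D div 2 then - 1 else 1) * (s (of_real r * udir D k) * fp (of_real r * udir D k) - s (of_real r * udir D k) * fm (of_real r * udir D k)))) (at r)"
      if k: "k < D" and r: "r > 0" for k r
    proof -
      let ?z = "of_real r * udir D k"
      have "?z \<in> open_ray (udir D k)" using r unfolding open_ray_def by blast
      then have eq: "s ?z * fp ?z - s ?z * fm ?z = - T g' \<omega>' k ?z" using jump_T[OF k] by (simp flip: right_diff_distrib)
      have "udir D k * (\<sigma> k * (- T g' \<omega>' k ?z)) = - \<sigma> k * (udir D k * T g' \<omega>' k ?z)" by simp
      moreover have "(h k has_vector_derivative - \<sigma> k * (udir D k * T g' \<omega>' k ?z)) (at r)"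
        unfolding h_def by (intro has_vector_derivative_mult_right field_derivative_along_ray X)
      ultimately show ?thesis unfolding eq \<sigma>_def by (simp only:)
    qed
    obtain l where l: "((\<lambda>r. \<Sum>k<D. h k r) \<longlongrightarrow> l) (at_right 0)" "((\<lambda>r. \<Sum>k<D. h k r) \<longlongrightarrow> l) at_top"
      by (rule ray_jump_primitives[OF D(1,2) sbv sdecay hder]) auto
    have total: "(\<Sum>k<D. h k r) = - (\<Theta> (of_real r) - \<Theta> (- of_real r)) -
       (\<Sum>i = 2..<D. c i * (\<Phi> (2 * weight_number D i) (of_real r * udir D (weight_number D i))
          - \<beta> i * \<Phi> 0 (of_real r) - \<kappa> i * \<Phi> D (- of_real r)))" for r
    proof -
      let ?z = "\<lambda>k. of_real r * udir D k"
      have pick: "(\<Sum>k<D. \<sigma> k * on m g k (?z k)) = \<sigma> m * g (?z m)" if "m < D" for m and g :: "complex \<Rightarrow> complex"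
      proof -
        have "(\<Sum>k<D. \<sigma> k * on m g k (?z k)) = (\<Sum>k<D. if k = m then \<sigma> m * g (?z m) else 0)"
          by (intro sum.cong) (auto simp: on_def)
        then show ?thesis using that by simp
      qed
      have pick_real: "(\<Sum>k<D. \<sigma> k * on 0 g k (?z k)) = g (of_real r)"
        "(\<Sum>k<D. \<sigma> k * on (D div 2) g k (?z k)) = - g (- of_real r)" for g :: "complex \<Rightarrow> complex"
        using pick[of 0 g] pick[OF half(2), of g] half by (simp_all add: \<sigma>_def)
      have pick_weight: "(\<Sum>k<D. \<sigma> k * on (weight_number D i) g k (?z k)) = g (?z (weight_number D i))"
        if "i \<in> {2..<D}" for i g
        using pick[OF wn(1)[OF that], of g] wn(2)[OF that] by (simp add: \<sigma>_def)
      have "(\<Sum>k<D. \<sigma> k * T \<Theta> \<Phi> k (?z k)) =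
         (\<Sum>k<D. \<sigma> k * on 0 \<Theta> k (?z k)) + (\<Sum>k<D. \<sigma> k * on (D div 2) \<Theta> k (?z k)) +
         (\<Sum>i = 2..<D. c i * ((\<Sum>k<D. \<sigma> k * on (weight_number D i) (\<Phi> (2 * weight_number D i)) k (?z k))
          - \<beta> i * (\<Sum>k<D. \<sigma> k * on 0 (\<Phi> 0) k (?z k)) + \<kappa> i * (\<Sum>k<D. \<sigma> k * on (D div 2) (\<Phi> D) k (?z k))))"
        unfolding T_def distrib_left sum.distrib sum_distrib_left right_diff_distrib sum_subtractf
          sum.swap[of _ "{2..<D}" "{..<D}"] by (simp only: mult_ac)
      also have "\<dots> = \<Theta> (of_real r) - \<Theta> (- of_real r) +
         (\<Sum>i = 2..<D. c i * (\<Phi> (2 * weight_number D i) (?z (weight_number D i))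
          - \<beta> i * \<Phi> 0 (of_real r) - \<kappa> i * \<Phi> D (- of_real r)))"
        unfolding pick_real by (simp add: pick_weight)
      finally show ?thesis unfolding h_def by (simp add: sum_negf)
    qed
    have cont: "((\<lambda>r. g (of_real r * u)) \<longlongrightarrow> g 0) (at_right 0)"
      if "\<And>z. (g has_field_derivative g' z) (at z)" for g g' :: "complex \<Rightarrow> complex" and u
    proof -
      have "((\<lambda>r. of_real r * u) \<longlongrightarrow> of_real 0 * u) (at_right 0)" by (intro tendsto_intros)
      moreover have "isCont g (of_real 0 * u)" using that DERIV_isCont by blast
      ultimately show ?thesis using isCont_tendsto_compose[of "of_real 0 * u" g] by fastforce
    qed
    have c\<Theta>: "((\<lambda>r. \<Theta> (of_real r)) \<longlongrightarrow> \<Theta> 0) (at_right 0)" "((\<lambda>r. \<Theta> (- of_real r)) \<longlongrightarrow> \<Theta> 0) (at_right 0)"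
      using cont[OF \<Theta>, of 1] cont[OF \<Theta>, of "- 1"] by simp_all
    have c\<Phi>: "((\<lambda>r. \<Phi> k (of_real r * u)) \<longlongrightarrow> \<Phi> k 0) (at_right 0)" if "k < 2 * D" "even k" for k u
      by (rule cont[OF \<Phi>[OF that]])
    have "((\<lambda>r. \<Sum>k<D. h k r) \<longlongrightarrow> - (\<Theta> 0 - \<Theta> 0) -
       (\<Sum>i = 2..<D. c i * (\<Phi> (2 * weight_number D i) 0 - \<beta> i * \<Phi> 0 0 - \<kappa> i * \<Phi> D 0))) (at_right 0)"
      unfolding total
    proof (intro tendsto_intros c\<Theta>)
      fix i assume i: "i \<in> {2..<D}"
      show "((\<lambda>r. \<Phi> (2 * weight_number D i) (of_real r * udir D (weight_number D i))) \<longlongrightarrow> \<Phi> (2 * weight_number D i) 0) (at_right 0)"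
        by (rule c\<Phi>) (use wn(1)[OF i] in auto)
      show "((\<lambda>r. \<Phi> 0 (of_real r)) \<longlongrightarrow> \<Phi> 0 0) (at_right 0)" using c\<Phi>[of 0 1] D by simp
      show "((\<lambda>r. \<Phi> D (- of_real r)) \<longlongrightarrow> \<Phi> D 0) (at_right 0)" using c\<Phi>[of D "- 1"] D by simp
    qed
    moreover have "(\<Sum>i = 2..<D. c i * (\<Phi> (2 * weight_number D i) 0 - \<beta> i * \<Phi> 0 0 - \<kappa> i * \<Phi> D 0)) = 0"
    proof (rule sum.neutral, rule ballI)
      fix i assume i: "i \<in> {2..<D}"
      have "\<Phi> (2 * weight_number D i) 0 = \<beta> i * \<Phi> 0 0 + \<kappa> i * \<Phi> D 0"
        unfolding \<Phi>_def \<beta>_def \<kappa>_def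
        by (rule sibuya_boundary_form_connection[OF coord D(3) _ D(1) lc lam sib wn(1)[OF i]]) (use D in auto)
      then show "c i * (\<Phi> (2 * weight_number D i) 0 - \<beta> i * \<Phi> 0 0 - \<kappa> i * \<Phi> D 0) = 0" by simp
    qed
    ultimately have "((\<lambda>r. \<Sum>k<D. h k r) \<longlongrightarrow> 0) (at_right 0)" by simp
    then have "l = 0" using tendsto_unique[OF _ l(1)] by simp
    have d\<Phi>: "((\<lambda>r. \<Phi> (2 * j) (of_real r * udir D j)) \<longlongrightarrow> 0) at_top" if "j < D" for j
      unfolding \<Phi>_def by (rule sibuya_boundary_form_decay[where F = F, OF coord D(3) _ lc sib]) (use D that in auto)
    have "((\<lambda>r. - (\<Sum>k<D. h k r) -
       (\<Sum>i = 2..<D. c i * (\<Phi> (2 * weight_number D i) (of_real r * udir D (weight_number D i))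
          - \<beta> i * \<Phi> 0 (of_real r) - \<kappa> i * \<Phi> D (- of_real r)))) \<longlongrightarrow> - l -
       (\<Sum>i = 2..<D. c i * (0 - \<beta> i * 0 - \<kappa> i * 0))) at_top"
    proof (intro tendsto_intros l(2))
      fix i assume i: "i \<in> {2..<D}"
      show "((\<lambda>r. \<Phi> (2 * weight_number D i) (of_real r * udir D (weight_number D i))) \<longlongrightarrow> 0) at_top"
        by (rule d\<Phi>[OF wn(1)[OF i]])
      show "((\<lambda>r. \<Phi> 0 (of_real r)) \<longlongrightarrow> 0) at_top" using d\<Phi>[of 0] D by simp
      show "((\<lambda>r. \<Phi> D (- of_real r)) \<longlongrightarrow> 0) at_top" using d\<Phi>[OF half(2)] half D(1) by simp
    qed
    then show "((\<lambda>r. \<Theta> (of_real r) - \<Theta> (- of_real r)) \<longlongrightarrow> 0) at_top"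
      unfolding total \<open>l = 0\<close> by simp
  qed
qed

section \<open>The Sobolev inner product\<close>

lemma integrable_inverse_1_plus_square: "integrable lborel (\<lambda>x::real. 1 / (1 + x\<^sup>2))"
proof -
  have "set_integrable lborel (einterval (-\<infinity>) \<infinity>) (\<lambda>x::real. 1 / (1 + x\<^sup>2))"
  proof (rule interval_integral_FTC_nonneg)
    show "DERIV arctan x :> 1 / (1 + x\<^sup>2)" for x
      using DERIV_arctan[of x] by (simp add: inverse_eq_divide)
    show "isCont (\<lambda>x::real. 1 / (1 + x\<^sup>2)) x" for x
      by (intro continuous_intros) (simp add: add_nonneg_eq_0_iff)
    show "((arctan \<circ> real_of_ereal) \<longlongrightarrow> - (pi / 2)) (at_right (- \<infinity>))"
      "((arctan \<circ> real_of_ereal) \<longlongrightarrow> pi / 2) (at_left \<infinity>)"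
      unfolding ereal_tendsto_simps by (rule tendsto_arctan_at_bot tendsto_arctan_at_top)+
  qed auto
  then show ?thesis by (simp add: set_integrable_def)
qed

lemma poly_exp_integrable:
  fixes V q :: "real poly"
  assumes V: "degree V > 0" "even (degree V)" "lead_coeff V > 0"
  shows "integrable lborel (\<lambda>x. poly q x * exp (- poly V x))"
proof -
  define g where "g x = (1 + x\<^sup>2) * (poly q x * exp (- poly V x))" for x
  have cg: "continuous_on UNIV g" unfolding g_def by (intro continuous_intros)
  define Q where "Q = map_poly complex_of_real ([:1, 0, 1:] * q)"
  have Q: "poly Q (of_real x) * exp (- cpoly V (of_real x)) = of_real (g x)" for x
  proof -
    have "poly Q (of_real x) = of_real (poly ([:1, 0, 1:] * q) x)"
      unfolding Q_def cpoly_def[symmetric] by (rule cpoly_of_real)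
    then show ?thesis by (simp add: g_def power2_eq_square exp_of_real[symmetric] algebra_simps)
  qed
  have lim: "((\<lambda>r. of_real (g (r * \<sigma>)) :: complex) \<longlongrightarrow> 0) at_top" if "complex_of_real \<sigma> ^ degree V = 1" for \<sigma>
    using poly_exp_decay[OF V(1,3) that, of Q] Q by (simp flip: of_real_mult)
  have ev: "\<exists>R. \<forall>r\<ge>R. \<bar>g (r * \<sigma>)\<bar> < 1" if "complex_of_real \<sigma> ^ degree V = 1" for \<sigma>
  proof -
    have "\<forall>\<^sub>F r in at_top. dist (of_real (g (r * \<sigma>)) :: complex) 0 < 1"
      by (rule tendstoD[OF lim[OF that]]) simp
    then show ?thesis unfolding eventually_at_top_linorder by (simp add: dist_norm)
  qed
  obtain R1 where R1: "\<And>r. r \<ge> R1 \<Longrightarrow> \<bar>g (r * 1)\<bar> < 1" using ev[of 1] by auto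
  obtain R2 where R2: "\<And>r. r \<ge> R2 \<Longrightarrow> \<bar>g (r * - 1)\<bar> < 1" using ev[of "- 1"] V(2) by auto
  have "bounded (g ` {- R2..R1})"
    by (intro compact_imp_bounded compact_continuous_image continuous_on_subset[OF cg]) auto
  then obtain M where "\<forall>y\<in>g ` {- R2..R1}. norm y \<le> M" unfolding bounded_iff by blast
  then have M: "\<bar>g x\<bar> \<le> M" if "x \<in> {- R2..R1}" for x using that by simp
  have bound: "\<bar>g x\<bar> \<le> max M 1" for x
    using M[of x] R1[of x] R2[of "- x"] by (cases "x \<in> {- R2..R1}") auto
  show ?thesis
  proof (rule Bochner_Integration.integrable_bound)
    show "integrable lborel (\<lambda>x::real. max M 1 * (1 / (1 + x\<^sup>2)))"
      by (intro integrable_mult_right integrable_inverse_1_plus_square)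
    show "(\<lambda>x. poly q x * exp (- poly V x)) \<in> borel_measurable lborel"
      by (auto intro!: borel_measurable_continuous_onI continuous_intros)
    have "norm (poly q x * exp (- poly V x)) \<le> norm (max M 1 * (1 / (1 + x\<^sup>2)))" for x
    proof -
      have "1 + x\<^sup>2 > 0" by (simp add: add_pos_nonneg)
      then show ?thesis using bound[of x] by (simp add: g_def abs_mult field_simps)
    qed
    then show "AE x in lborel. norm (poly q x * exp (- poly V x)) \<le> norm (max M 1 * (1 / (1 + x\<^sup>2)))" by simp
  qed
qed

lemma integral_eq_limit_primitive:
  fixes f F :: "real \<Rightarrow> real"
  assumes "integrable lborel f" "continuous_on UNIV f"
    and F: "\<And>x. (F has_real_derivative f x) (at x)"
    and lim: "((\<lambda>r. F r - F (- r)) \<longlongrightarrow> l) at_top"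
  shows "integral\<^sup>L lborel f = l"
proof -
  have l: "((\<lambda>r. LINT x|lborel. indicator {- r..r} x *\<^sub>R f x) \<longlongrightarrow> integral\<^sup>L lborel f) at_top"
  proof (rule integral_dominated_convergence_at_top[where w = "\<lambda>x. norm (f x)"])
    have "((\<lambda>r. indicator {- r..r} x *\<^sub>R f x) \<longlongrightarrow> f x) at_top" for x
    proof (rule tendsto_eventually)
      show "\<forall>\<^sub>F r in at_top. indicator {- r..r} x *\<^sub>R f x = f x"
        using eventually_ge_at_top[of "\<bar>x\<bar>"] by eventually_elim (auto simp: indicator_def abs_le_iff)
    qed
    then show "AE x in lborel. ((\<lambda>r. indicator {- r..r} x *\<^sub>R f x) \<longlongrightarrow> f x) at_top" by simp
  qed (use assms(1) in \<open>auto simp: indicator_def\<close>)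
  have ev: "\<forall>\<^sub>F r in at_top. (LINT x|lborel. indicator {- r..r} x *\<^sub>R f x) = F r - F (- r)"
    using eventually_ge_at_top[of 0]
  proof eventually_elim
    case (elim r)
    show ?case
    proof (rule integral_FTC_Icc)
      show "(F has_vector_derivative f x) (at x within {- r..r})" for x
        using F[of x] by (simp add: has_real_derivative_iff_has_vector_derivative has_vector_derivative_at_within)
      show "continuous_on {- r..r} f" by (rule continuous_on_subset[OF assms(2)]) simp
    qed (use elim in simp)
  qed
  show ?thesis
    by (rule tendsto_unique[OF trivial_limit_at_top_linorder tendsto_cong[OF ev, THEN iffD1, OF l] lim])
qed

context
  fixes V :: "real poly" and lam :: real
  assumes V: "degree V > 0" "even (degree V)" "lead_coeff V > 0" and lam: "lam > 0"
begin

lemma sobolev_inner_eq: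
  "sobolev_inner V lam a b = (LINT x|lborel. poly (a * b + Polynomial.smult lam (pderiv a * pderiv b)) x * exp (- poly V x))"
proof -
  have "(LINT x|lborel. poly (a * b + Polynomial.smult lam (pderiv a * pderiv b)) x * exp (- poly V x))
    = (LINT x|lborel. poly (a * b) x * exp (- poly V x) + lam * (poly (pderiv a * pderiv b) x * exp (- poly V x)))"
    by (intro Bochner_Integration.integral_cong) (auto simp: algebra_simps)
  also have "\<dots> = (LINT x|lborel. poly (a * b) x * exp (- poly V x)) + (LINT x|lborel. lam * (poly (pderiv a * pderiv b) x * exp (- poly V x)))"
    by (rule Bochner_Integration.integral_add[OF poly_exp_integrable[OF V] integrable_mult_right[OF poly_exp_integrable[OF V]]])
  finally show ?thesis by (simp add: sobolev_inner_def)
qed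

lemma sobolev_inner_commute: "sobolev_inner V lam a b = sobolev_inner V lam b a"
  unfolding sobolev_inner_eq by (simp only: mult.commute[of a] mult.commute[of "pderiv a"])

lemma sobolev_inner_diff: "sobolev_inner V lam (a - b) q = sobolev_inner V lam a q - sobolev_inner V lam b q"
proof -
  have "poly ((a - b) * q + Polynomial.smult lam (pderiv (a - b) * pderiv q)) x * exp (- poly V x) =
    poly (a * q + Polynomial.smult lam (pderiv a * pderiv q)) x * exp (- poly V x)
    - poly (b * q + Polynomial.smult lam (pderiv b * pderiv q)) x * exp (- poly V x)" for x
    by (simp add: pderiv_diff algebra_simps)
  then show ?thesis unfolding sobolev_inner_eq
    by (simp only: Bochner_Integration.integral_diff[OF poly_exp_integrable[OF V] poly_exp_integrable[OF V]])
qed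

lemma sobolev_inner_smult: "sobolev_inner V lam (Polynomial.smult c a) q = c * sobolev_inner V lam a q"
proof -
  have "poly (Polynomial.smult c a * q + Polynomial.smult lam (pderiv (Polynomial.smult c a) * pderiv q)) x * exp (- poly V x) =
    c * (poly (a * q + Polynomial.smult lam (pderiv a * pderiv q)) x * exp (- poly V x))" for x
    by (simp add: pderiv_smult algebra_simps)
  then show ?thesis unfolding sobolev_inner_eq
    by (simp only: Bochner_Integration.integral_mult_right_zero)
qed

lemma sobolev_inner_definite:
  assumes "sobolev_inner V lam a a = 0"
  shows "a = 0"
proof (rule ccontr)
  assume a: "a \<noteq> 0"
  let ?f = "\<lambda>x. poly (a * a + Polynomial.smult lam (pderiv a * pderiv a)) x * exp (- poly V x)"
  have "(\<integral>x. ?f x \<partial>lborel) = 0" using assms unfolding sobolev_inner_eq .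
  moreover have "AE x in lborel. 0 \<le> ?f x" using lam by (auto intro!: AE_I2 mult_nonneg_nonneg add_nonneg_nonneg)
  ultimately have "AE x in lborel. ?f x = 0"
    using integral_nonneg_eq_0_iff_AE[OF poly_exp_integrable[OF V]] by blast
  moreover have "AE x in lborel. x \<notin> {x. poly a x = 0}"
    by (intro AE_not_in finite_imp_null_set_lborel poly_roots_finite a)
  ultimately have "AE x in (lborel :: real measure). False"
  proof eventually_elim
    case (elim x)
    have "poly a x \<noteq> 0" using elim(2) by simp
    then have "poly a x * poly a x > 0" using not_real_square_gt_zero by blast
    moreover have "lam * (poly (pderiv a) x * poly (pderiv a) x) \<ge> 0" using lam by simp
    ultimately show False using elim(1) by simp
  qed
  then have "(UNIV :: real set) \<in> null_sets lborel"
    using AE_iff_null[of lborel "\<lambda>_::real. False"] by simp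
  then show False by (simp add: null_sets_def)
qed

lemma sobolev_orthogonal_lower_degree:
  assumes P: "monic_sobolev_orthogonal V lam P" and q: "\<And>i. i \<ge> m \<Longrightarrow> coeff q i = 0" and m: "m \<le> n"
  shows "sobolev_inner V lam q (P n) = 0"
  using q m
proof (induction m arbitrary: q)
  case 0
  then have "q = 0" by (intro poly_eqI) simp
  then show ?case by (simp add: sobolev_inner_def)
next
  case (Suc m)
  have Pm: "degree (P m) = m" "coeff (P m) m = 1" "sobolev_inner V lam (P m) (P n) = 0"
    using P Suc.prems(2) unfolding monic_sobolev_orthogonal_def by (metis, metis, metis Suc_n_not_le_n)
  define q' where "q' = q - Polynomial.smult (coeff q m) (P m)"
  have "coeff q' i = 0" if "i \<ge> m" for i
  proof (cases "i = m")
    case True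
    then show ?thesis using Pm by (simp add: q'_def)
  next
    case False
    then show ?thesis using that Pm(1) Suc.prems(1)[of i] by (simp add: q'_def coeff_eq_0)
  qed
  then have "sobolev_inner V lam q' (P n) = 0" using Suc.IH Suc.prems(2) by simp
  then show ?case by (simp add: q'_def sobolev_inner_diff sobolev_inner_smult Pm)
qed

text \<open>The primitives \<open>\<Theta>\<close> and \<open>T\<close>, of \<open>p s e\<^bsup>-V\<^esup>\<close> and of the integrand of the Sobolev product, differ by
  \<open>\<lambda> e\<^bsup>-V\<^esup> q' p\<close>, which decays. Real and imaginary parts of the coefficients of \<open>p\<close> are treated apart
  since the product is defined for real polynomials.\<close>
lemma moments_imp_sobolev_orthogonal:
  assumes moments: "\<And>q \<Theta>. degree q < n \<Longrightarrow>
       (\<And>z. (\<Theta> has_field_derivative (poly p z * cpoly (sobolev_op V lam q) z * exp (- cpoly V z))) (at z)) \<Longrightarrow>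
       ((\<lambda>r. \<Theta> (of_real r) - \<Theta> (- of_real r)) \<longlongrightarrow> 0) at_top"
    and q: "degree q < n"
  shows "sobolev_inner V lam (map_poly Re p) q = 0" "sobolev_inner V lam (map_poly Im p) q = 0"
proof -
  let ?S = "\<lambda>z. (poly p z * cpoly q z + of_real lam * (poly (pderiv p) z * cpoly (pderiv q) z)) * exp (- cpoly V z)"
  have "?S holomorphic_on UNIV" by (intro holomorphic_intros)
  then obtain T where T: "\<And>z. (T has_field_derivative ?S z) (at z)"
    using holomorphic_convex_primitive'[OF convex_UNIV open_UNIV] by auto
  define b where "b z = exp (- cpoly V z) * (cpoly (pderiv q) z * poly p z)" for z
  have b: "(b has_field_derivative exp (- cpoly V z) * (cpoly (pderiv q) z * poly (pderiv p) z + cpoly (pderiv (pderiv q)) z * poly p z)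
      + (- cpoly (pderiv V) z * exp (- cpoly V z)) * (cpoly (pderiv q) z * poly p z)) (at z)" for z
    unfolding b_def
    by (intro DERIV_mult' exp_cpoly_has_field_derivative cpoly_has_field_derivative poly_DERIV)
  have "((\<lambda>z. T z - of_real lam * b z) has_field_derivative poly p z * cpoly (sobolev_op V lam q) z * exp (- cpoly V z)) (at z)" for z
    using DERIV_diff[OF T DERIV_cmult[OF b]] by (rule DERIV_cong) (simp add: sobolev_op_def algebra_simps)
  from moments[OF q this]
  have lim: "((\<lambda>r. T (of_real r) - of_real lam * b (of_real r) - (T (- of_real r) - of_real lam * b (- of_real r))) \<longlongrightarrow> 0) at_top" .
  have bdecay: "((\<lambda>r. b (of_real r * u)) \<longlongrightarrow> 0) at_top" if "u ^ degree V = 1" for u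
    using poly_exp_decay[OF V(1,3) that, of "map_poly of_real (pderiv q) * p"]
    by (simp add: b_def cpoly_def mult_ac)
  have b0: "((\<lambda>r. b (of_real r)) \<longlongrightarrow> 0) at_top" "((\<lambda>r. b (- of_real r)) \<longlongrightarrow> 0) at_top"
    using bdecay[of 1] bdecay[of "- 1"] V(2) by simp_all
  have "((\<lambda>r. (T (of_real r) - of_real lam * b (of_real r) - (T (- of_real r) - of_real lam * b (- of_real r)))
      + (of_real lam * b (of_real r) - of_real lam * b (- of_real r))) \<longlongrightarrow> 0 + (of_real lam * 0 - of_real lam * 0)) at_top"
    by (intro tendsto_intros lim b0)
  then have limT: "((\<lambda>r. T (of_real r) - T (- of_real r)) \<longlongrightarrow> 0) at_top" by simp
  have split: "poly p (of_real x) = of_real (poly (map_poly Re p) x) + \<i> * of_real (poly (map_poly Im p) x)" for p x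
    by (induction p) (auto simp: map_poly_pCons complex_eq_iff algebra_simps)
  have pd: "map_poly Re (pderiv p) = pderiv (map_poly Re p)" "map_poly Im (pderiv p) = pderiv (map_poly Im p)"
    by (intro poly_eqI; simp add: coeff_map_poly coeff_pderiv)+
  have S: "?S (of_real x) =
      of_real (poly (map_poly Re p * q + Polynomial.smult lam (pderiv (map_poly Re p) * pderiv q)) x * exp (- poly V x))
      + \<i> * of_real (poly (map_poly Im p * q + Polynomial.smult lam (pderiv (map_poly Im p) * pderiv q)) x * exp (- poly V x))" for x
    unfolding split pd by (simp add: exp_of_real[symmetric] algebra_simps)
  have vd: "((\<lambda>x. T (of_real x)) has_vector_derivative ?S (of_real x)) (at x)" for x
    using field_derivative_along_ray[OF T, of 1 x] by simp
  have cint: "continuous_on UNIV (\<lambda>x. poly f x * exp (- poly V x))" for f by (intro continuous_intros)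
  show "sobolev_inner V lam (map_poly Re p) q = 0" unfolding sobolev_inner_eq
  proof (rule integral_eq_limit_primitive[OF poly_exp_integrable[OF V] cint, where F = "\<lambda>x. Re (T (of_real x))"])
    show "((\<lambda>x. Re (T (of_real x))) has_real_derivative
        poly (map_poly Re p * q + Polynomial.smult lam (pderiv (map_poly Re p) * pderiv q)) x * exp (- poly V x)) (at x)" for x
      using has_field_derivative_Re[OF vd[of x]] unfolding S by simp
    show "((\<lambda>r. Re (T (of_real r)) - Re (T (of_real (- r)))) \<longlongrightarrow> 0) at_top"
      using tendsto_Re[OF limT] by simp
  qed
  show "sobolev_inner V lam (map_poly Im p) q = 0" unfolding sobolev_inner_eq
  proof (rule integral_eq_limit_primitive[OF poly_exp_integrable[OF V] cint, where F = "\<lambda>x. Im (T (of_real x))"])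
    show "((\<lambda>x. Im (T (of_real x))) has_real_derivative
        poly (map_poly Im p * q + Polynomial.smult lam (pderiv (map_poly Im p) * pderiv q)) x * exp (- poly V x)) (at x)" for x
      using has_field_derivative_Im[OF vd[of x]] unfolding S by simp
    show "((\<lambda>r. Im (T (of_real r)) - Im (T (of_real (- r)))) \<longlongrightarrow> 0) at_top"
      using tendsto_Im[OF limT] by simp
  qed
qed

text \<open>Both \<open>Re p - P\<^sub>n\<close> and \<open>Im p\<close> have degree less than \<open>n\<close>, as \<open>p\<close> is monic, and are orthogonal to all polynomials
  of such degree, in particular to themselves.\<close>
lemma moments_characterize_sobolev:
  assumes P: "monic_sobolev_orthogonal V lam P" and n: "n \<ge> 1"
    and p: "degree p = n" "lead_coeff p = 1"
    and moments: "\<And>q \<Theta>. degree q < n \<Longrightarrow>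
       (\<And>z. (\<Theta> has_field_derivative (poly p z * cpoly (sobolev_op V lam q) z * exp (- cpoly V z))) (at z)) \<Longrightarrow>
       ((\<lambda>r. \<Theta> (of_real r) - \<Theta> (- of_real r)) \<longlongrightarrow> 0) at_top"
  shows "poly p z = cpoly (P n) z"
proof -
  note orth = moments_imp_sobolev_orthogonal[OF moments]
  have Pn: "degree (P n) = n" "coeff (P n) n = 1" using P unfolding monic_sobolev_orthogonal_def by metis+
  have low: "degree a < n" if "\<And>i. i \<ge> n \<Longrightarrow> coeff a i = 0" for a :: "real poly"
  proof (cases "a = 0")
    case False
    then have "coeff a (degree a) \<noteq> 0" by simp
    then show ?thesis using that not_le by blast
  qed (use n in simp)
  define a where "a = map_poly Re p - P n"
  have ca: "coeff a i = 0" if "i \<ge> n" for i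
    using that p Pn by (cases "i = n") (auto simp: a_def coeff_map_poly coeff_eq_0)
  have "sobolev_inner V lam a a = 0"
  proof -
    have "sobolev_inner V lam (map_poly Re p) a = 0" by (rule orth(1)) (use low[OF ca] in auto)
    moreover have "sobolev_inner V lam (P n) a = 0"
      using sobolev_orthogonal_lower_degree[OF P ca, of n] sobolev_inner_commute by simp
    ultimately show ?thesis unfolding a_def sobolev_inner_diff by simp
  qed
  then have re: "map_poly Re p = P n" using sobolev_inner_definite[of a] by (simp add: a_def)
  have ci: "coeff (map_poly Im p) i = 0" if "i \<ge> n" for i
    using that p by (cases "i = n") (auto simp: coeff_map_poly coeff_eq_0)
  have "sobolev_inner V lam (map_poly Im p) (map_poly Im p) = 0"
    by (rule orth(2)) (use low[OF ci] in auto)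
  then have im: "map_poly Im p = 0" by (rule sobolev_inner_definite)
  have "p = map_poly of_real (P n)"
  proof (rule poly_eqI)
    fix i
    have "Re (coeff p i) = coeff (P n) i" using arg_cong[OF re, of "\<lambda>f. coeff f i"] by (simp add: coeff_map_poly)
    moreover have "Im (coeff p i) = 0" using arg_cong[OF im, of "\<lambda>f. coeff f i"] by (simp add: coeff_map_poly)
    ultimately show "coeff p i = coeff (map_poly of_real (P n)) i" by (simp add: coeff_map_poly complex_eq_iff)
  qed
  then show ?thesis by (simp add: cpoly_def)
qed

end

section \<open>The inverse transpose\<close>

lemma jump_A_props:
  assumes "degree V = D" "D > 0"
  shows "jump_A V lam F x \<in> carrier_mat D D" "det (jump_A V lam F x) = 1"
    "jump_A_hat V lam F x \<in> carrier_mat D D"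
    "transpose_mat (jump_A_hat V lam F x) * jump_A V lam F x = 1\<^sub>m D"
proof -
  define v where "v j = (if j = 1 then exp (- cpoly V x) * indicator \<real> x else sibuya_weight V lam F (weight_number D j) x)" for j
  have J: "jump_A V lam F x = mat D D (\<lambda>(i, j). if i = j then 1 else if i = 0 then v j else 0)"
    unfolding jump_A_def Let_def assms by (intro eq_matI) (auto simp: v_def)
  have J': "jump_A_hat V lam F x = mat D D (\<lambda>(i, j). if i = j then 1 else if j = 0 then - v i else 0)"
    unfolding jump_A_hat_def Let_def assms by (intro eq_matI) (auto simp: v_def)
  show "jump_A V lam F x \<in> carrier_mat D D" "jump_A_hat V lam F x \<in> carrier_mat D D"
    unfolding J J' by auto
  have "det (jump_A V lam F x) = prod_list (diag_mat (jump_A V lam F x))"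
    by (rule det_upper_triangular[of _ D]) (auto simp: J)
  also have "\<dots> = (\<Prod>i<D. 1)"
    by (simp add: diag_mat_def J prod.distinct_set_conv_list[symmetric] lessThan_atLeast0)
  finally show "det (jump_A V lam F x) = 1" by simp
  show "transpose_mat (jump_A_hat V lam F x) * jump_A V lam F x = 1\<^sub>m D"
  proof (rule eq_matI)
    fix i j assume "i < dim_row (1\<^sub>m D :: complex mat)" "j < dim_col (1\<^sub>m D :: complex mat)"
    then have ij: "i < D" "j < D" by auto
    have "(transpose_mat (jump_A_hat V lam F x) * jump_A V lam F x) $$ (i, j) =
       (\<Sum>k<D. (if k = i then 1 else if i = 0 then - v k else 0) * (if k = j then 1 else if k = 0 then v j else 0))"
      unfolding J J' using ij by (simp add: scalar_prod_def lessThan_atLeast0)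
    also have "\<dots> = 1\<^sub>m D $$ (i, j)"
    proof (cases "i = 0 \<and> j \<noteq> 0")
      case True
      then have "(\<Sum>k<D. (if k = i then 1 else if i = 0 then - v k else 0) * (if k = j then 1 else if k = 0 then v j else 0))
         = (\<Sum>k<D. (if k = 0 then v j else 0) + (if k = j then - v j else 0))"
        by (intro sum.cong) auto
      then show ?thesis using True ij by (simp add: sum.distrib)
    next
      case False
      then have "(\<Sum>k<D. (if k = i then 1 else if i = 0 then - v k else 0) * (if k = j then 1 else if k = 0 then v j else 0))
         = (\<Sum>k<D. if k = i then (if i = j then 1 else 0) else 0)"
        by (intro sum.cong) auto
      then show ?thesis using ij by simp
    qed
    finally show "(transpose_mat (jump_A_hat V lam F x) * jump_A V lam F x) $$ (i, j) = 1\<^sub>m D $$ (i, j)" .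
  qed (auto simp: J J')
qed

theorem theorem2p40:
  fixes D n :: nat
    and \<gamma> lam \<rho> :: real
    and V :: "real poly"
    and \<phi> \<psi> :: "complex \<Rightarrow> complex"
    and F :: "nat \<Rightarrow> complex \<Rightarrow> complex"
    and A :: "complex \<Rightarrow> complex mat"
    and P :: "nat \<Rightarrow> real poly"
  assumes "even D" and "D \<ge> 4" and "lam > 0"
    and "degree V = D" and "lead_coeff V = \<gamma>" and "\<gamma> > 0"
    and "sibuya_coordinate V \<rho> \<phi> \<psi>"
    and "\<And>k. k < 2 * D \<Longrightarrow> sibuya_solution V lam \<rho> \<psi> k (F k)"
    and "monic_sobolev_orthogonal V lam P"
    and "n \<ge> 1"
    and "solves_rhp_A V lam F n A"
  shows "(\<forall>z \<in> - star D. invertible_mat (A z))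
    \<and> solves_rhp_A_hat V lam F n (\<lambda>z. transpose_mat (mat_inv (A z)))
    \<and> (\<forall>B. solves_rhp_A_hat V lam F n B \<longrightarrow>
          (\<forall>z \<in> - star D. B z = transpose_mat (mat_inv (A z))))
    \<and> (\<forall>z \<in> - star D.
          transpose_mat (mat_inv (A z)) $$ (1, 1) = mat_inv (A z) $$ (1, 1)
          \<and> mat_inv (A z) $$ (1, 1) = cpoly (P n) z)"
proof -
  have D: "even D" "D > 0" "1 < D" using assms(1,2) by auto
  define e where "e = (\<lambda>i::nat. if i = 0 then int n + int D - 2 else if i = 1 then - int n else - 1)"
  have e_sum: "(\<Sum>i<D. e i) = 0"
  proof -
    have "{..<D} = insert 0 (insert 1 {2..<D})" using D by auto
    then have "(\<Sum>i<D. e i) = e 0 + (e 1 + (\<Sum>i=2..<D. e i))" by simp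
    also have "(\<Sum>i=2..<D. e i) = (\<Sum>i=2..<D. - 1)" by (intro sum.cong) (auto simp: e_def)
    finally show ?thesis using assms(2) by (simp add: e_def)
  qed
  have e_neg: "(\<lambda>i. - e i) = (\<lambda>i. if i = 0 then - int n - int D + 2 else if i = 1 then int n else 1)"
    by (auto simp: e_def)
  note J = jump_A_props[OF assms(4) D(2), of lam F]
  have A: "rh_solution D (jump_A V lam F) e A"
    using assms(11) unfolding solves_rhp_A_def assms(4) e_def .
  have hat: "solves_rhp_A_hat V lam F n B \<longleftrightarrow> rh_solution D (jump_A_hat V lam F) (\<lambda>i. - e i) B" for B
    unfolding solves_rhp_A_hat_def assms(4) e_neg ..
  have "A z \<in> carrier_mat D D \<and> det (A z) = 1" if "z \<in> - star D" for z
    by (rule rh_solution_inverse_transpose(1)[where J' = "jump_A_hat V lam F", OF D(1,2) e_sum _ _ A that])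
       (use J in auto)
  then have Ainv: "A z \<in> carrier_mat D D" "det (A z) = 1" if "z \<in> - star D" for z
    using that by auto
  have sol: "solves_rhp_A_hat V lam F n (\<lambda>z. transpose_mat (mat_inv (A z)))"
    unfolding hat by (rule rh_solution_inverse_transpose(2)[OF D(1,2) e_sum _ _ A]) (use J in auto)
  have uniq: "B z = transpose_mat (mat_inv (A z))" if "solves_rhp_A_hat V lam F n B" "z \<in> - star D" for B z
    using that unfolding hat
    by (intro rh_solution_unique[OF D(1,2) e_sum _ _ A]) (use J in auto)
  obtain p where p: "\<And>z. z \<notin> star D \<Longrightarrow> transpose_mat (mat_inv (A z)) $$ (1, 1) = poly p z" "degree p = n" "lead_coeff p = 1"
    and moments: "\<And>q \<Theta>. degree q < n \<Longrightarrow>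
       (\<And>z. (\<Theta> has_field_derivative (poly p z * cpoly (sobolev_op V lam q) z * exp (- cpoly V z))) (at z)) \<Longrightarrow>
       ((\<lambda>r. \<Theta> (of_real r) - \<Theta> (- of_real r)) \<longlongrightarrow> 0) at_top"
    by (rule hat_second_row_moments[OF assms(1,2,4,3) _ assms(7,8,10) sol]) (use assms(5,6) in auto)
  have pP: "poly p z = cpoly (P n) z" for z
    by (rule moments_characterize_sobolev[OF _ _ _ assms(3,9,10) p(2,3) moments]) (use assms D in auto)
  have tr: "transpose_mat (mat_inv (A z)) $$ (1, 1) = mat_inv (A z) $$ (1, 1)" if "z \<in> - star D" for z
    using mat_inv_eq_adj_mat(1)[OF Ainv[OF that]] adj_mat(1)[OF Ainv(1)[OF that]] D by simp
  have inv: "invertible_mat (A z)" if "z \<in> - star D" for z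
    by (rule mat_inv_eq_adj_mat(2)[OF Ainv[OF that]])
  show ?thesis
  proof (intro conjI ballI allI impI)
    fix z assume z: "z \<in> - star D"
    show "invertible_mat (A z)" by (rule inv[OF z])
    show "transpose_mat (mat_inv (A z)) $$ (1, 1) = mat_inv (A z) $$ (1, 1)" by (rule tr[OF z])
    show "mat_inv (A z) $$ (1, 1) = cpoly (P n) z" using p(1)[of z] tr[OF z] pP[of z] z by simp
    show "B z = transpose_mat (mat_inv (A z))" if "solves_rhp_A_hat V lam F n B" for B
      by (rule uniq[OF that z])
  qed (rule sol)
qed

end
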